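(* Let $\mathbf{y}\in\mathrm{Im}(\Psi^\lambda_\iota)$. If $\mathbf{y}^\ast$ is extremal, then there exist $j_1,\ldots,j_l\in I$ and $\mathbf{x}\in\Sigma'_\iota[\lambda]$ such that $\mathbf{x}=\tilde{f}_{j_l}\cdots\tilde{f}_{j_1}\mathbf{y}$.
   Context: Let $\mathfrak{g}$ be the Kac-Moody algebra with generalized Cartan matrix $A=\begin{pmatrix}2&-a_1\\-a_2&2\end{pmatrix}$, $a_1,a_2\in\mathbb{Z}_{\geq1}$, $a_1a_2>4$, index set $I=\{1,2\}$, simple roots $\alpha_i$, simple coroots $\alpha_i^\vee$, fundamental weights $\Lambda_1,\Lambda_2$, Weyl group $W=\langle s_1,s_2\rangle$. Let $\iota^+=(\ldots,i_2,i_1)=(\ldots,2,1,2,1)$ and $\iota^-=(i_0,i_{-1},\ldots)=(2,1,2,1,\ldots)$, i.e. $i_k=1$ for $k$ odd and $i_k=2$ for $k$ even; $\iota=(\iota^+,\iota^-)$. Let $\lambda=k_1\Lambda_1-k_2\Lambda_2$ with $k_1,k_2\in\mathbb{Z}_{>0}$ such that: if $a_1,a_2\geq2$, either $k_2\leq k_1<(a_1-1)k_2$ or $k_1<k_2\leq(a_2-1)k_1$; if $a_1=1$, $2k_1\leq k_2\leq(a_2-2)k_1$; if $a_2=1$, $2k_2\leq k_1\leq(a_1-2)k_2$. Define integers $p_m$ by $p_0=k_2$, $p_1=k_1$, $p_{m+2}=a_2p_{m+1}-p_m$ ($m\ge0$ even), $p_{m+2}=a_1p_{m+1}-p_m$ ($m\ge0$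 odd), and for $m<0$: $p_m=a_2p_{m+1}-p_{m+2}$ ($m$ even), $p_m=a_1p_{m+1}-p_{m+2}$ ($m$ odd). Let $\alpha=\frac{a_1a_2+\sqrt{a_1^2a_2^2-4a_1a_2}}{2a_2}$, $\beta=\frac{a_1a_2+\sqrt{a_1^2a_2^2-4a_1a_2}}{2a_1}$, $\gamma_k=\alpha$ for $k$ even and $\gamma_k=\beta$ for $k$ odd. Let $\mathbb{Z}^{+\infty}_{\geq0}=\{(\ldots,x_2,x_1)\mid x_k\in\mathbb{Z}_{\ge0},\ x_k=0 \text{ for } k\gg0\}$ and $\mathbb{Z}^{-\infty}_{\leq0}=\{(x_0,x_{-1},\ldots)\mid x_k\in\mathbb{Z}_{\le0},\ x_k=0\text{ for }k\ll0\}$ with the Nakashima–Zelevinsky crystal structures associated to $\iota^\pm$, and $\mathbb{Z}_\iota(\lambda)=\mathbb{Z}^{+\infty}_{\geq0}\otimes\mathcal{T}_\lambda\otimes\mathbb{Z}^{-\infty}_{\leq0}$ (tensor product crystal; $\mathcal{T}_\lambda=\{t_\lambda\}$). There are crystal embeddings $\Psi^+_{\iota^+}:\mathcal{B}(\infty)\hookrightarrow\mathbb{Z}^{+\infty}_{\geq0}$ ($u_\infty\mapsto z_\infty=(\ldots,0,0)$), $\Psi^-_{\iota^-}:\mathcal{B}(-\infty)\hookrightarrow\mathbb{Z}^{-\infty}_{\leq0}$ ($u_{-\infty}\mapsto z_{-\infty}=(0,0,\ldots)$), and $\Psi^\lambda_\iota=\Psi^+_{\iota^+}\otimes\mathrm{id}\otimes\Psi^-_{\iota^-}:\mathcal{B}(\infty)\otimes\mathcal{T}_\lambda\otimes\mathcal{B}(-\infty)\hookrightarrow\mathbb{Z}_\iota(\lambda)$.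 The $\ast$-operation on $\mathrm{Im}(\Psi^\lambda_\iota)$ is transported from Kashiwara's $\ast$-operation; explicitly $(z_1\otimes t_\mu\otimes z_2)^\ast=z_1^\ast\otimes t_{-\mu-\mathrm{wt}(z_1)-\mathrm{wt}(z_2)}\otimes z_2^\ast$. For $\mathbf{x}=(\ldots,x_2,x_1)\otimes t_\lambda\otimes(x_0,x_{-1},\ldots)$ let $\zeta_k(\mathbf{x})=x_k$. Let $\Xi_\iota[\lambda]$ consist of $\gamma_0p_0+\gamma_0\zeta_0-\zeta_1$, $\gamma_1p_1+\zeta_0-\gamma_1\zeta_1$; for $k\ge1$: $p_k-\zeta_k$, $\gamma_k\zeta_k-\zeta_{k+1}$, $\gamma_{k+1}p_{k+1}-p_k+\zeta_k-\gamma_{k+1}\zeta_{k+1}$; for $k\le0$: $p_k+\zeta_k$, $\zeta_{k-1}-\gamma_k\zeta_k$, $\gamma_{k-1}p_{k-1}-p_k+\gamma_{k-1}\zeta_{k-1}-\zeta_k$. Set $\Sigma_\iota[\lambda]=\{\mathbf{x}\in\mathbb{Z}_\iota(\lambda)\mid\varphi(\mathbf{x})\ge0\ \forall\varphi\in\Xi_\iota[\lambda]\}$ and $\Sigma'_\iota[\lambda]=\{\hat{x}\otimes t_\lambda\otimes z_{-\infty}\in\Sigma_\iota[\lambda]\mid \hat{x}\in\mathrm{Im}(\Psi^+_{\iota^+})\}$. An element $b$ of a normal crystal is extremal if for all $w\in W$, $i\in I$: $\tilde{e}_i(S_wb)=0$ when $\langle\mathrm{wt}(S_wb),\alpha_i^\vee\rangle\ge0$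 and $\tilde{f}_i(S_wb)=0$ when $\langle\mathrm{wt}(S_wb),\alpha_i^\vee\rangle\le0$; here $S_ib=\tilde{f}_i^{n}b$ if $n=\langle\mathrm{wt}(b),\alpha_i^\vee\rangle\ge0$, $S_ib=\tilde{e}_i^{-n}b$ if $n\le0$, and $S_w=S_{j_1}\cdots S_{j_r}$ for $w=s_{j_1}\cdots s_{j_r}$. *)

theory Defs
  imports Complex_Main
begin

text \<open>Rank 2 Kac-Moody algebra with GCM A = [[2,-a1],[-a2,2]], index set I = {1,2} (as integers).
  Weights are represented by their pairings with the simple coroots:
  mu :: int \<times> int stands for the weight with <mu,h_1> = fst mu, <mu,h_2> = snd mu
  (faithful since det A \<noteq> 0). So Lambda_1 = (1,0), Lambda_2 = (0,1).
  An element  (..,x_2,x_1) \<otimes> t_mu \<otimes> (x_0,x_{-1},..)  of the tensor product crystal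
  Z^{+\<infinity>} \<otimes> T_mu \<otimes> Z^{-\<infinity>} is represented as a pair (zeta, mu) with zeta :: int \<Rightarrow> int,
  zeta k = x_k for all integers k. The zero element of a crystal is None.\<close>

definition cartan :: "int \<Rightarrow> int \<Rightarrow> int \<Rightarrow> int \<Rightarrow> int" where
  "cartan a1 a2 i j = (if i = j then 2 else if i = 1 then - a1 else - a2)"
  \<comment> \<open>cartan a1 a2 i j = <h_i, alpha_j> = a_{ij}\<close>

definition idx :: "int \<Rightarrow> int" where
  "idx k = (if odd k then 1 else 2)"

definition pairw :: "int \<Rightarrow> int \<times> int \<Rightarrow> int" where
  "pairw i mu = (if i = 1 then fst mu else snd mu)"

definition supp :: "(int \<Rightarrow> int) \<Rightarrow> int set" where
  "supp z = {k. z k \<noteq> 0}"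

subsection \<open>Nakashima-Zelevinsky crystal on Z^{+\<infinity>}_{\<ge>0} (indices k \<ge> 1)\<close>

definition sigmaP :: "int \<Rightarrow> int \<Rightarrow> int \<Rightarrow> (int \<Rightarrow> int) \<Rightarrow> int" where
  "sigmaP a1 a2 k z = z k + (\<Sum>j\<in>{j. k < j \<and> z j \<noteq> 0}. cartan a1 a2 (idx k) (idx j) * z j)"

definition sigP :: "int \<Rightarrow> int \<Rightarrow> int \<Rightarrow> (int \<Rightarrow> int) \<Rightarrow> int" where
  "sigP a1 a2 i z = Max ((\<lambda>k. sigmaP a1 a2 k z) ` {k. 1 \<le> k \<and> idx k = i})"

definition wtP :: "int \<Rightarrow> int \<Rightarrow> int \<Rightarrow> (int \<Rightarrow> int) \<Rightarrow> int" where
  "wtP a1 a2 i z = - (\<Sum>k\<in>{k. 1 \<le> k \<and> z k \<noteq> 0}. z k * cartan a1 a2 i (idx k))"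
  \<comment> \<open><h_i, wt z>, wt z = - sum_k x_k alpha_{i_k}\<close>

definition fP :: "int \<Rightarrow> int \<Rightarrow> int \<Rightarrow> (int \<Rightarrow> int) \<Rightarrow> (int \<Rightarrow> int)" where
  "fP a1 a2 i z = (let m = (LEAST k. 1 \<le> k \<and> idx k = i \<and> sigmaP a1 a2 k z = sigP a1 a2 i z)
                    in z(m := z m + 1))"

definition eP :: "int \<Rightarrow> int \<Rightarrow> int \<Rightarrow> (int \<Rightarrow> int) \<Rightarrow> (int \<Rightarrow> int) option" where
  "eP a1 a2 i z = (if sigP a1 a2 i z > 0 then
      (let m = (GREATEST k. 1 \<le> k \<and> idx k = i \<and> sigmaP a1 a2 k z = sigP a1 a2 i z)
       in Some (z(m := z m - 1)))
     else None)"

definition epsP :: "int \<Rightarrow> int \<Rightarrow> int \<Rightarrow> (int \<Rightarrow> int) \<Rightarrow> int" where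
  "epsP a1 a2 i z = sigP a1 a2 i z"

subsection \<open>Nakashima-Zelevinsky crystal on Z^{-\<infinity>}_{\<le>0} (indices k \<le> 0)\<close>

definition sigmaM :: "int \<Rightarrow> int \<Rightarrow> int \<Rightarrow> (int \<Rightarrow> int) \<Rightarrow> int" where
  "sigmaM a1 a2 k z = z k + (\<Sum>j\<in>{j. j < k \<and> z j \<noteq> 0}. cartan a1 a2 (idx k) (idx j) * z j)"

definition sigM :: "int \<Rightarrow> int \<Rightarrow> int \<Rightarrow> (int \<Rightarrow> int) \<Rightarrow> int" where
  "sigM a1 a2 i z = Min ((\<lambda>k. sigmaM a1 a2 k z) ` {k. k \<le> 0 \<and> idx k = i})"

definition wtM :: "int \<Rightarrow> int \<Rightarrow> int \<Rightarrow> (int \<Rightarrow> int) \<Rightarrow> int" where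
  "wtM a1 a2 i z = - (\<Sum>k\<in>{k. k \<le> 0 \<and> z k \<noteq> 0}. z k * cartan a1 a2 i (idx k))"

definition fM :: "int \<Rightarrow> int \<Rightarrow> int \<Rightarrow> (int \<Rightarrow> int) \<Rightarrow> (int \<Rightarrow> int) option" where
  "fM a1 a2 i z = (if sigM a1 a2 i z < 0 then
      (let m = (LEAST k. k \<le> 0 \<and> idx k = i \<and> sigmaM a1 a2 k z = sigM a1 a2 i z)
       in Some (z(m := z m + 1)))
     else None)"

definition eM :: "int \<Rightarrow> int \<Rightarrow> int \<Rightarrow> (int \<Rightarrow> int) \<Rightarrow> (int \<Rightarrow> int)" where
  "eM a1 a2 i z = (let m = (GREATEST k. k \<le> 0 \<and> idx k = i \<and> sigmaM a1 a2 k z = sigM a1 a2 i z)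
                    in z(m := z m - 1))"

definition phiM :: "int \<Rightarrow> int \<Rightarrow> int \<Rightarrow> (int \<Rightarrow> int) \<Rightarrow> int" where
  "phiM a1 a2 i z = - sigM a1 a2 i z"

definition epsM :: "int \<Rightarrow> int \<Rightarrow> int \<Rightarrow> (int \<Rightarrow> int) \<Rightarrow> int" where
  "epsM a1 a2 i z = phiM a1 a2 i z - wtM a1 a2 i z"

subsection \<open>Tensor product crystal Z^{+\<infinity>} \<otimes> T_mu \<otimes> Z^{-\<infinity>} (Kashiwara's tensor rule)\<close>

type_synonym elt = "(int \<Rightarrow> int) \<times> (int \<times> int)"

definition wtT :: "int \<Rightarrow> int \<Rightarrow> int \<Rightarrow> elt \<Rightarrow> int" where
  "wtT a1 a2 i b = wtP a1 a2 i (fst b) + pairw i (snd b) + wtM a1 a2 i (fst b)"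

definition phiL :: "int \<Rightarrow> int \<Rightarrow> int \<Rightarrow> elt \<Rightarrow> int" where
  \<comment> \<open>phi_i of the left factor z_1 \<otimes> t_mu\<close>
  "phiL a1 a2 i b = epsP a1 a2 i (fst b) + wtP a1 a2 i (fst b) + pairw i (snd b)"

definition ftil :: "int \<Rightarrow> int \<Rightarrow> int \<Rightarrow> elt \<Rightarrow> elt option" where
  "ftil a1 a2 i b = (if phiL a1 a2 i b > epsM a1 a2 i (fst b)
      then Some (fP a1 a2 i (fst b), snd b)
      else map_option (\<lambda>z. (z, snd b)) (fM a1 a2 i (fst b)))"

definition etil :: "int \<Rightarrow> int \<Rightarrow> int \<Rightarrow> elt \<Rightarrow> elt option" where
  "etil a1 a2 i b = (if phiL a1 a2 i b \<ge> epsM a1 a2 i (fst b)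
      then map_option (\<lambda>z. (z, snd b)) (eP a1 a2 i (fst b))
      else Some (eM a1 a2 i (fst b), snd b))"

definition iter_opt :: "nat \<Rightarrow> ('a \<Rightarrow> 'a option) \<Rightarrow> 'a option \<Rightarrow> 'a option" where
  "iter_opt n g = ((\<lambda>x. Option.bind x g) ^^ n)"

definition fpath :: "int \<Rightarrow> int \<Rightarrow> int list \<Rightarrow> elt \<Rightarrow> elt option" where
  "fpath a1 a2 js b = foldl (\<lambda>x j. Option.bind x (ftil a1 a2 j)) (Some b) js"

definition Sop :: "int \<Rightarrow> int \<Rightarrow> int \<Rightarrow> elt \<Rightarrow> elt option" where
  "Sop a1 a2 i b = (let n = wtT a1 a2 i b in
     if n \<ge> 0 then iter_opt (nat n) (ftil a1 a2 i) (Some b)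
     else iter_opt (nat (- n)) (etil a1 a2 i) (Some b))"

definition Sw :: "int \<Rightarrow> int \<Rightarrow> int list \<Rightarrow> elt \<Rightarrow> elt option" where
  \<comment> \<open>S_w for w = s_{j_1} ... s_{j_r}: S_{j_1} ... S_{j_r} b\<close>
  "Sw a1 a2 js b = foldr (\<lambda>j x. Option.bind x (Sop a1 a2 j)) js (Some b)"

definition extremal :: "int \<Rightarrow> int \<Rightarrow> elt \<Rightarrow> bool" where
  "extremal a1 a2 b \<longleftrightarrow>
     (\<forall>js. set js \<subseteq> {1,2} \<longrightarrow> (\<forall>i\<in>{1,2}. \<forall>c. Sw a1 a2 js b = Some c \<longrightarrow>
        (wtT a1 a2 i c \<ge> 0 \<longrightarrow> etil a1 a2 i c = None) \<and>
        (wtT a1 a2 i c \<le> 0 \<longrightarrow> ftil a1 a2 i c = None)))"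

inductive_set ImP :: "int \<Rightarrow> int \<Rightarrow> (int \<Rightarrow> int) set" for a1 a2 where
  zero: "(\<lambda>_. 0) \<in> ImP a1 a2"
| step: "z \<in> ImP a1 a2 \<Longrightarrow> i \<in> {1,2} \<Longrightarrow> fP a1 a2 i z \<in> ImP a1 a2"

inductive_set ImM :: "int \<Rightarrow> int \<Rightarrow> (int \<Rightarrow> int) set" for a1 a2 where
  zero: "(\<lambda>_. 0) \<in> ImM a1 a2"
| step: "z \<in> ImM a1 a2 \<Longrightarrow> i \<in> {1,2} \<Longrightarrow> eM a1 a2 i z \<in> ImM a1 a2"

definition glue :: "(int \<Rightarrow> int) \<Rightarrow> (int \<Rightarrow> int) \<Rightarrow> (int \<Rightarrow> int)" where
  "glue u v = (\<lambda>k. if 1 \<le> k then u k else v k)"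

definition plusPart :: "(int \<Rightarrow> int) \<Rightarrow> (int \<Rightarrow> int)" where
  "plusPart z = (\<lambda>k. if 1 \<le> k then z k else 0)"

definition minusPart :: "(int \<Rightarrow> int) \<Rightarrow> (int \<Rightarrow> int)" where
  "minusPart z = (\<lambda>k. if k \<le> 0 then z k else 0)"

definition ImPsi :: "int \<Rightarrow> int \<Rightarrow> int \<times> int \<Rightarrow> elt set" where
  "ImPsi a1 a2 lam = {(glue u v, lam) | u v. u \<in> ImP a1 a2 \<and> v \<in> ImM a1 a2}"

text \<open>For x = Psi^+(b), x_1 = eps^*_{i_1}(b), x_2 = eps^*_{i_2}(e^*max_{i_1} b), ..., i.e. x is the
  i-string of b^*, whence b^* = f_{i_1}^{x_1} f_{i_2}^{x_2} ... f_{i_N}^{x_N} u_infty.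
  Dually for B(-infty): b^* = e_{i_0}^{-x_0} e_{i_{-1}}^{-x_{-1}} ... u_{-infty}.\<close>

definition bound :: "(int \<Rightarrow> int) \<Rightarrow> int" where
  "bound z = Max ({0} \<union> {\<bar>k\<bar> | k. z k \<noteq> 0})"

definition starP :: "int \<Rightarrow> int \<Rightarrow> (int \<Rightarrow> int) \<Rightarrow> (int \<Rightarrow> int)" where
  "starP a1 a2 z = foldr (\<lambda>k c. (fP a1 a2 (idx k) ^^ nat (z k)) c) [1..bound z] (\<lambda>_. 0)"

definition starM :: "int \<Rightarrow> int \<Rightarrow> (int \<Rightarrow> int) \<Rightarrow> (int \<Rightarrow> int)" where
  "starM a1 a2 z = foldr (\<lambda>k c. (eM a1 a2 (idx k) ^^ nat (- z k)) c) (rev [- bound z..0]) (\<lambda>_. 0)"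

definition star :: "int \<Rightarrow> int \<Rightarrow> elt \<Rightarrow> elt" where
  "star a1 a2 b = (let z = fst b; mu = snd b in
     (glue (starP a1 a2 (plusPart z)) (starM a1 a2 (minusPart z)),
      (- fst mu - wtP a1 a2 1 z - wtM a1 a2 1 z, - snd mu - wtP a1 a2 2 z - wtM a1 a2 2 z)))"

fun pplus :: "int \<Rightarrow> int \<Rightarrow> int \<Rightarrow> int \<Rightarrow> nat \<Rightarrow> int" where
  "pplus a1 a2 k1 k2 0 = k2"
| "pplus a1 a2 k1 k2 (Suc 0) = k1"
| "pplus a1 a2 k1 k2 (Suc (Suc n)) =
     (if even n then a2 else a1) * pplus a1 a2 k1 k2 (Suc n) - pplus a1 a2 k1 k2 n"

fun pminus :: "int \<Rightarrow> int \<Rightarrow> int \<Rightarrow> int \<Rightarrow> nat \<Rightarrow> int" where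
  \<comment> \<open>pminus n = p_{1-n}\<close>
  "pminus a1 a2 k1 k2 0 = k1"
| "pminus a1 a2 k1 k2 (Suc 0) = k2"
| "pminus a1 a2 k1 k2 (Suc (Suc n)) =
     (if odd n then a2 else a1) * pminus a1 a2 k1 k2 (Suc n) - pminus a1 a2 k1 k2 n"

definition pseq :: "int \<Rightarrow> int \<Rightarrow> int \<Rightarrow> int \<Rightarrow> int \<Rightarrow> int" where
  "pseq a1 a2 k1 k2 m = (if 0 \<le> m then pplus a1 a2 k1 k2 (nat m) else pminus a1 a2 k1 k2 (nat (1 - m)))"

definition alphaC :: "int \<Rightarrow> int \<Rightarrow> real" where
  "alphaC a1 a2 = (a1 * a2 + sqrt (a1\<^sup>2 * a2\<^sup>2 - 4 * a1 * a2)) / (2 * a2)"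

definition betaC :: "int \<Rightarrow> int \<Rightarrow> real" where
  "betaC a1 a2 = (a1 * a2 + sqrt (a1\<^sup>2 * a2\<^sup>2 - 4 * a1 * a2)) / (2 * a1)"

definition gam :: "int \<Rightarrow> int \<Rightarrow> int \<Rightarrow> real" where
  "gam a1 a2 k = (if even k then alphaC a1 a2 else betaC a1 a2)"

definition inZ :: "(int \<Rightarrow> int) \<Rightarrow> bool" where
  "inZ z \<longleftrightarrow> finite (supp z) \<and> (\<forall>k. 1 \<le> k \<longrightarrow> z k \<ge> 0) \<and> (\<forall>k. k \<le> 0 \<longrightarrow> z k \<le> 0)"

definition Sigma_set :: "int \<Rightarrow> int \<Rightarrow> int \<Rightarrow> int \<Rightarrow> elt set" where
  "Sigma_set a1 a2 k1 k2 = {(z, (k1, - k2)) | z. inZ z \<and>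
     (let p = (\<lambda>m. real_of_int (pseq a1 a2 k1 k2 m)); g = gam a1 a2; x = (\<lambda>m. real_of_int (z m)) in
      g 0 * p 0 + g 0 * x 0 - x 1 \<ge> 0 \<and>
      g 1 * p 1 + x 0 - g 1 * x 1 \<ge> 0 \<and>
      (\<forall>k. 1 \<le> k \<longrightarrow>
          p k - x k \<ge> 0 \<and> g k * x k - x (k + 1) \<ge> 0 \<and>
          g (k + 1) * p (k + 1) - p k + x k - g (k + 1) * x (k + 1) \<ge> 0) \<and>
      (\<forall>k. k \<le> 0 \<longrightarrow>
          p k + x k \<ge> 0 \<and> x (k - 1) - g k * x k \<ge> 0 \<and>
          g (k - 1) * p (k - 1) - p k + g (k - 1) * x (k - 1) - x k \<ge> 0))}"

definition Sigma' :: "int \<Rightarrow> int \<Rightarrow> int \<Rightarrow> int \<Rightarrow> elt set" where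
  "Sigma' a1 a2 k1 k2 = {b \<in> Sigma_set a1 a2 k1 k2.
      minusPart (fst b) = (\<lambda>_. 0) \<and> plusPart (fst b) \<in> ImP a1 a2}"

definition lam_cond :: "int \<Rightarrow> int \<Rightarrow> int \<Rightarrow> int \<Rightarrow> bool" where
  "lam_cond a1 a2 k1 k2 \<longleftrightarrow> 0 < k1 \<and> 0 < k2 \<and>
     (2 \<le> a1 \<and> 2 \<le> a2 \<longrightarrow> (k2 \<le> k1 \<and> k1 < (a1 - 1) * k2) \<or> (k1 < k2 \<and> k2 \<le> (a2 - 1) * k1)) \<and>
     (a1 = 1 \<longrightarrow> 2 * k1 \<le> k2 \<and> k2 \<le> (a2 - 2) * k1) \<and>
     (a2 = 1 \<longrightarrow> 2 * k2 \<le> k1 \<and> k1 \<le> (a1 - 2) * k2)"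

end

theory Submission
  imports Defs
begin

text \<open>
  Write \<open>X\<^sub>k = x\<^sub>k\<close> for \<open>k \<ge> 1\<close>, \<open>X\<^sub>k = x\<^sub>k + p\<^sub>k\<close> for \<open>k \<le> 0\<close>, and \<open>Q\<^sub>k = p\<^sub>k - X\<^sub>k\<close>. The inequalities cutting
  out \<open>\<Sigma>\<^sub>\<iota>[\<lambda>]\<close> then read \<open>X\<^sub>k, Q\<^sub>k \<ge> 0\<close>, \<open>X\<^bsub>k+1\<^esub> \<le> \<gamma>\<^sub>k X\<^sub>k\<close> and \<open>Q\<^sub>k \<le> \<gamma>\<^bsub>k+1\<^esub> Q\<^bsub>k+1\<^esub>\<close> for all integers \<open>k\<close>.

  If \<open>y\<^sup>*\<close> is extremal, then acting on it by \<open>\<dots> S\<^sub>1 S\<^sub>2\<close> shows that \<open>(X\<^sub>k, X\<^bsub>k+1\<^esub>, \<dots>)\<close> is the string of an element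
  of \<open>B(\<infinity>)\<close> for every \<open>k\<close>. The entries of a string satisfy \<open>X\<^bsub>j+1\<^esub> \<le> \<rho> X\<^sub>j\<close>, where \<open>\<rho>\<close> is a truncation of the
  continued fraction of \<open>\<gamma>\<^sub>j\<close> which gets longer as the string starts further to the left; letting \<open>k\<close> tend to
  minus infinity gives the inequalities for \<open>X\<close>. The other direction \<open>\<dots> S\<^sub>2 S\<^sub>1\<close> gives those for \<open>Q\<close>; it is the
  first one after exchanging the two factors of the tensor product. So \<open>y\<close> lies in \<open>\<Sigma>\<^sub>\<iota>[\<lambda>]\<close>.

  The set \<open>\<Sigma>\<^sub>\<iota>[\<lambda>]\<close> is stable under the operators \<open>f\<^sub>i\<close>, because \<open>f\<^sub>i\<close> can act on the entry \<open>k\<close> only if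
  \<open>X\<^sub>k < a X\<^bsub>k-1\<^esub> - X\<^bsub>k-2\<^esub>\<close>. As long as the right factor is not \<open>z\<^bsub>-\<infinity>\<^esub>\<close>, some \<open>f\<^sub>i\<close>, applied often enough, brings
  it closer to \<open>z\<^bsub>-\<infinity>\<^esub>\<close>.
\<close>

subsection \<open>Signatures and the maximal raising operator\<close>

text \<open>\<open>flip\<close> identifies \<open>\<int>\<^bsup>-\<infinity>\<^esup>\<close> for \<open>(a1, a2)\<close> with \<open>\<int>\<^bsup>+\<infinity>\<^esup>\<close> for \<open>(a2, a1)\<close>; it interchanges \<open>e\<^sub>i\<close> with \<open>f\<^bsub>3-i\<^esub>\<close>.
  \<open>Emax\<close> is a closed form of the maximal power of \<open>e\<^sub>i\<close>, a discrete Pitman transform.\<close>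

definition flip :: "(int \<Rightarrow> int) \<Rightarrow> int \<Rightarrow> int" where
  "flip z = (\<lambda>k. - z (1 - k))"

text \<open>For \<open>t = 1\<close> this is \<open>\<epsilon>_i\<close>. The tails
  \<open>t > 1\<close> enter the closed form of the maximal raising and serve as induction parameter
  in the estimates for strings.\<close>

definition tmax :: "int \<Rightarrow> int \<Rightarrow> int \<Rightarrow> int \<Rightarrow> (int \<Rightarrow> int) \<Rightarrow> int" where
  "tmax a1 a2 i t z = Max ((\<lambda>k. sigmaP a1 a2 k z) ` {k. t \<le> k \<and> idx k = i})"

definition Emax :: "int \<Rightarrow> int \<Rightarrow> int \<Rightarrow> (int \<Rightarrow> int) \<Rightarrow> int \<Rightarrow> int" where
  "Emax a1 a2 i z = (\<lambda>k. if 1 \<le> k then z k - tmax a1 a2 i k z + tmax a1 a2 i (k + 1) z else z k)"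

text \<open>Minus the off-diagonal Cartan entry in the column of \<open>i_k\<close>; also the
  coefficient in \<open>p_{k+1} + p_{k-1} = acoef k * p_k\<close>.\<close>

definition acoef :: "int \<Rightarrow> int \<Rightarrow> int \<Rightarrow> int" where
  "acoef a1 a2 k = (if even k then a1 else a2)"

lemma idx_in: "idx k \<in> {1, 2}"
  by (simp add: idx_def)

lemma idx_add2 [simp]: "idx (k + 2) = idx k" "idx (k - 2) = idx k"
  by (simp_all add: idx_def)

lemma idx_Suc_neq: "idx (k + 1) \<noteq> idx k"
  by (simp add: idx_def)

lemma idx_flip: "idx (1 - k) = 3 - idx k"
  by (simp add: idx_def)

lemma cartan_same [simp]: "cartan a1 a2 i i = 2"
  by (simp add: cartan_def)

lemma cartan_idx_adj: "cartan a1 a2 (idx k) (idx (k + 1)) = - acoef a1 a2 (k + 1)"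
  "cartan a1 a2 (idx (k + 1)) (idx k) = - acoef a1 a2 k"
  by (auto simp: cartan_def idx_def acoef_def)

lemma cartan_swap:
  assumes "i \<in> {1, 2}" "j \<in> {1, 2}"
  shows "cartan a2 a1 (3 - i) (3 - j) = cartan a1 a2 i j"
  using assms by (auto simp: cartan_def)

lemma acoef_swap: "acoef a2 a1 k = acoef a1 a2 (1 - k)"
  by (simp add: acoef_def)

lemma flip_flip [simp]: "flip (flip z) = z"
  by (simp add: flip_def)

lemma flip_upd: "flip (z(m := c)) = (flip z)(1 - m := - c)"
  by (auto simp: flip_def fun_eq_iff)

lemma finite_supp_flip [simp]: "finite (supp (flip z)) \<longleftrightarrow> finite (supp z)"
proof -
  have "supp (flip z) = (\<lambda>k. 1 - k) ` supp z" for z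
    by (force simp: supp_def flip_def image_iff)
  then show ?thesis by (metis finite_imageI flip_flip)
qed

lemma finite_supp_upd [simp]: "finite (supp (z(m := c))) \<longleftrightarrow> finite (supp z)"
proof -
  have "finite (supp (z(m := c)))" if "finite (supp z)" for z :: "int \<Rightarrow> int" and c
    by (rule finite_subset[of _ "insert m (supp z)"]) (use that in \<open>auto simp: supp_def\<close>)
  from this[of z c] this[of "z(m := c)" "z m"] show ?thesis by auto
qed

lemma finite_suppD: "finite (supp z) \<Longrightarrow> finite {k. R k \<and> z k \<noteq> 0}"
  by (rule finite_subset[of _ "supp z"]) (auto simp: supp_def)

lemma sum_supp_upd:
  fixes g z :: "int \<Rightarrow> int"
  assumes "finite (supp z)"
  shows "(\<Sum>j\<in>{j. R j \<and> (z(m := z m + c)) j \<noteq> 0}. g j * (z(m := z m + c)) j) =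
    (\<Sum>j\<in>{j. R j \<and> z j \<noteq> 0}. g j * z j) + (if R m then g m * c else 0)"
proof -
  let ?S = "insert m (supp z)"
  let ?T = "{j \<in> ?S. R j}"
  have fin: "finite ?T" using assms by simp
  have 1: "(\<Sum>j\<in>{j. R j \<and> (z(m := z m + c)) j \<noteq> 0}. g j * (z(m := z m + c)) j) = (\<Sum>j\<in>?T. g j * (z(m := z m + c)) j)"
    by (rule sum.mono_neutral_left[OF fin]) (auto simp: supp_def split: if_splits)
  have 2: "(\<Sum>j\<in>{j. R j \<and> z j \<noteq> 0}. g j * z j) = (\<Sum>j\<in>?T. g j * z j)"
    by (rule sum.mono_neutral_left[OF fin]) (auto simp: supp_def)
  have "(\<Sum>j\<in>?T. g j * (z(m := z m + c)) j) = (\<Sum>j\<in>?T. g j * z j + (if j = m then g m * c else 0))"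
    by (rule sum.cong) (auto simp: algebra_simps)
  also have "\<dots> = (\<Sum>j\<in>?T. g j * z j) + (if m \<in> ?T then g m * c else 0)"
    using fin by (simp add: sum.distrib)
  finally show ?thesis unfolding 1 2 by simp
qed

lemma sum_supp_split:
  fixes g z :: "int \<Rightarrow> int"
  assumes "finite (supp z)" "\<And>j. R j \<longleftrightarrow> j = m \<or> R' j" "\<not> R' m"
  shows "(\<Sum>j\<in>{j. R j \<and> z j \<noteq> 0}. g j * z j) = g m * z m + (\<Sum>j\<in>{j. R' j \<and> z j \<noteq> 0}. g j * z j)"
proof (cases "z m = 0")
  case True
  then have "{j. R j \<and> z j \<noteq> 0} = {j. R' j \<and> z j \<noteq> 0}" using assms by auto
  with True show ?thesis by simp
next
  case False
  then have "{j. R j \<and> z j \<noteq> 0} = insert m {j. R' j \<and> z j \<noteq> 0}" using assms by auto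
  with assms show ?thesis by (simp add: finite_suppD)
qed

section \<open>Signatures and their maxima over tails\<close>

lemma sigmaP_upd:
  assumes "finite (supp z)"
  shows "sigmaP a1 a2 k (z(m := z m + c)) = sigmaP a1 a2 k z +
    (if k = m then c else if k < m then cartan a1 a2 (idx k) (idx m) * c else 0)"
  unfolding sigmaP_def sum_supp_upd[OF assms] by auto

text \<open>All terms beyond \<open>k + 2\<close> cancel. Comparing two neighbouring signature
  values of one colour thus becomes a linear inequality in three consecutive entries, the form in
  which the stability arguments use it.\<close>

lemma sigmaP_diff:
  assumes "finite (supp z)"
  shows "sigmaP a1 a2 k z - sigmaP a1 a2 (k + 2) z = z k - acoef a1 a2 (k + 1) * z (k + 1) + z (k + 2)"
proof -
  let ?s = "\<lambda>t. \<Sum>j\<in>{j. t < j \<and> z j \<noteq> 0}. cartan a1 a2 (idx k) (idx j) * z j"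
  have "?s k = cartan a1 a2 (idx k) (idx (k + 1)) * z (k + 1) + ?s (k + 1)"
    by (rule sum_supp_split[OF assms]) auto
  also have "?s (k + 1) = cartan a1 a2 (idx k) (idx (k + 2)) * z (k + 2) + ?s (k + 2)"
    by (rule sum_supp_split[OF assms]) auto
  finally show ?thesis by (simp add: sigmaP_def cartan_idx_adj)
qed

lemma sigmaP_large:
  assumes "finite (supp z)"
  obtains N where "t \<le> N" "\<And>k. N \<le> k \<Longrightarrow> sigmaP a1 a2 k z = 0"
proof -
  have "bdd_above (supp z)" using assms by (rule bdd_above_finite)
  then obtain B where B: "\<And>j. j \<in> supp z \<Longrightarrow> j \<le> B" by (auto simp: bdd_above_def)
  have "sigmaP a1 a2 k z = 0" if "max t (B + 1) \<le> k" for k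
  proof -
    have z: "z j = 0" if "j > B" for j using B[of j] that by (force simp: supp_def)
    have "{j. k < j \<and> z j \<noteq> 0} = {}" using z that by force
    then show ?thesis using z[of k] that unfolding sigmaP_def by (simp del: Collect_empty_eq)
  qed
  then show ?thesis using that[of "max t (B + 1)"] by simp
qed

text \<open>The signature vanishes beyond the support, so only finitely many values occur on the
  infinite set of positions.\<close>

lemma finite_sigmaP_image:
  assumes "finite (supp z)"
  shows "finite ((\<lambda>k. sigmaP a1 a2 k z) ` {k. t \<le> k \<and> idx k = i})"
proof -
  obtain N where N: "t \<le> N" "\<And>k. N \<le> k \<Longrightarrow> sigmaP a1 a2 k z = 0"
    using sigmaP_large[OF assms, of t a1 a2] by blast
  show ?thesis
    by (rule finite_subset[of _ "insert 0 ((\<lambda>k. sigmaP a1 a2 k z) ` {t..N})"])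
      (auto simp: image_iff, metis N(2) atLeastAtMost_iff linorder_linear)
qed

lemma ex_idx_ge:
  assumes "i \<in> {1, 2}"
  obtains k where "t \<le> k" "idx k = i"
  using assms that[of t] that[of "t + 1"] by (cases "odd t") (auto simp: idx_def)

lemma tmax_nonempty:
  "i \<in> {1, 2} \<Longrightarrow> (\<lambda>k. sigmaP a1 a2 k z) ` {k. t \<le> k \<and> idx k = i} \<noteq> {}"
  using ex_idx_ge[of i t] by blast

lemma tmax_ge:
  assumes "finite (supp z)" "t \<le> k" "idx k = i"
  shows "sigmaP a1 a2 k z \<le> tmax a1 a2 i t z"
  unfolding tmax_def using assms by (intro Max_ge finite_sigmaP_image) auto

lemma tmax_attained:
  assumes "finite (supp z)" "i \<in> {1, 2}"
  obtains k where "t \<le> k" "idx k = i" "sigmaP a1 a2 k z = tmax a1 a2 i t z"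
  using Max_in[OF finite_sigmaP_image[OF assms(1)] tmax_nonempty[OF assms(2)], of a1 a2 t]
  unfolding tmax_def by auto

lemma tmax_le:
  assumes "finite (supp z)" "i \<in> {1, 2}" "\<And>k. t \<le> k \<Longrightarrow> idx k = i \<Longrightarrow> sigmaP a1 a2 k z \<le> c"
  shows "tmax a1 a2 i t z \<le> c"
  using tmax_attained[OF assms(1,2), of t a1 a2] assms(3) by metis

lemma tmax_nonneg:
  assumes "finite (supp z)" "i \<in> {1, 2}"
  shows "0 \<le> tmax a1 a2 i t z"
proof -
  obtain N where N: "t \<le> N" "\<And>k. N \<le> k \<Longrightarrow> sigmaP a1 a2 k z = 0"
    using sigmaP_large[OF assms(1), of t a1 a2] by blast
  obtain k where "N \<le> k" "idx k = i" using ex_idx_ge[OF assms(2)] .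
  with N tmax_ge[OF assms(1), of t k i a1 a2] show ?thesis by simp
qed

lemma tmax_antimono:
  assumes "finite (supp z)" "i \<in> {1, 2}" "s \<le> t"
  shows "tmax a1 a2 i t z \<le> tmax a1 a2 i s z"
  using assms by (intro tmax_le tmax_ge) auto

lemma sigP_tmax: "sigP a1 a2 i z = tmax a1 a2 i 1 z"
  by (simp add: sigP_def tmax_def)

section \<open>The positions at which \<open>f_i\<close> and \<open>e_i\<close> act\<close>

lemma fP_at:
  assumes "finite (supp z)" "i \<in> {1, 2}"
  obtains m where "1 \<le> m" "idx m = i" "fP a1 a2 i z = z(m := z m + 1)"
    "sigmaP a1 a2 m z = sigP a1 a2 i z"
    "\<And>k. 1 \<le> k \<Longrightarrow> k < m \<Longrightarrow> idx k = i \<Longrightarrow> sigmaP a1 a2 k z < sigP a1 a2 i z"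
proof -
  let ?R = "\<lambda>k. 1 \<le> k \<and> idx k = i \<and> sigmaP a1 a2 k z = sigP a1 a2 i z"
  obtain k where k: "?R k"
    using tmax_attained[OF assms, of 1 a1 a2] by (auto simp: sigP_tmax)
  \<comment> \<open>The integers are not well-ordered. The minimum is taken over the naturals and
    carried over, which the bound \<open>1 \<le> k\<close> permits.\<close>
  let ?n = "LEAST n. ?R (int n)"
  have n: "?R (int ?n)"
    using LeastI[of "\<lambda>n. ?R (int n)" "nat k"] k by simp
  have least: "int ?n \<le> k" if "?R k" for k
  proof -
    have "?n \<le> nat k" by (rule Least_le) (use that in simp)
    with that show ?thesis by linarith
  qed
  have "(LEAST k. ?R k) = int ?n"
    by (rule Least_equality) (use n least in auto)
  then have "fP a1 a2 i z = z(int ?n := z (int ?n) + 1)" by (simp only: fP_def Let_def)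
  moreover have "sigmaP a1 a2 k z < sigP a1 a2 i z" if "1 \<le> k" "k < int ?n" "idx k = i" for k
    using least[of k] that tmax_ge[OF assms(1), of 1 k i a1 a2] by (force simp: sigP_tmax)
  ultimately show ?thesis using that n by blast
qed

lemma fP_eqI:
  assumes "finite (supp z)" "1 \<le> m" "idx m = i" "sigmaP a1 a2 m z = sigP a1 a2 i z"
    "\<And>k. 1 \<le> k \<Longrightarrow> k < m \<Longrightarrow> idx k = i \<Longrightarrow> sigmaP a1 a2 k z < sigP a1 a2 i z"
  shows "fP a1 a2 i z = z(m := z m + 1)"
proof -
  have "(LEAST k. 1 \<le> k \<and> idx k = i \<and> sigmaP a1 a2 k z = sigP a1 a2 i z) = m"
    by (rule Least_equality) (use assms in \<open>auto, force\<close>)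
  then show ?thesis by (simp add: fP_def)
qed

lemma eP_eqI:
  assumes "finite (supp z)" "1 \<le> m" "idx m = i" "sigmaP a1 a2 m z = sigP a1 a2 i z"
    "\<And>k. m < k \<Longrightarrow> idx k = i \<Longrightarrow> sigmaP a1 a2 k z < sigP a1 a2 i z" "0 < sigP a1 a2 i z"
  shows "eP a1 a2 i z = Some (z(m := z m - 1))"
proof -
  have "(GREATEST k. 1 \<le> k \<and> idx k = i \<and> sigmaP a1 a2 k z = sigP a1 a2 i z) = m"
    by (rule Greatest_equality) (use assms in \<open>auto, force\<close>)
  then show ?thesis using assms(6) by (simp add: eP_def)
qed

lemma greatest_argmax:
  assumes "finite (supp z)" "i \<in> {1, 2}" "0 < sigP a1 a2 i z"
  obtains m where "1 \<le> m" "idx m = i" "sigmaP a1 a2 m z = sigP a1 a2 i z"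
    "\<And>k. m < k \<Longrightarrow> idx k = i \<Longrightarrow> sigmaP a1 a2 k z < sigP a1 a2 i z"
proof -
  let ?S = "{k. 1 \<le> k \<and> idx k = i \<and> sigmaP a1 a2 k z = sigP a1 a2 i z}"
  obtain N where N: "1 \<le> N" "\<And>k. N \<le> k \<Longrightarrow> sigmaP a1 a2 k z = 0"
    using sigmaP_large[OF assms(1), of 1 a1 a2] by blast
  \<comment> \<open>A positive maximum is not attained where the signature is already zero, so a
    last maximizer exists.\<close>
  have fin: "finite ?S"
  proof (rule finite_subset)
    show "?S \<subseteq> {1..N}"
    proof
      fix k assume "k \<in> ?S"
      then show "k \<in> {1..N}" using N(2)[of k] assms(3) by (cases "k \<le> N") auto
    qed
  qed simp
  have ne: "?S \<noteq> {}"
    using tmax_attained[OF assms(1,2), of 1 a1 a2] by (auto simp: sigP_tmax)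
  have "Max ?S \<in> ?S" using fin ne by (rule Max_in)
  moreover have "sigmaP a1 a2 k z < sigP a1 a2 i z" if "Max ?S < k" "idx k = i" for k
  proof -
    have "1 \<le> k" using \<open>Max ?S \<in> ?S\<close> that by auto
    moreover have "k \<notin> ?S" using Max_ge[OF fin] that by force
    ultimately show ?thesis
      using that tmax_ge[OF assms(1), of 1 k i a1 a2] by (force simp: sigP_tmax)
  qed
  ultimately show ?thesis using that by blast
qed

text \<open>Adding 1 at the first maximizer \<open>m\<close> raises the signature by 1 at
  \<open>m\<close> and by 2 at earlier positions of colour \<open>i\<close>. The earlier values were
  strictly below the maximum, so by integrality every tail maximum with \<open>t \<le> m\<close>
  grows by exactly 1, and \<open>m\<close> becomes the last maximizer.\<close>

lemma fP_tmax:
  assumes "finite (supp z)" "i \<in> {1, 2}"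
  obtains m where "1 \<le> m" "idx m = i" "fP a1 a2 i z = z(m := z m + 1)"
    "\<And>t. 1 \<le> t \<Longrightarrow> tmax a1 a2 i t (fP a1 a2 i z) = tmax a1 a2 i t z + (if t \<le> m then 1 else 0)"
    "eP a1 a2 i (fP a1 a2 i z) = Some z"
proof -
  obtain m where m: "1 \<le> m" "idx m = i" and f: "fP a1 a2 i z = z(m := z m + 1)"
    and s: "sigmaP a1 a2 m z = sigP a1 a2 i z"
    and l: "\<And>k. 1 \<le> k \<Longrightarrow> k < m \<Longrightarrow> idx k = i \<Longrightarrow> sigmaP a1 a2 k z < sigP a1 a2 i z"
    using fP_at[OF assms] by metis
  let ?z = "z(m := z m + 1)"
  have sig: "sigmaP a1 a2 k ?z = sigmaP a1 a2 k z + (if k = m then 1 else if k < m then 2 else 0)" if "idx k = i" for k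
    unfolding sigmaP_upd[OF assms(1)] using that m by simp
  have fz: "finite (supp ?z)" using assms by simp
  have t: "tmax a1 a2 i t ?z = tmax a1 a2 i t z + (if t \<le> m then 1 else 0)" if t: "1 \<le> t" for t
  proof (cases "t \<le> m")
    case True
    have eq: "tmax a1 a2 i t z = sigP a1 a2 i z"
      using tmax_ge[OF assms(1) True m(2), of a1 a2] s tmax_antimono[OF assms t, of a1 a2]
      by (simp add: sigP_tmax)
    have "tmax a1 a2 i t ?z \<le> sigP a1 a2 i z + 1"
    proof (rule tmax_le[OF fz assms(2)])
      fix k assume k: "t \<le> k" "idx k = i"
      show "sigmaP a1 a2 k ?z \<le> sigP a1 a2 i z + 1"
        using sig[OF k(2)] l[of k] k t s tmax_ge[OF assms(1) k, of a1 a2] eq by (auto split: if_splits)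
    qed
    moreover have "sigP a1 a2 i z + 1 \<le> tmax a1 a2 i t ?z"
      using tmax_ge[OF fz True m(2), of a1 a2] sig[OF m(2)] s by simp
    ultimately show ?thesis using True eq by simp
  next
    case False
    have "(\<lambda>k. sigmaP a1 a2 k ?z) ` {k. t \<le> k \<and> idx k = i} = (\<lambda>k. sigmaP a1 a2 k z) ` {k. t \<le> k \<and> idx k = i}"
      by (rule image_cong) (use False sig in auto)
    then show ?thesis using False by (simp add: tmax_def)
  qed
  have "eP a1 a2 i ?z = Some (?z(m := ?z m - 1))"
  proof (rule eP_eqI[OF fz m])
    have e: "sigP a1 a2 i ?z = sigP a1 a2 i z + 1" using t[of 1] m by (simp add: sigP_tmax)
    show "sigmaP a1 a2 m ?z = sigP a1 a2 i ?z" using sig[OF m(2)] s e by simp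
    show "0 < sigP a1 a2 i ?z" using e tmax_nonneg[OF assms, of a1 a2 1] by (simp add: sigP_tmax)
    show "sigmaP a1 a2 k ?z < sigP a1 a2 i ?z" if "m < k" "idx k = i" for k
      using that sig[of k] e tmax_ge[OF assms(1), of 1 k i a1 a2] m by (simp add: sigP_tmax)
  qed
  then show ?thesis using that m f t by simp
qed

lemma eP_None_iff: "eP a1 a2 i z = None \<longleftrightarrow> sigP a1 a2 i z \<le> 0"
  by (auto simp: eP_def Let_def)

text \<open>Lowering the last maximizer drops the earlier values by 2, hence \<open>m\<close> is the
  first maximizer afterwards and \<open>f_i\<close> undoes the step. The strict drop from
  \<open>m\<close> to \<open>m + 2\<close> is what the cone and region arguments use.\<close>

lemma eP_cases:
  assumes "finite (supp z)" "i \<in> {1, 2}" "0 < sigP a1 a2 i z"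
  obtains m where "1 \<le> m" "idx m = i" "eP a1 a2 i z = Some (z(m := z m - 1))"
    "sigmaP a1 a2 (m + 2) z < sigmaP a1 a2 m z" "fP a1 a2 i (z(m := z m - 1)) = z"
proof -
  obtain m where m: "1 \<le> m" "idx m = i" and s: "sigmaP a1 a2 m z = sigP a1 a2 i z"
    and g: "\<And>k. m < k \<Longrightarrow> idx k = i \<Longrightarrow> sigmaP a1 a2 k z < sigP a1 a2 i z"
    using greatest_argmax[OF assms] by metis
  let ?z = "z(m := z m - 1)"
  have sig: "sigmaP a1 a2 k ?z = sigmaP a1 a2 k z - (if k = m then 1 else if k < m then 2 else 0)" if "idx k = i" for k
    using sigmaP_upd[OF assms(1), of a1 a2 k m "- 1"] that m by simp
  have fz: "finite (supp ?z)" using assms by simp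
  have e: "sigP a1 a2 i ?z = sigP a1 a2 i z - 1"
  proof (rule antisym)
    show "sigP a1 a2 i ?z \<le> sigP a1 a2 i z - 1"
      unfolding sigP_tmax
    proof (rule tmax_le[OF fz assms(2)])
      fix k assume k: "1 \<le> k" "idx k = i"
      show "sigmaP a1 a2 k ?z \<le> tmax a1 a2 i 1 z - 1"
        using sig[OF k(2)] g[of k] s k tmax_ge[OF assms(1) k, of a1 a2]
        by (auto simp: sigP_tmax split: if_splits)
    qed
    show "sigP a1 a2 i z - 1 \<le> sigP a1 a2 i ?z"
      using tmax_ge[OF fz m, of a1 a2] sig[OF m(2)] s by (simp add: sigP_tmax)
  qed
  have "fP a1 a2 i ?z = ?z(m := ?z m + 1)"
  proof (rule fP_eqI[OF fz m])
    show "sigmaP a1 a2 m ?z = sigP a1 a2 i ?z" using e sig[OF m(2)] s by simp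
    show "sigmaP a1 a2 k ?z < sigP a1 a2 i ?z" if "1 \<le> k" "k < m" "idx k = i" for k
      using that e sig[of k] tmax_ge[OF assms(1), of 1 k i a1 a2] by (simp add: sigP_tmax)
  qed
  then show ?thesis
    using that[OF m eP_eqI[OF assms(1) m s g assms(3)]] s g[of "m + 2"] m by simp
qed

section \<open>Induction along \<open>i\<close>-strings and the maximal raising\<close>

lemma finite_supp_fP [simp]:
  "finite (supp z) \<Longrightarrow> finite (supp (fP a1 a2 i z))"
  by (simp add: fP_def Let_def)

lemma finite_supp_fP_pow [simp]:
  "finite (supp z) \<Longrightarrow> finite (supp ((fP a1 a2 i ^^ n) z))"
  by (induction n) auto

lemma eP_fP:
  assumes "finite (supp z)" "i \<in> {1, 2}"
  shows "eP a1 a2 i (fP a1 a2 i z) = Some z"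
  using fP_tmax[OF assms] by metis

lemma sigP_fP:
  assumes "finite (supp z)" "i \<in> {1, 2}"
  shows "sigP a1 a2 i (fP a1 a2 i z) = sigP a1 a2 i z + 1"
proof -
  obtain m where "1 \<le> m"
    "\<And>t. 1 \<le> t \<Longrightarrow> tmax a1 a2 i t (fP a1 a2 i z) = tmax a1 a2 i t z + (if t \<le> m then 1 else 0)"
    using fP_tmax[OF assms] by metis
  from this(1) this(2)[of 1] show ?thesis by (simp add: sigP_tmax)
qed

lemma sigP_fP_pow:
  assumes "finite (supp z)" "i \<in> {1, 2}"
  shows "sigP a1 a2 i ((fP a1 a2 i ^^ n) z) = sigP a1 a2 i z + int n"
  by (induction n) (use assms in \<open>simp_all add: sigP_fP\<close>)

lemma sigP_nonneg:
  assumes "finite (supp z)" "i \<in> {1, 2}"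
  shows "0 \<le> sigP a1 a2 i z"
  using tmax_nonneg[OF assms] by (simp add: sigP_tmax)

text \<open>Every element arises by powers of \<open>f_i\<close> from one with
  \<open>\<epsilon>_i = 0\<close>; the induction descends along its \<open>i\<close>-string by
  \<open>e_i\<close>.\<close>

lemma fP_induct [consumes 2, case_names zero step]:
  assumes "finite (supp z)" "i \<in> {1, 2}"
    and "\<And>z. finite (supp z) \<Longrightarrow> sigP a1 a2 i z = 0 \<Longrightarrow> P z"
    and "\<And>z. finite (supp z) \<Longrightarrow> P z \<Longrightarrow> P (fP a1 a2 i z)"
  shows "P z"
  using assms(1)
proof (induction "nat (sigP a1 a2 i z)" arbitrary: z)
  case 0
  then show ?case using assms(3) sigP_nonneg[OF _ assms(2), of z a1 a2] by force
next
  case (Suc n)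
  then have "0 < sigP a1 a2 i z" by simp
  with Suc.prems obtain m where m: "fP a1 a2 i (z(m := z m - 1)) = z"
    using eP_cases[OF _ assms(2)] by metis
  let ?z = "z(m := z m - 1)"
  have fz: "finite (supp ?z)" using Suc.prems by simp
  have "sigP a1 a2 i z = sigP a1 a2 i ?z + 1" using sigP_fP[OF fz assms(2), of a1 a2] m by simp
  then have "n = nat (sigP a1 a2 i ?z)" using Suc.hyps(2) by simp
  then have "P ?z" using Suc.hyps(1) fz by blast
  from assms(4)[OF fz this] m show ?case by simp
qed

lemma tmax_zero:
  assumes "finite (supp z)" "i \<in> {1, 2}" "sigP a1 a2 i z = 0" "1 \<le> t"
  shows "tmax a1 a2 i t z = 0"
  using tmax_antimono[OF assms(1,2,4), of a1 a2] tmax_nonneg[OF assms(1,2), of a1 a2 t] assms(3)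
  by (simp add: sigP_tmax)

lemma Emax_zero:
  assumes "finite (supp z)" "i \<in> {1, 2}" "sigP a1 a2 i z = 0"
  shows "Emax a1 a2 i z = z"
  using tmax_zero[OF assms] by (simp add: Emax_def fun_eq_iff)

text \<open>At the position \<open>m\<close> where \<open>f_i\<close> acts only the first of the two
  tail maxima grows, which absorbs the added 1; elsewhere both grow or neither does.\<close>

lemma Emax_fP:
  assumes "finite (supp z)" "i \<in> {1, 2}"
  shows "Emax a1 a2 i (fP a1 a2 i z) = Emax a1 a2 i z"
proof -
  obtain m where m: "1 \<le> m" "idx m = i" "fP a1 a2 i z = z(m := z m + 1)"
    "\<And>t. 1 \<le> t \<Longrightarrow> tmax a1 a2 i t (fP a1 a2 i z) = tmax a1 a2 i t z + (if t \<le> m then 1 else 0)"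
    using fP_tmax[OF assms] by metis
  show ?thesis
  proof
    fix k show "Emax a1 a2 i (fP a1 a2 i z) k = Emax a1 a2 i z k"
      using m(4)[of k] m(4)[of "k + 1"] m(1) by (auto simp: Emax_def m(3))
  qed
qed

lemma Emax_fP_pow:
  assumes "finite (supp z)" "i \<in> {1, 2}"
  shows "Emax a1 a2 i ((fP a1 a2 i ^^ n) z) = Emax a1 a2 i z"
  by (induction n) (use assms in \<open>simp_all add: Emax_fP\<close>)

text \<open>Constancy along \<open>i\<close>-strings reduces this to the element with
  \<open>\<epsilon>_i = 0\<close>, where all tail maxima vanish. It identifies \<open>Emax\<close>
  with the maximal power of \<open>e_i\<close>.\<close>

lemma Emax_props:
  assumes "finite (supp z)" "i \<in> {1, 2}"
  shows "finite (supp (Emax a1 a2 i z)) \<and> sigP a1 a2 i (Emax a1 a2 i z) = 0 \<and>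
    z = (fP a1 a2 i ^^ nat (sigP a1 a2 i z)) (Emax a1 a2 i z)"
  using assms
proof (induction rule: fP_induct[where ?a1.0 = a1 and ?a2.0 = a2])
  case (zero z)
  then show ?case using Emax_zero[OF zero(1) assms(2)] by simp
next
  case (step z)
  have "nat (sigP a1 a2 i (fP a1 a2 i z)) = Suc (nat (sigP a1 a2 i z))"
    using sigP_fP[OF step(1) assms(2), of a1 a2] sigP_nonneg[OF step(1) assms(2), of a1 a2] by simp
  then show ?case using step Emax_fP[OF step(1) assms(2), of a1 a2] by simp
qed

text \<open>The right-hand side, like the left, does not change when \<open>f_i\<close> is applied,
  and for \<open>\<epsilon>_i = 0\<close> all tail maxima are zero. The formula shows how signatures
  of one colour depend on tail maxima of the other.\<close>

lemma sigmaP_Emax: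
  assumes "finite (supp z)" "i \<in> {1, 2}" "1 \<le> r"
  shows "sigmaP a1 a2 r (Emax a1 a2 i z) =
    (if idx r = i then sigmaP a1 a2 r z - tmax a1 a2 i r z - tmax a1 a2 i (r + 1) z
     else sigmaP a1 a2 r z - cartan a1 a2 (idx r) i * tmax a1 a2 i (r + 1) z)"
  using assms(1,2)
proof (induction rule: fP_induct[where ?a1.0 = a1 and ?a2.0 = a2])
  case (zero z)
  then show ?case using Emax_zero[OF zero(1) assms(2)] tmax_zero[OF zero(1) assms(2) zero(2)] assms(3)
    by simp
next
  case (step z)
  obtain m where m: "1 \<le> m" "idx m = i" "fP a1 a2 i z = z(m := z m + 1)"
    "\<And>t. 1 \<le> t \<Longrightarrow> tmax a1 a2 i t (fP a1 a2 i z) = tmax a1 a2 i t z + (if t \<le> m then 1 else 0)"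
    using fP_tmax[OF step(1) assms(2)] by metis
  have s: "sigmaP a1 a2 r (fP a1 a2 i z) = sigmaP a1 a2 r z +
      (if r = m then 1 else if r < m then cartan a1 a2 (idx r) (idx m) else 0)"
    using sigmaP_upd[OF step(1), of a1 a2 r m 1] m(3) by simp
  show ?case
    unfolding Emax_fP[OF step(1) assms(2)] step.IH
    using m(4)[of r] m(4)[of "r + 1"] assms(3) s m(2) by (auto simp: algebra_simps)
qed

subsection \<open>Exchanging the two tensor factors\<close>

text \<open>Both tensor factors are encoded in \<open>Z^{+infinity}\<close>, the right one for the
  transposed matrix, so that one theory of signatures serves both.\<close>

definition el :: "(int \<Rightarrow> int) \<Rightarrow> (int \<Rightarrow> int) \<Rightarrow> int \<times> int \<Rightarrow> elt" where
  "el U V mu = (glue U (flip V), mu)"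

text \<open>Exchange of the two tensor factors. It exchanges the colours and negates weights, whence
  the swap and the signs in the middle component.\<close>

definition flip_elt :: "elt \<Rightarrow> elt" where
  "flip_elt b = (flip (fst b), (- snd (snd b), - fst (snd b)))"

lemma flip_apply: "flip z k = - z (1 - k)"
  by (simp add: flip_def)

lemma sigmaM_flip: "sigmaM a1 a2 k z = - sigmaP a2 a1 (1 - k) (flip z)"
proof -
  have "(\<Sum>j\<in>{j. j < k \<and> z j \<noteq> 0}. cartan a1 a2 (idx k) (idx j) * z j) =
      (\<Sum>j\<in>{j. 1 - k < j \<and> flip z j \<noteq> 0}. - (cartan a2 a1 (idx (1 - k)) (idx j) * flip z j))"
    by (rule sum.reindex_bij_witness[of _ "\<lambda>j. 1 - j" "\<lambda>j. 1 - j"])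
      (auto simp: flip_def idx_flip cartan_swap idx_in[simplified])
  then show ?thesis by (simp add: sigmaM_def sigmaP_def sum_negf flip_def)
qed

lemma wtM_flip:
  assumes "i \<in> {1, 2}"
  shows "wtM a1 a2 i z = - wtP a2 a1 (3 - i) (flip z)"
proof -
  have "(\<Sum>k\<in>{k. k \<le> 0 \<and> z k \<noteq> 0}. z k * cartan a1 a2 i (idx k)) =
      (\<Sum>k\<in>{k. 1 \<le> k \<and> flip z k \<noteq> 0}. - (flip z k * cartan a2 a1 (3 - i) (idx k)))"
    by (rule sum.reindex_bij_witness[of _ "\<lambda>j. 1 - j" "\<lambda>j. 1 - j"])
      (use assms in \<open>auto simp: flip_def idx_flip cartan_swap idx_in[simplified]\<close>)
  then show ?thesis by (simp add: wtM_def wtP_def sum_negf)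
qed

lemma swap_in: "i \<in> {1, 2} \<Longrightarrow> 3 - i \<in> {1, 2 :: int}"
  by auto

lemma sigM_flip:
  assumes "finite (supp z)" "i \<in> {1, 2}"
  shows "sigM a1 a2 i z = - sigP a2 a1 (3 - i) (flip z)"
proof -
  have "{k. k \<le> 0 \<and> idx k = i} = (\<lambda>k. 1 - k) ` {k. 1 \<le> k \<and> idx k = 3 - i}"
    by (auto simp: image_iff idx_flip intro!: exI[of _ "1 - _"])
  then have "(\<lambda>k. sigmaM a1 a2 k z) ` {k. k \<le> 0 \<and> idx k = i} =
      uminus ` (\<lambda>k. sigmaP a2 a1 k (flip z)) ` {k. 1 \<le> k \<and> idx k = 3 - i}"
    by (simp add: image_image sigmaM_flip)
  then show ?thesis
    unfolding sigM_def sigP_def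
    using minus_Max_eq_Min[OF finite_sigmaP_image tmax_nonempty[OF swap_in[OF assms(2)]], of "flip z" a2 a1 1]
      assms(1) by simp
qed

lemma eM_flip:
  assumes "finite (supp z)" "i \<in> {1, 2}"
  shows "eM a1 a2 i z = flip (fP a2 a1 (3 - i) (flip z))"
proof -
  have fz: "finite (supp (flip z))" using assms by simp
  obtain m where m: "1 \<le> m" "idx m = 3 - i" "fP a2 a1 (3 - i) (flip z) = (flip z)(m := flip z m + 1)"
    "sigmaP a2 a1 m (flip z) = sigP a2 a1 (3 - i) (flip z)"
    "\<And>k. 1 \<le> k \<Longrightarrow> k < m \<Longrightarrow> idx k = 3 - i \<Longrightarrow> sigmaP a2 a1 k (flip z) < sigP a2 a1 (3 - i) (flip z)"
    using fP_at[OF fz swap_in[OF assms(2)]] by metis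
  have "(GREATEST k. k \<le> 0 \<and> idx k = i \<and> sigmaM a1 a2 k z = sigM a1 a2 i z) = 1 - m"
  proof (rule Greatest_equality)
    show "1 - m \<le> 0 \<and> idx (1 - m) = i \<and> sigmaM a1 a2 (1 - m) z = sigM a1 a2 i z"
      using m by (simp add: idx_flip sigmaM_flip sigM_flip[OF assms])
    fix k assume "k \<le> 0 \<and> idx k = i \<and> sigmaM a1 a2 k z = sigM a1 a2 i z"
    then show "k \<le> 1 - m"
      using m(5)[of "1 - k"] by (cases "k \<le> 1 - m") (auto simp: idx_flip sigmaM_flip sigM_flip[OF assms])
  qed
  then show ?thesis by (simp add: eM_def Let_def m(3) flip_upd flip_apply)
qed

lemma fM_flip:
  assumes "finite (supp z)" "i \<in> {1, 2}"
  shows "fM a1 a2 i z = map_option flip (eP a2 a1 (3 - i) (flip z))"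
proof (cases "0 < sigP a2 a1 (3 - i) (flip z)")
  case True
  have fz: "finite (supp (flip z))" using assms by simp
  obtain m where m: "1 \<le> m" "idx m = 3 - i"
    "sigmaP a2 a1 m (flip z) = sigP a2 a1 (3 - i) (flip z)"
    "\<And>k. m < k \<Longrightarrow> idx k = 3 - i \<Longrightarrow> sigmaP a2 a1 k (flip z) < sigP a2 a1 (3 - i) (flip z)"
    using greatest_argmax[OF fz swap_in[OF assms(2)] True] by metis
  note e = eP_eqI[OF fz m True]
  have "(LEAST k. k \<le> 0 \<and> idx k = i \<and> sigmaM a1 a2 k z = sigM a1 a2 i z) = 1 - m"
  proof (rule Least_equality)
    show "1 - m \<le> 0 \<and> idx (1 - m) = i \<and> sigmaM a1 a2 (1 - m) z = sigM a1 a2 i z"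
      using m by (simp add: idx_flip sigmaM_flip sigM_flip[OF assms])
    fix k assume "k \<le> 0 \<and> idx k = i \<and> sigmaM a1 a2 k z = sigM a1 a2 i z"
    then show "1 - m \<le> k"
      using m(4)[of "1 - k"] by (cases "1 - m \<le> k") (auto simp: idx_flip sigmaM_flip sigM_flip[OF assms])
  qed
  then show ?thesis using True
    by (simp add: fM_def Let_def e flip_upd flip_apply sigM_flip[OF assms] add.commute)
next
  case False
  then show ?thesis by (simp add: fM_def eP_def sigM_flip[OF assms])
qed

section \<open>Crystal operators on a pair of tensor factors\<close>

lemma sigmaP_glue: "1 \<le> k \<Longrightarrow> sigmaP a1 a2 k (glue U W) = sigmaP a1 a2 k U"
  unfolding sigmaP_def by (intro arg_cong2[of _ _ _ _ "(+)"] sum.cong) (auto simp: glue_def)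

lemma sigP_glue: "sigP a1 a2 i (glue U W) = sigP a1 a2 i U"
  unfolding sigP_def by (intro arg_cong[of _ _ Max] image_cong) (auto simp: sigmaP_glue)

lemma wtP_glue: "wtP a1 a2 i (glue U W) = wtP a1 a2 i U"
  unfolding wtP_def by (intro arg_cong[of _ _ uminus] sum.cong) (auto simp: glue_def)

lemma finite_supp_glue:
  assumes "finite (supp U)" "finite (supp W)"
  shows "finite (supp (glue U W))"
  by (rule finite_subset[of _ "supp U \<union> supp W"]) (use assms in \<open>auto simp: supp_def glue_def\<close>)

lemma glue_upd: "1 \<le> m \<Longrightarrow> (glue U W)(m := c) = glue (U(m := c)) W"
  by (auto simp: glue_def fun_eq_iff)

lemma glue_val: "1 \<le> m \<Longrightarrow> glue U W m = U m"
  by (auto simp: glue_def)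

lemma fP_glue:
  assumes "finite (supp U)" "finite (supp W)" "i \<in> {1, 2}"
  shows "fP a1 a2 i (glue U W) = glue (fP a1 a2 i U) W"
proof -
  obtain m where m: "1 \<le> m" "idx m = i" "fP a1 a2 i U = U(m := U m + 1)"
    "sigmaP a1 a2 m U = sigP a1 a2 i U"
    "\<And>k. 1 \<le> k \<Longrightarrow> k < m \<Longrightarrow> idx k = i \<Longrightarrow> sigmaP a1 a2 k U < sigP a1 a2 i U"
    using fP_at[OF assms(1,3)] by metis
  have "fP a1 a2 i (glue U W) = (glue U W)(m := glue U W m + 1)"
    by (rule fP_eqI[OF finite_supp_glue[OF assms(1,2)] m(1,2)])
      (use m in \<open>auto simp: sigmaP_glue sigP_glue\<close>)
  then show ?thesis by (simp add: m(1,3) glue_upd glue_val)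
qed

lemma eP_glue:
  assumes "finite (supp U)" "finite (supp W)" "i \<in> {1, 2}"
  shows "eP a1 a2 i (glue U W) = map_option (\<lambda>U'. glue U' W) (eP a1 a2 i U)"
proof (cases "0 < sigP a1 a2 i U")
  case True
  obtain m where m: "1 \<le> m" "idx m = i" "sigmaP a1 a2 m U = sigP a1 a2 i U"
    "\<And>k. m < k \<Longrightarrow> idx k = i \<Longrightarrow> sigmaP a1 a2 k U < sigP a1 a2 i U"
    using greatest_argmax[OF assms(1,3) True] by metis
  have "eP a1 a2 i (glue U W) = Some ((glue U W)(m := glue U W m - 1))"
    by (rule eP_eqI[OF finite_supp_glue[OF assms(1,2)] m(1,2)])
      (use m True in \<open>auto simp: sigmaP_glue sigP_glue\<close>)
  then show ?thesis by (simp add: m(1) eP_eqI[OF assms(1) m True] glue_upd glue_val)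
next
  case False
  then show ?thesis by (simp add: eP_def sigP_glue)
qed

lemma flip_glue: "flip (glue U (flip V)) = glue V (flip U)"
  by (auto simp: flip_def glue_def)

lemma el_self: "(z, mu) = el z (flip z) mu"
  by (auto simp: el_def glue_def)

lemma flip_elt_el: "flip_elt (el U V mu) = el V U (- snd mu, - fst mu)"
  by (simp add: flip_elt_def el_def flip_glue)

lemma phiL_el: "phiL a1 a2 i (el U V mu) = sigP a1 a2 i U + wtP a1 a2 i U + pairw i mu"
  by (simp add: phiL_def epsP_def el_def sigP_glue wtP_glue)

lemma epsM_el:
  assumes "finite (supp U)" "finite (supp V)" "i \<in> {1, 2}"
  shows "epsM a1 a2 i (fst (el U V mu)) = sigP a2 a1 (3 - i) V + wtP a2 a1 (3 - i) V"
  using assms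
  by (simp add: epsM_def phiM_def el_def sigM_flip wtM_flip finite_supp_glue flip_glue sigP_glue wtP_glue)

lemma wtT_el:
  assumes "i \<in> {1, 2}"
  shows "wtT a1 a2 i (el U V mu) = wtP a1 a2 i U + pairw i mu - wtP a2 a1 (3 - i) V"
  using assms by (simp add: wtT_def el_def wtM_flip flip_glue wtP_glue)

text \<open>The tensor product rule in these coordinates: applying \<open>f_i\<close> to the right
  factor is applying \<open>e_{3-i}\<close> to its flipped copy.\<close>

lemma ftil_el:
  assumes "finite (supp U)" "finite (supp V)" "i \<in> {1, 2}"
  shows "ftil a1 a2 i (el U V mu) =
    (if sigP a1 a2 i U + wtP a1 a2 i U + pairw i mu > sigP a2 a1 (3 - i) V + wtP a2 a1 (3 - i) V
     then Some (el (fP a1 a2 i U) V mu)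
     else map_option (\<lambda>V'. el U V' mu) (eP a2 a1 (3 - i) V))"
proof -
  note s = swap_in[OF assms(3)]
  have "fM a1 a2 i (glue U (flip V)) = map_option (\<lambda>V'. glue U (flip V')) (eP a2 a1 (3 - i) V)"
    using assms s by (simp add: fM_flip finite_supp_glue flip_glue eP_glue option.map_comp comp_def)
  moreover have "fP a1 a2 i (glue U (flip V)) = glue (fP a1 a2 i U) (flip V)"
    using assms by (simp add: fP_glue)
  ultimately show ?thesis
    unfolding ftil_def phiL_el epsM_el[OF assms] by (simp add: el_def option.map_comp comp_def)
qed

lemma etil_el:
  assumes "finite (supp U)" "finite (supp V)" "i \<in> {1, 2}"
  shows "etil a1 a2 i (el U V mu) =
    (if sigP a1 a2 i U + wtP a1 a2 i U + pairw i mu \<ge> sigP a2 a1 (3 - i) V + wtP a2 a1 (3 - i) V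
     then map_option (\<lambda>U'. el U' V mu) (eP a1 a2 i U)
     else Some (el U (fP a2 a1 (3 - i) V) mu))"
proof -
  note s = swap_in[OF assms(3)]
  have "eM a1 a2 i (glue U (flip V)) = glue U (flip (fP a2 a1 (3 - i) V))"
    using assms s by (simp add: eM_flip finite_supp_glue flip_glue fP_glue)
  moreover have "eP a1 a2 i (glue U (flip V)) = map_option (\<lambda>U'. glue U' (flip V)) (eP a1 a2 i U)"
    using assms by (simp add: eP_glue)
  ultimately show ?thesis
    unfolding etil_def phiL_el epsM_el[OF assms] by (simp add: el_def option.map_comp comp_def)
qed

lemma flip_elt_flip_elt [simp]: "flip_elt (flip_elt b) = b"
  by (simp add: flip_elt_def)

lemma wtT_flip:
  assumes "i \<in> {1, 2}"
  shows "wtT a2 a1 (3 - i) (flip_elt b) = - wtT a1 a2 i b"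
  using assms by (auto simp: wtT_def flip_elt_def wtM_flip pairw_def)

text \<open>After the exchange the strict test for \<open>f\<close> is the negation of the weak test
  for \<open>e\<close>, so ties are resolved consistently.\<close>

lemma ftil_flip:
  assumes "finite (supp (fst b))" "i \<in> {1, 2}"
  shows "ftil a2 a1 (3 - i) (flip_elt b) = map_option flip_elt (etil a1 a2 i b)"
proof -
  obtain z mu where b: "b = (z, mu)" using prod.exhaust by blast
  have fin: "finite (supp z)" "finite (supp (flip z))" using assms b by auto
  have p: "pairw (3 - i) (- snd mu, - fst mu) = - pairw i mu" using assms(2) by (auto simp: pairw_def)
  show ?thesis
    unfolding b el_self[of z mu] flip_elt_el ftil_el[OF fin(2,1) swap_in[OF assms(2)]] etil_el[OF fin assms(2)] p
    by (auto simp: flip_elt_el option.map_comp comp_def)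
qed

lemma etil_flip:
  assumes "finite (supp (fst b))" "i \<in> {1, 2}"
  shows "etil a2 a1 (3 - i) (flip_elt b) = map_option flip_elt (ftil a1 a2 i b)"
proof -
  have "ftil a1 a2 (3 - (3 - i)) (flip_elt (flip_elt b)) =
      map_option flip_elt (etil a2 a1 (3 - i) (flip_elt b))"
    by (rule ftil_flip) (use assms in \<open>auto simp: flip_elt_def\<close>)
  then show ?thesis by (simp add: option.map_comp comp_def option.map_ident)
qed

lemma finite_supp_ftil:
  assumes "ftil a1 a2 i b = Some c" "finite (supp (fst b))"
  shows "finite (supp (fst c))"
  using assms by (auto simp: ftil_def fP_def fM_def Let_def split: if_splits)

lemma finite_supp_etil:
  assumes "etil a1 a2 i b = Some c" "finite (supp (fst b))"
  shows "finite (supp (fst c))"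
  using assms by (auto simp: etil_def eP_def eM_def Let_def split: if_splits)

section \<open>Weyl group operators and extremality under the exchange\<close>

lemma iter_opt_simps [simp]:
  "iter_opt 0 g x = x" "iter_opt (Suc n) g x = Option.bind (iter_opt n g x) g"
  by (simp_all add: iter_opt_def)

lemma iter_opt_inv:
  assumes "\<And>b c. I b \<Longrightarrow> g b = Some c \<Longrightarrow> I c" "I b" "iter_opt n g (Some b) = Some c"
  shows "I c"
  using assms(3)
proof (induction n arbitrary: c)
  case 0
  then show ?case using assms(2) by simp
next
  case (Suc n)
  then obtain d where "iter_opt n g (Some b) = Some d" "g d = Some c"
    by (auto simp: bind_eq_Some_conv)
  with Suc.IH assms(1) show ?case by blast
qed

lemma iter_opt_map:
  assumes "\<And>b. I b \<Longrightarrow> h (F b) = map_option F (g b)" "\<And>b c. I b \<Longrightarrow> g b = Some c \<Longrightarrow> I c" "I b"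
  shows "iter_opt n h (Some (F b)) = map_option F (iter_opt n g (Some b))"
proof (induction n)
  case (Suc n)
  show ?case
  proof (cases "iter_opt n g (Some b)")
    case (Some c)
    have "I c" by (rule iter_opt_inv[where I = I, OF _ assms(3) Some]) (rule assms(2))
    with Some Suc show ?thesis by (simp add: assms(1))
  qed (use Suc in simp)
qed simp

lemma Sop_flip:
  assumes "finite (supp (fst b))" "i \<in> {1, 2}"
  shows "Sop a2 a1 (3 - i) (flip_elt b) = map_option flip_elt (Sop a1 a2 i b)"
proof -
  have "iter_opt n (ftil a2 a1 (3 - i)) (Some (flip_elt b)) =
      map_option flip_elt (iter_opt n (etil a1 a2 i) (Some b))" for n
    by (rule iter_opt_map[where I = "\<lambda>b. finite (supp (fst b))"])
      (use assms ftil_flip finite_supp_etil in auto)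
  moreover have "iter_opt n (etil a2 a1 (3 - i)) (Some (flip_elt b)) =
      map_option flip_elt (iter_opt n (ftil a1 a2 i) (Some b))" for n
    by (rule iter_opt_map[where I = "\<lambda>b. finite (supp (fst b))"])
      (use assms etil_flip finite_supp_ftil in auto)
  ultimately show ?thesis
    by (auto simp: Sop_def Let_def wtT_flip[OF assms(2)])
qed

lemma finite_supp_Sop:
  assumes "Sop a1 a2 i b = Some c" "finite (supp (fst b))"
  shows "finite (supp (fst c))"
proof -
  have "finite (supp (fst c))" if "iter_opt n (ftil a1 a2 i) (Some b) = Some c" for n
    by (rule iter_opt_inv[where I = "\<lambda>b. finite (supp (fst b))", OF _ assms(2) that])
      (use finite_supp_ftil in blast)
  moreover have "finite (supp (fst c))" if "iter_opt n (etil a1 a2 i) (Some b) = Some c" for n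
    by (rule iter_opt_inv[where I = "\<lambda>b. finite (supp (fst b))", OF _ assms(2) that])
      (use finite_supp_etil in blast)
  ultimately show ?thesis using assms(1) by (auto simp: Sop_def Let_def split: if_splits)
qed

lemma Sw_Cons: "Sw a1 a2 (j # js) b = Option.bind (Sw a1 a2 js b) (Sop a1 a2 j)"
  by (simp add: Sw_def)

lemma Sw_flip:
  assumes "finite (supp (fst b))" "set js \<subseteq> {1, 2}"
  shows "Sw a2 a1 (map (\<lambda>j. 3 - j) js) (flip_elt b) = map_option flip_elt (Sw a1 a2 js b) \<and>
    (\<forall>c. Sw a1 a2 js b = Some c \<longrightarrow> finite (supp (fst c)))"
  using assms(2)
proof (induction js)
  case Nil
  then show ?case using assms by (simp add: Sw_def)
next
  case (Cons j js)
  then have IH: "Sw a2 a1 (map (\<lambda>j. 3 - j) js) (flip_elt b) = map_option flip_elt (Sw a1 a2 js b)"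
    "\<And>c. Sw a1 a2 js b = Some c \<Longrightarrow> finite (supp (fst c))" and j: "j \<in> {1, 2}" by auto
  show ?case
  proof (cases "Sw a1 a2 js b")
    case None
    with IH(1) show ?thesis by (simp add: Sw_Cons)
  next
    case (Some c)
    note fc = IH(2)[OF Some]
    from Some IH(1) Sop_flip[OF fc j] show ?thesis
      by (auto simp: Sw_Cons dest: finite_supp_Sop[OF _ fc])
  qed
qed

text \<open>Words are translated letter by letter by \<open>j \<mapsto> 3 - j\<close>, and the sign
  change of the weight exchanges the two vanishing conditions. This lets the bound for
  \<open>Q\<close> be read off from the one for \<open>X\<close>.\<close>

lemma extremal_flip:
  assumes "finite (supp (fst b))" "extremal a1 a2 b"
  shows "extremal a2 a1 (flip_elt b)"
  unfolding extremal_def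
proof (intro allI impI ballI)
  fix js and i :: int and c assume js: "set js \<subseteq> {1, 2}" and i: "i \<in> {1, 2}"
    and c: "Sw a2 a1 js (flip_elt b) = Some c"
  let ?js = "map (\<lambda>j. 3 - j) js"
  have js': "set ?js \<subseteq> {1, 2}" using js by auto
  have "map (\<lambda>j. 3 - j) ?js = js" by (simp add: comp_def)
  then have "map_option flip_elt (Sw a1 a2 ?js b) = Some c"
    using Sw_flip[OF assms(1) js', of a2 a1] c by simp
  then obtain d where d: "Sw a1 a2 ?js b = Some d" "c = flip_elt d" "finite (supp (fst d))"
    using Sw_flip[OF assms(1) js', of a2 a1] by (cases "Sw a1 a2 ?js b") auto
  have "(wtT a1 a2 (3 - i) d \<ge> 0 \<longrightarrow> etil a1 a2 (3 - i) d = None) \<and>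
      (wtT a1 a2 (3 - i) d \<le> 0 \<longrightarrow> ftil a1 a2 (3 - i) d = None)"
    using assms(2) js' d(1) swap_in[OF i] unfolding extremal_def by blast
  moreover have "wtT a2 a1 i c = - wtT a1 a2 (3 - i) d"
    using wtT_flip[OF swap_in[OF i], of a2 a1 d] d(2) by simp
  ultimately show "(0 \<le> wtT a2 a1 i c \<longrightarrow> etil a2 a1 i c = None) \<and>
      (wtT a2 a1 i c \<le> 0 \<longrightarrow> ftil a2 a1 i c = None)"
    using ftil_flip[OF d(3) swap_in[OF i], of a2 a1] etil_flip[OF d(3) swap_in[OF i], of a2 a1] d(2)
    by simp
qed

subsection \<open>Bounds for strings and the string cone\<close>

lemma gam_props:
  assumes "1 \<le> a1" "1 \<le> a2" "a1 * a2 > 4"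
  shows gam_pos: "0 < gam a1 a2 k"
    and gam_rec: "gam a1 a2 (k + 1) + 1 / gam a1 a2 k = acoef a1 a2 (k + 1)"
    and gam_mult: "gam a1 a2 k * gam a1 a2 (k + 1) = alphaC a1 a2 * betaC a1 a2"
    and alpha_beta_gt1: "1 < alphaC a1 a2 * betaC a1 a2"
proof -
  define A where "A = real_of_int a1 * real_of_int a2"
  define s where "s = sqrt (A\<^sup>2 - 4 * A)"
  \<comment> \<open>\<open>T\<close> is the larger root of \<open>T^2 = 2 A T - 4 A\<close>, and
    \<open>\<alpha>\<close>, \<open>\<beta>\<close> are its multiples by \<open>1/(2 a2)\<close> and
    \<open>1/(2 a1)\<close>; this equation yields the recursion for \<open>\<gamma>\<close>.\<close>
  define T where "T = A + s"
  have A: "4 < A" using assms(3) unfolding A_def by (metis of_int_less_iff of_int_mult of_int_numeral)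
  have pos: "0 < real_of_int a1" "0 < real_of_int a2" using assms by auto
  have "0 \<le> A\<^sup>2 - 4 * A" using A by (simp add: power2_eq_square)
  then have s: "0 \<le> s" "s\<^sup>2 = A\<^sup>2 - 4 * A" by (simp_all add: s_def)
  have T: "4 < T" "A \<le> T" using A s by (simp_all add: T_def)
  have T2: "T * T = 2 * A * T - 4 * A" using s(2) by (simp add: T_def power2_eq_square algebra_simps)
  have eq: "(real_of_int a1)\<^sup>2 * (real_of_int a2)\<^sup>2 - 4 * real_of_int a1 * real_of_int a2 = A\<^sup>2 - 4 * A"
    by (simp add: A_def power2_eq_square algebra_simps)
  have al: "alphaC a1 a2 = T / (2 * real_of_int a2)" and be: "betaC a1 a2 = T / (2 * real_of_int a1)"
    unfolding alphaC_def betaC_def eq s_def[symmetric] T_def by (simp_all flip: A_def)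
  show "0 < gam a1 a2 k" using T pos by (simp add: gam_def al be)
  have "T / (2 * real_of_int a2) + 1 / (T / (2 * real_of_int a1)) = (T * T + 4 * A) / (2 * real_of_int a2 * T)"
    using T pos by (simp add: field_simps A_def)
  also have "\<dots> = real_of_int a1" unfolding T2 using T pos by (simp add: field_simps A_def)
  finally have 1: "alphaC a1 a2 + 1 / betaC a1 a2 = a1" by (simp add: al be)
  have "T / (2 * real_of_int a1) + 1 / (T / (2 * real_of_int a2)) = (T * T + 4 * A) / (2 * real_of_int a1 * T)"
    using T pos by (simp add: field_simps A_def)
  also have "\<dots> = real_of_int a2" unfolding T2 using T pos by (simp add: field_simps A_def)
  finally have 2: "betaC a1 a2 + 1 / alphaC a1 a2 = a2" by (simp add: al be)
  show "gam a1 a2 (k + 1) + 1 / gam a1 a2 k = acoef a1 a2 (k + 1)"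
    using 1 2 by (simp add: gam_def acoef_def)
  show "gam a1 a2 k * gam a1 a2 (k + 1) = alphaC a1 a2 * betaC a1 a2"
    by (simp add: gam_def mult.commute)
  have "4 * A < T * T"
    using mult_strict_right_mono[OF A, of A] mult_mono[OF T(2) T(2)] A T by linarith
  moreover have "alphaC a1 a2 * betaC a1 a2 = T * T / (4 * A)"
    by (simp add: al be A_def)
  ultimately show "1 < alphaC a1 a2 * betaC a1 a2" using A by simp
qed

lemma gam_swap: "gam a2 a1 k = gam a1 a2 (1 - k)"
  by (simp add: gam_def alphaC_def betaC_def mult.commute mult.left_commute)

text \<open>The truncations \<open>a - 1/(a' - 1/(a - \<dots>))\<close> of the continued fraction of \<open>\<gamma>\<close>; the last partial quotient is the one at \<open>s + 1\<close>.\<close>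

fun rho :: "int \<Rightarrow> int \<Rightarrow> int \<Rightarrow> nat \<Rightarrow> real" where
  "rho a1 a2 s 0 = acoef a1 a2 (s + 1)"
| "rho a1 a2 s (Suc n) = acoef a1 a2 (s + 2 + int n) - 1 / rho a1 a2 s n"

text \<open>\<open>\<gamma>\<close> solves the recursion of \<open>rho\<close> exactly, and one step
  multiplies the bound on the relative error by \<open>1/(\<alpha>\<beta>) < 1\<close>. Hence
  \<open>rho\<close> tends to \<open>\<gamma>\<close> when \<open>s + n\<close> is held fixed and
  \<open>n\<close> grows.\<close>

lemma rho_bounds:
  assumes "1 \<le> a1" "1 \<le> a2" "a1 * a2 > 4"
  shows "gam a1 a2 (s + 1 + int n) \<le> rho a1 a2 s n \<and>
    rho a1 a2 s n \<le> gam a1 a2 (s + 1 + int n) * (1 + (1 / (alphaC a1 a2 * betaC a1 a2)) ^ n)"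
proof (induction n)
  case 0
  note g = gam_pos[OF assms]
  have m: "1 < gam a1 a2 s * gam a1 a2 (s + 1)" using gam_mult[OF assms] alpha_beta_gt1[OF assms] by simp
  have r: "rho a1 a2 s 0 = gam a1 a2 (s + 1) + 1 / gam a1 a2 s"
    using gam_rec[OF assms, of s] by simp
  have "1 / gam a1 a2 s \<le> gam a1 a2 (s + 1)" using m g[of s] by (simp add: field_simps)
  then show ?case unfolding r using g[of s] by simp
next
  case (Suc n)
  let ?q = "alphaC a1 a2 * betaC a1 a2"
  let ?g = "gam a1 a2 (s + 1 + int n)" and ?g' = "gam a1 a2 (s + 2 + int n)" and ?r = "rho a1 a2 s n"
  let ?e = "(1 / ?q) ^ n"
  have g: "0 < ?g" "0 < ?g'" using gam_pos[OF assms] by auto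
  have m: "?g * ?g' = ?q" using gam_mult[OF assms, of "s + 1 + int n"] by (simp add: algebra_simps)
  have IH: "?g \<le> ?r" "?r \<le> ?g * (1 + ?e)" using Suc by auto
  have rec: "?g' + 1 / ?g = acoef a1 a2 (s + 2 + int n)"
    using gam_rec[OF assms, of "s + 1 + int n"] by (simp add: algebra_simps)
  have r: "rho a1 a2 s (Suc n) = ?g' + (1 / ?g - 1 / ?r)" using rec by simp
  have d: "1 / ?g - 1 / ?r = (?r - ?g) / (?g * ?r)" using g IH by (simp add: field_simps)
  have "(?r - ?g) / (?g * ?r) \<le> (?g * ?e) / (?g * ?g)"
    using g IH by (intro frac_le mult_left_mono) (auto simp: algebra_simps)
  also have "\<dots> = ?g' * (1 / ?q) ^ Suc n" using g by (simp add: m[symmetric] field_simps)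
  finally have "1 / ?g - 1 / ?r \<le> ?g' * (1 / ?q) ^ Suc n" unfolding d .
  moreover have "0 \<le> 1 / ?g - 1 / ?r" using g IH by (simp add: d)
  moreover have "s + 1 + int (Suc n) = s + 2 + int n" by simp
  ultimately show ?case unfolding r by (simp only: distrib_left mult_1_right) linarith
qed

lemma rho_pos:
  assumes "1 \<le> a1" "1 \<le> a2" "a1 * a2 > 4"
  shows "0 < rho a1 a2 s n"
  using rho_bounds[OF assms, of s n] gam_pos[OF assms, of "s + 1 + int n"] by linarith

text \<open>Only the case \<open>t = 1\<close> concerns the string; the induction needs the inequality for all truncations of the sequence at once.\<close>

lemma tmax_chain_le:
  assumes a: "1 \<le> a1" "1 \<le> a2" "a1 * a2 > 4"
    and fin: "\<And>j. s \<le> j \<Longrightarrow> finite (supp (U j))"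
    and U: "\<And>j. s \<le> j \<Longrightarrow> U (j + 1) = Emax a1 a2 (idx j) (U j)"
    and "1 \<le> t"
  shows "real_of_int (tmax a1 a2 (idx (s + 2 + int n)) t (U (s + 2 + int n))) \<le>
    rho a1 a2 s n * real_of_int (tmax a1 a2 (idx (s + 1 + int n)) t (U (s + 1 + int n)))"
  using assms(6)
proof (induction n arbitrary: t)
  case 0
  have f: "finite (supp (U (s + 1)))" "finite (supp (U (s + 2)))" "finite (supp (U s))"
    using fin by simp_all
  obtain r where r: "t \<le> r" "idx r = idx (s + 2)"
    "sigmaP a1 a2 r (U (s + 2)) = tmax a1 a2 (idx (s + 2)) t (U (s + 2))"
    using tmax_attained[OF f(2) idx_in] by metis
  have r1: "1 \<le> r" using r(1) 0 by simp
  have "sigmaP a1 a2 r (U (s + 2)) = sigmaP a1 a2 r (U (s + 1)) +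
      acoef a1 a2 (s + 1) * tmax a1 a2 (idx (s + 1)) (r + 1) (U (s + 1))"
    using sigmaP_Emax[OF f(1) idx_in r1, of a1 a2 "s + 1"] U[of "s + 1"] r(2) idx_Suc_neq[of s]
      cartan_idx_adj[of a1 a2 s] by (auto simp: add.commute)
  \<comment> \<open>\<open>U (s + 1)\<close> is a maximal raising in the colour of \<open>r\<close>,
    so its signatures of that colour at positions from 1 on are at most 0.\<close>
  also have "sigmaP a1 a2 r (U (s + 1)) \<le> 0"
    using tmax_ge[OF f(1) r1, of "idx s" a1 a2] r(2) U[of s] Emax_props[OF f(3) idx_in[of s], of a1 a2]
    by (simp add: sigP_tmax)
  also have "acoef a1 a2 (s + 1) * tmax a1 a2 (idx (s + 1)) (r + 1) (U (s + 1)) \<le>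
      acoef a1 a2 (s + 1) * tmax a1 a2 (idx (s + 1)) t (U (s + 1))"
    using tmax_antimono[OF f(1) idx_in, of t "r + 1" a1 a2 "s + 1"] r(1) a
    by (intro mult_left_mono) (auto simp: acoef_def)
  finally show ?case
    unfolding r(3) by (simp flip: of_int_mult)
next
  case (Suc n)
  define j where "j = s + 2 + int n"
  have f: "finite (supp (U (j - 1)))" "finite (supp (U j))" "finite (supp (U (j + 1)))"
    using fin by (simp_all add: j_def)
  have js: "s \<le> j" "s \<le> j - 1" by (simp_all add: j_def)
  obtain r where r: "t \<le> r" "idx r = idx (j + 1)"
    "sigmaP a1 a2 r (U (j + 1)) = tmax a1 a2 (idx (j + 1)) t (U (j + 1))"
    using tmax_attained[OF f(3) idx_in] by metis
  have r1: "1 \<le> r" using r(1) Suc.prems by simp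
  have ij: "idx (j + 1) = idx (j - 1)" by (simp add: idx_def)
  have ne: "idx (j - 1) \<noteq> idx j" using idx_Suc_neq[of "j - 1"] by simp
  let ?m = "tmax a1 a2 (idx j) (r + 1) (U j)" and ?m' = "tmax a1 a2 (idx (j - 1)) (r + 1) (U (j - 1))"
  have "sigmaP a1 a2 r (U (j + 1)) = sigmaP a1 a2 r (U j) + acoef a1 a2 j * ?m"
    using sigmaP_Emax[OF f(2) idx_in r1, of a1 a2 j] U[of j] r(2) ij ne
      cartan_idx_adj(1)[of a1 a2 "j - 1"] js by auto
  also have "sigmaP a1 a2 r (U j) = sigmaP a1 a2 r (U (j - 1)) - tmax a1 a2 (idx (j - 1)) r (U (j - 1)) - ?m'"
    using sigmaP_Emax[OF f(1) idx_in r1, of a1 a2 "j - 1"] U[of "j - 1"] r(2) ij js by simp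
  \<comment> \<open>The value at \<open>r\<close> is absorbed by the tail maximum from
    \<open>r\<close>. What remains is \<open>M_{j+1} \<le> a M_j - M_{j-1}\<close>, with the tails
    from \<open>r + 1\<close> on the right.\<close>
  also have "\<dots> \<le> - ?m'" using tmax_ge[OF f(1) order.refl, of r "idx (j - 1)" a1 a2] r(2) ij by simp
  finally have 1: "tmax a1 a2 (idx (j + 1)) t (U (j + 1)) \<le> acoef a1 a2 j * ?m - ?m'"
    unfolding r(3) by simp
  have IH: "real_of_int ?m \<le> rho a1 a2 s n * real_of_int ?m'"
    using Suc.IH[of "r + 1"] r1 by (simp add: j_def algebra_simps)
  have rp: "0 < rho a1 a2 s n" "0 < rho a1 a2 s (Suc n)" using rho_pos[OF a] by blast+
  have "real_of_int (tmax a1 a2 (idx (j + 1)) t (U (j + 1))) \<le> acoef a1 a2 j * real_of_int ?m - ?m'"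
    using 1 by (simp flip: of_int_mult of_int_diff)
  also have "\<dots> \<le> acoef a1 a2 j * real_of_int ?m - real_of_int ?m / rho a1 a2 s n"
    using IH rp by (simp add: field_simps)
  also have "\<dots> = rho a1 a2 s (Suc n) * real_of_int ?m"
    by (simp add: j_def algebra_simps)
  also have "\<dots> \<le> rho a1 a2 s (Suc n) * real_of_int (tmax a1 a2 (idx j) t (U j))"
    using tmax_antimono[OF f(2) idx_in, of t "r + 1" a1 a2 j] r(1) rp(2) by (intro mult_left_mono) auto
  finally show ?case by (simp add: j_def algebra_simps)
qed

text \<open>The string cone of rank 2, for strings that start at index 1. The chain begins with the
  ratio of the entries 3 and 2, for which \<open>rho\<close> is a single partial quotient.\<close>

definition cone :: "int \<Rightarrow> int \<Rightarrow> (int \<Rightarrow> int) set" where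
  "cone a1 a2 = {z. finite (supp z) \<and> (\<forall>k\<le>0. z k = 0) \<and> (\<forall>k. 0 \<le> z k) \<and>
     (\<forall>n. real_of_int (z (3 + int n)) \<le> rho a1 a2 1 n * real_of_int (z (2 + int n)))}"

lemma coneD:
  assumes "z \<in> cone a1 a2"
  shows "finite (supp z)" "k \<le> 0 \<Longrightarrow> z k = 0" "0 \<le> z k"
    "real_of_int (z (3 + int n)) \<le> rho a1 a2 1 n * real_of_int (z (2 + int n))"
  using assms by (auto simp: cone_def)

text \<open>If \<open>f_i\<close> acts at \<open>m \<ge> 3\<close>, the signature at
  \<open>m - 2\<close> is smaller, which reads \<open>z_m + 1 \<le> a z_{m-1} - z_{m-2}\<close>.
  Bounding \<open>z_{m-2}\<close> from below by \<open>z_{m-1} / rho\<close> reproduces the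
  recursion of \<open>rho\<close>; at \<open>m = 3\<close> non-negativity of \<open>z_1\<close>
  suffices.\<close>

lemma cone_fP:
  assumes a: "1 \<le> a1" "1 \<le> a2" "a1 * a2 > 4" and z: "z \<in> cone a1 a2" and i: "i \<in> {1, 2}"
  shows "fP a1 a2 i z \<in> cone a1 a2"
proof -
  note zc = coneD[OF z]
  obtain m where m: "1 \<le> m" "idx m = i" and f: "fP a1 a2 i z = z(m := z m + 1)"
    and sm: "sigmaP a1 a2 m z = sigP a1 a2 i z"
    and l: "\<And>k. 1 \<le> k \<Longrightarrow> k < m \<Longrightarrow> idx k = i \<Longrightarrow> sigmaP a1 a2 k z < sigP a1 a2 i z"
    using fP_at[OF zc(1) i] by metis
  have key: "real_of_int (z m + 1) \<le> rho a1 a2 1 n * real_of_int (z (m - 1))" if n: "m = 3 + int n" for n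
  proof -
    have "sigmaP a1 a2 (m - 2) z < sigmaP a1 a2 m z" using l[of "m - 2"] n m(2) sm by (simp only: idx_add2)
    then have "z m + 1 \<le> acoef a1 a2 (m - 1) * z (m - 1) - z (m - 2)"
      using sigmaP_diff[OF zc(1), of a1 a2 "m - 2"] by simp
    then have le: "real_of_int (z m + 1) \<le> acoef a1 a2 (m - 1) * real_of_int (z (m - 1)) - z (m - 2)"
      by (simp flip: of_int_mult of_int_diff)
    show ?thesis
    proof (cases n)
      case 0
      then show ?thesis using le zc(3)[of "m - 2"] n by simp
    next
      case (Suc n')
      have rp: "0 < rho a1 a2 1 n'" using rho_pos[OF a] .
      have "real_of_int (z (m - 1)) \<le> rho a1 a2 1 n' * real_of_int (z (m - 2))"
        using zc(4)[of n'] n Suc by (simp add: algebra_simps)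
      then have "real_of_int (z (m - 1)) / rho a1 a2 1 n' \<le> real_of_int (z (m - 2))"
        using rp by (simp add: field_simps)
      then show ?thesis using le n Suc by (simp add: algebra_simps)
    qed
  qed
  have "real_of_int ((z(m := z m + 1)) (3 + int n)) \<le> rho a1 a2 1 n * real_of_int ((z(m := z m + 1)) (2 + int n))" for n
  proof (cases "m = 3 + int n")
    case True
    then show ?thesis using key[OF True] by (simp add: algebra_simps)
  next
    case False
    then show ?thesis using zc(4)[of n] rho_pos[OF a, of 1 n] by (auto simp: algebra_simps)
  qed
  then show ?thesis unfolding f cone_def using zc(1-3) m(1) by auto
qed

text \<open>The strict drop of the signature from \<open>m\<close> to \<open>m + 2\<close> gives
  \<open>a z_{m+1} - z_{m+2} \<le> z_m - 1\<close>, and the bound on \<open>z_{m+2}\<close> turns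
  this into the inequality between \<open>z_{m+1}\<close> and the lowered entry.\<close>

lemma cone_eP:
  assumes a: "1 \<le> a1" "1 \<le> a2" "a1 * a2 > 4" and z: "z \<in> cone a1 a2" and i: "i \<in> {1, 2}"
    and e: "eP a1 a2 i z = Some z'"
  shows "z' \<in> cone a1 a2"
proof -
  note zc = coneD[OF z]
  have "0 < sigP a1 a2 i z" using e by (auto simp: eP_def split: if_splits)
  then obtain m where m: "1 \<le> m" "idx m = i" and f: "z' = z(m := z m - 1)"
    and sm: "sigmaP a1 a2 (m + 2) z < sigmaP a1 a2 m z"
    using eP_cases[OF zc(1) i] e by (metis option.inject)
  have "acoef a1 a2 (m + 1) * z (m + 1) - z (m + 2) \<le> z m - 1"
    using sm sigmaP_diff[OF zc(1), of a1 a2 m] by simp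
  then have le: "acoef a1 a2 (m + 1) * real_of_int (z (m + 1)) - z (m + 2) \<le> real_of_int (z m - 1)"
    by (simp flip: of_int_mult of_int_diff)
  have key: "real_of_int (z (m + 1)) \<le> rho a1 a2 1 n * real_of_int (z m - 1)" if n: "m = 2 + int n" for n
  proof -
    have rp: "0 < rho a1 a2 1 n" using rho_pos[OF a] .
    have "real_of_int (z (m + 2)) \<le> rho a1 a2 1 (Suc n) * real_of_int (z (m + 1))"
      using zc(4)[of "Suc n"] n by (simp add: algebra_simps)
    with le have "real_of_int (z (m + 1)) / rho a1 a2 1 n \<le> real_of_int (z m - 1)"
      using n by (simp add: algebra_simps)
    then show ?thesis using rp by (simp add: field_simps)
  qed
  \<comment> \<open>The lowered entry stays non-negative because a positive multiple of it dominates
    the next entry; at \<open>m = 1\<close> the bound for \<open>z_3\<close> is used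
    directly.\<close>
  have nn: "0 \<le> z m - 1"
  proof (cases "m = 1")
    case True
    then have "0 \<le> real_of_int (z m - 1)" using le zc(4)[of 0] by simp
    then show ?thesis by simp
  next
    case False
    then have "m = 2 + int (nat (m - 2))" using m by simp
    from key[OF this] zc(3)[of "m + 1"] rho_pos[OF a, of 1 "nat (m - 2)"]
    have "0 \<le> rho a1 a2 1 (nat (m - 2)) * real_of_int (z m - 1)" by linarith
    then have "0 \<le> real_of_int (z m - 1)" using rho_pos[OF a, of 1 "nat (m - 2)"]
      by (simp add: zero_le_mult_iff)
    then show ?thesis by simp
  qed
  have "real_of_int ((z(m := z m - 1)) (3 + int n)) \<le> rho a1 a2 1 n * real_of_int ((z(m := z m - 1)) (2 + int n))" for n
  proof (cases "m = 2 + int n")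
    case True
    then show ?thesis using key[OF True] by (simp add: algebra_simps)
  next
    case False
    then show ?thesis using zc(4)[of n] by auto
  qed
  then show ?thesis unfolding f cone_def using zc(1-3) m(1) nn by auto
qed

lemma ImP_cone:
  assumes "1 \<le> a1" "1 \<le> a2" "a1 * a2 > 4" "z \<in> ImP a1 a2"
  shows "z \<in> cone a1 a2"
  using assms(4)
proof induction
  case zero
  then show ?case by (simp add: cone_def supp_def)
next
  case (step z i)
  then show ?case using cone_fP[OF assms(1-3)] by blast
qed

lemma cone_Emax:
  assumes "1 \<le> a1" "1 \<le> a2" "a1 * a2 > 4" "z \<in> cone a1 a2" "i \<in> {1, 2}"
  shows "Emax a1 a2 i z \<in> cone a1 a2"
proof -
  have "z \<in> cone a1 a2 \<longrightarrow> Emax a1 a2 i z \<in> cone a1 a2"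
    using coneD(1)[OF assms(4)] assms(5)
  proof (induction rule: fP_induct[where ?a1.0 = a1 and ?a2.0 = a2])
    case (zero z)
    then show ?case using Emax_zero[OF zero(1) assms(5)] by simp
  next
    case (step z)
    then show ?case
      using cone_eP[OF assms(1-3) _ assms(5) eP_fP[OF step(1) assms(5)]] Emax_fP[OF step(1) assms(5)] by simp
  qed
  with assms(4) show ?thesis by simp
qed

subsection \<open>The string of an element\<close>

text \<open>For entries at indices \<open>k \<ge> 1\<close> the height of \<open>-wt z\<close>. It
  is the grading with finite pieces in the cone, and the measure for termination.\<close>

definition ztotal :: "(int \<Rightarrow> int) \<Rightarrow> int" where
  "ztotal z = (\<Sum>k\<in>supp z. z k)"

fun strip :: "int \<Rightarrow> int \<Rightarrow> (int \<Rightarrow> int) \<Rightarrow> nat \<Rightarrow> int \<Rightarrow> int" where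
  "strip a1 a2 w 0 = w"
| "strip a1 a2 w (Suc n) = Emax a1 a2 (idx (int n + 1)) (strip a1 a2 w n)"

definition str :: "int \<Rightarrow> int \<Rightarrow> (int \<Rightarrow> int) \<Rightarrow> int \<Rightarrow> int" where
  "str a1 a2 w j = (if 1 \<le> j then sigP a1 a2 (idx j) (strip a1 a2 w (nat (j - 1))) else 0)"

lemma ztotal_superset:
  assumes "finite S" "supp z \<subseteq> S"
  shows "ztotal z = (\<Sum>k\<in>S. z k)"
  unfolding ztotal_def using assms by (intro sum.mono_neutral_left) (auto simp: supp_def)

lemma ztotal_fP:
  assumes "finite (supp z)"
  shows "ztotal (fP a1 a2 i z) = ztotal z + 1"
proof -
  obtain m where m: "fP a1 a2 i z = z(m := z m + 1)" by (simp add: fP_def Let_def)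
  let ?S = "insert m (supp z)"
  have fin: "finite ?S" using assms by simp
  have "ztotal (z(m := z m + 1)) = (\<Sum>k\<in>?S. (z(m := z m + 1)) k)"
    by (rule ztotal_superset[OF fin]) (auto simp: supp_def)
  also have "\<dots> = (\<Sum>k\<in>?S. z k + (if k = m then 1 else 0))" by (rule sum.cong) auto
  also have "\<dots> = (\<Sum>k\<in>?S. z k) + 1" using fin by (subst sum.distrib) simp
  also have "(\<Sum>k\<in>?S. z k) = ztotal z" using ztotal_superset[OF fin, of z] by (simp add: subset_insertI)
  finally show ?thesis unfolding m .
qed

lemma ztotal_Emax:
  assumes "finite (supp z)" "i \<in> {1, 2}"
  shows "ztotal z = ztotal (Emax a1 a2 i z) + sigP a1 a2 i z"
  using assms
proof (induction rule: fP_induct[where ?a1.0 = a1 and ?a2.0 = a2])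
  case (zero z)
  then show ?case using Emax_zero[OF zero(1) assms(2)] by simp
next
  case (step z)
  then show ?case
    using Emax_fP[OF step(1) assms(2), of a1 a2] sigP_fP[OF step(1) assms(2), of a1 a2] ztotal_fP[OF step(1)]
    by simp
qed

lemma ztotal_nonneg: "z \<in> cone a1 a2 \<Longrightarrow> 0 \<le> ztotal z"
  unfolding ztotal_def using coneD(3) by (blast intro: sum_nonneg)

text \<open>At the last nonzero position the signature equals the entry, which would make some
  \<open>\<epsilon>_i\<close> positive.\<close>

lemma sigP_zero_imp_zero:
  assumes zc: "finite (supp z)" "\<And>k. k \<le> 0 \<Longrightarrow> z k = 0" "\<And>k. 0 \<le> z k"
    and s: "\<And>i. i \<in> {1, 2} \<Longrightarrow> sigP a1 a2 i z = 0"
  shows "z = (\<lambda>_. 0)"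
proof (rule ccontr)
  assume "z \<noteq> (\<lambda>_. 0)"
  then have ne: "supp z \<noteq> {}" by (auto simp: supp_def)
  define k where "k = Max (supp z)"
  have k: "z k \<noteq> 0" using Max_in[OF zc(1) ne] by (simp add: k_def supp_def)
  then have k1: "1 \<le> k" using zc(2)[of k] by fastforce
  have "z j = 0" if "k < j" for j
    using Max_ge[OF zc(1), of j] that by (force simp: k_def supp_def)
  then have "{j. k < j \<and> z j \<noteq> 0} = {}" by auto
  then have "sigmaP a1 a2 k z = z k" unfolding sigmaP_def by (simp del: Collect_empty_eq)
  then have "z k \<le> 0"
    using tmax_ge[OF zc(1) k1, of "idx k" a1 a2] s[OF idx_in] by (simp add: sigP_tmax)
  with k zc(3)[of k] show False by simp
qed

lemma strip_cone:
  assumes "1 \<le> a1" "1 \<le> a2" "a1 * a2 > 4" "w \<in> cone a1 a2"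
  shows "strip a1 a2 w n \<in> cone a1 a2"
  by (induction n) (use assms cone_Emax[OF assms(1-3) _ idx_in] in auto)

lemma str_Suc: "str a1 a2 w (int n + 1) = sigP a1 a2 (idx (int n + 1)) (strip a1 a2 w n)"
  by (simp add: str_def)

lemma strip_unfold:
  assumes "1 \<le> a1" "1 \<le> a2" "a1 * a2 > 4" "w \<in> cone a1 a2"
  shows "strip a1 a2 w n = (fP a1 a2 (idx (int n + 1)) ^^ nat (str a1 a2 w (int n + 1))) (strip a1 a2 w (Suc n))"
    "ztotal (strip a1 a2 w n) = ztotal (strip a1 a2 w (Suc n)) + str a1 a2 w (int n + 1)"
    "sigP a1 a2 (idx (int n + 1)) (strip a1 a2 w (Suc n)) = 0"
proof -
  have fin: "finite (supp (strip a1 a2 w n))" using coneD(1)[OF strip_cone[OF assms]] .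
  show "strip a1 a2 w n = (fP a1 a2 (idx (int n + 1)) ^^ nat (str a1 a2 w (int n + 1))) (strip a1 a2 w (Suc n))"
    "sigP a1 a2 (idx (int n + 1)) (strip a1 a2 w (Suc n)) = 0"
    using Emax_props[OF fin idx_in, of a1 a2 "int n + 1"] by (simp_all add: str_Suc)
  show "ztotal (strip a1 a2 w n) = ztotal (strip a1 a2 w (Suc n)) + str a1 a2 w (int n + 1)"
    using ztotal_Emax[OF fin idx_in, of a1 a2 "int n + 1"] by (simp add: str_Suc)
qed

lemma str_nonneg:
  assumes "1 \<le> a1" "1 \<le> a2" "a1 * a2 > 4" "w \<in> cone a1 a2"
  shows "0 \<le> str a1 a2 w j"
  using sigP_nonneg[OF coneD(1)[OF strip_cone[OF assms]] idx_in] by (simp add: str_def)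

lemma idx_cases_adj: "i \<in> {1, 2} \<Longrightarrow> i = idx k \<or> i = idx (k + 1)"
  by (auto simp: idx_def)

lemma strip_zero:
  assumes "1 \<le> a1" "1 \<le> a2" "a1 * a2 > 4" "w \<in> cone a1 a2"
    and "sigP a1 a2 (idx (int n)) (strip a1 a2 w n) = 0" "str a1 a2 w (int n + 1) = 0"
  shows "strip a1 a2 w n = (\<lambda>_. 0)"
proof (rule sigP_zero_imp_zero[where ?a1.0 = a1 and ?a2.0 = a2])
  note zc = coneD[OF strip_cone[OF assms(1-4)]]
  show "finite (supp (strip a1 a2 w n))" "\<And>k. k \<le> 0 \<Longrightarrow> strip a1 a2 w n k = 0" "\<And>k. 0 \<le> strip a1 a2 w n k"
    using zc by blast+
  fix i :: int assume "i \<in> {1, 2}"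
  then show "sigP a1 a2 i (strip a1 a2 w n) = 0"
    using idx_cases_adj[of i "int n"] assms(5,6) by (auto simp: str_Suc)
qed

text \<open>After a maximal raising in one colour, a zero exponent for the other means that both
  \<open>\<epsilon>_i\<close> vanish, so the element is zero. Otherwise each step lowers the total
  by at least 1; the first step is not counted, since its exponent may be 0.\<close>

lemma strip_ztotal_bound:
  assumes a: "1 \<le> a1" "1 \<le> a2" "a1 * a2 > 4" and w: "w \<in> cone a1 a2"
  shows "strip a1 a2 w (Suc n) = (\<lambda>_. 0) \<or> ztotal (strip a1 a2 w (Suc n)) + int n \<le> ztotal w"
proof (induction n)
  case 0
  then show ?case using strip_unfold(2)[OF a w, of 0] str_nonneg[OF a w, of 1] by simp
next
  case (Suc n)
  show ?case
  proof (cases "str a1 a2 w (int (Suc n) + 1) = 0")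
    case True
    have z: "sigP a1 a2 (idx (int (Suc n))) (strip a1 a2 w (Suc n)) = 0"
      using strip_unfold(3)[OF a w, of n] by (simp add: add.commute)
    note z0 = strip_zero[OF a w z True]
    have "strip a1 a2 w (Suc (Suc n)) = strip a1 a2 w (Suc n)"
      using strip_unfold(1)[OF a w, of "Suc n"] True by simp
    with z0 show ?thesis by simp
  next
    case False
    then have pos: "0 < str a1 a2 w (int (Suc n) + 1)" using str_nonneg[OF a w] by (metis order_le_less)
    have "strip a1 a2 w (Suc n) \<noteq> (\<lambda>_. 0)"
    proof
      assume "strip a1 a2 w (Suc n) = (\<lambda>_. 0)"
      then have "ztotal (strip a1 a2 w (Suc n)) = 0" by (simp only: ztotal_def) simp
      then show False
        using strip_unfold(2)[OF a w, of "Suc n"] pos ztotal_nonneg[OF strip_cone[OF a w, of "Suc (Suc n)"]]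
        by linarith
    qed
    then show ?thesis using Suc strip_unfold(2)[OF a w, of "Suc n"] pos by simp
  qed
qed

lemma strip_eventually_zero:
  assumes a: "1 \<le> a1" "1 \<le> a2" "a1 * a2 > 4" and w: "w \<in> cone a1 a2" and n: "ztotal w + 2 \<le> int n"
  shows "strip a1 a2 w n = (\<lambda>_. 0)"
proof -
  obtain m where m: "n = Suc m" using n ztotal_nonneg[OF w] by (cases n) auto
  show ?thesis using strip_ztotal_bound[OF a w, of m] n ztotal_nonneg[OF strip_cone[OF a w, of n]]
    unfolding m by auto
qed

lemma str_eventually_zero:
  assumes a: "1 \<le> a1" "1 \<le> a2" "a1 * a2 > 4" and w: "w \<in> cone a1 a2" and j: "ztotal w + 3 \<le> j"
  shows "str a1 a2 w j = 0"
proof -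
  have j1: "1 \<le> j" using j ztotal_nonneg[OF w] by simp
  have "strip a1 a2 w (nat (j - 1)) = (\<lambda>_. 0)" "strip a1 a2 w (Suc (nat (j - 1))) = (\<lambda>_. 0)"
    by (rule strip_eventually_zero[OF a w]; use j j1 in simp)+
  then show ?thesis using strip_unfold(2)[OF a w, of "nat (j - 1)"] j1 by simp
qed

lemma supp_str:
  assumes "1 \<le> a1" "1 \<le> a2" "a1 * a2 > 4" "w \<in> cone a1 a2"
  shows "supp (str a1 a2 w) \<subseteq> {1..ztotal w + 2}"
proof
  fix j assume "j \<in> supp (str a1 a2 w)"
  then have "str a1 a2 w j \<noteq> 0" by (simp add: supp_def)
  then show "j \<in> {1..ztotal w + 2}"
    using str_eventually_zero[OF assms, of j] by (cases "1 \<le> j"; cases "ztotal w + 3 \<le> j") (auto simp: str_def)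
qed

lemma ztotal_str:
  assumes a: "1 \<le> a1" "1 \<le> a2" "a1 * a2 > 4" and w: "w \<in> cone a1 a2"
  shows "ztotal (str a1 a2 w) = ztotal w"
proof -
  have "ztotal w = (\<Sum>j\<in>{1..int n}. str a1 a2 w j) + ztotal (strip a1 a2 w n)" for n
  proof (induction n)
    case (Suc n)
    have "{1..int (Suc n)} = insert (int n + 1) {1..int n}" by auto
    then have "(\<Sum>j\<in>{1..int (Suc n)}. str a1 a2 w j) = str a1 a2 w (int n + 1) + (\<Sum>j\<in>{1..int n}. str a1 a2 w j)"
      by simp
    with Suc strip_unfold(2)[OF a w, of n] show ?case by linarith
  qed simp
  from this[of "nat (ztotal w + 2)"] have "ztotal w = (\<Sum>j\<in>{1..ztotal w + 2}. str a1 a2 w j) + ztotal (strip a1 a2 w (nat (ztotal w + 2)))"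
    using ztotal_nonneg[OF w] by simp
  moreover have "strip a1 a2 w (nat (ztotal w + 2)) = (\<lambda>_. 0)"
    by (rule strip_eventually_zero[OF a w]) simp
  moreover have "ztotal (\<lambda>_. 0) = 0" by (simp add: ztotal_def)
  ultimately show ?thesis using ztotal_superset[OF _ supp_str[OF a w]] by simp
qed

lemma str_cone:
  assumes a: "1 \<le> a1" "1 \<le> a2" "a1 * a2 > 4" and w: "w \<in> cone a1 a2"
  shows "str a1 a2 w \<in> cone a1 a2"
proof -
  define U where "U j = strip a1 a2 w (nat (j - 1))" for j :: int
  have fin: "finite (supp (U j))" for j unfolding U_def using coneD(1)[OF strip_cone[OF a w]] .
  have U: "U (j + 1) = Emax a1 a2 (idx j) (U j)" if "1 \<le> j" for j
  proof -
    have "nat (j + 1 - 1) = Suc (nat (j - 1))" using that by simp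
    then show ?thesis using that by (simp add: U_def)
  qed
  have X: "str a1 a2 w j = tmax a1 a2 (idx j) 1 (U j)" if "1 \<le> j" for j
    using that by (simp add: str_def U_def sigP_tmax)
  have "real_of_int (str a1 a2 w (3 + int n)) \<le> rho a1 a2 1 n * real_of_int (str a1 a2 w (2 + int n))" for n
    using tmax_chain_le[where U = U and s = 1 and t = 1 and n = n, OF a fin U] X by simp
  moreover have "finite (supp (str a1 a2 w))"
    using supp_str[OF a w] by (rule finite_subset) simp
  moreover have "\<forall>k\<le>0. str a1 a2 w k = 0" by (simp add: str_def)
  ultimately show ?thesis using str_nonneg[OF a w] by (simp add: cone_def)
qed

section \<open>Recovering an element from its string\<close>

lemma foldr_pow_chain:
  assumes "\<And>j. 1 \<le> j \<Longrightarrow> j \<le> int n \<Longrightarrow> U j = (g j ^^ x j) (U (j + 1))"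
  shows "foldr (\<lambda>k. g k ^^ x k) [1..int n] (U (int n + 1)) = U 1"
  using assms
proof (induction n)
  case (Suc n)
  have "[1..int (Suc n)] = [1..int n] @ [int n + 1]" by (subst upto_rec2) (auto simp: algebra_simps)
  then have "foldr (\<lambda>k. g k ^^ x k) [1..int (Suc n)] (U (int (Suc n) + 1)) =
      foldr (\<lambda>k. g k ^^ x k) [1..int n] ((g (int n + 1) ^^ x (int n + 1)) (U (int n + 1 + 1)))"
    by (simp add: add.commute)
  also have "(g (int n + 1) ^^ x (int n + 1)) (U (int n + 1 + 1)) = U (int n + 1)"
    using Suc.prems[of "int n + 1"] by simp
  also have "foldr (\<lambda>k. g k ^^ x k) [1..int n] (U (int n + 1)) = U 1"
    by (rule Suc.IH) (use Suc.prems in simp)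
  finally show ?case .
qed simp

lemma bound_ge:
  assumes "finite (supp z)" "z k \<noteq> 0"
  shows "\<bar>k\<bar> \<le> bound z"
proof -
  have "{\<bar>k\<bar> | k. z k \<noteq> 0} = abs ` supp z" by (auto simp: supp_def)
  then have fin: "finite ({0} \<union> {\<bar>k\<bar> | k. z k \<noteq> 0})" using assms by simp
  show ?thesis unfolding bound_def by (rule Max_ge[OF fin]) (use assms in auto)
qed

lemma bound_nonneg:
  assumes "finite (supp z)"
  shows "0 \<le> bound z"
proof -
  have "{\<bar>k\<bar> | k. z k \<noteq> 0} = abs ` supp z" by (auto simp: supp_def)
  then have fin: "finite ({0} \<union> {\<bar>k\<bar> | k. z k \<noteq> 0})" using assms by simp
  show "0 \<le> bound z" unfolding bound_def by (rule Max_ge[OF fin]) auto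
qed

lemma strip_tail_zero:
  assumes a: "1 \<le> a1" "1 \<le> a2" "a1 * a2 > 4" and w: "w \<in> cone a1 a2"
    and z: "\<And>j. int n < j \<Longrightarrow> str a1 a2 w j = 0"
  shows "strip a1 a2 w n = (\<lambda>_. 0)"
proof -
  have eq: "strip a1 a2 w (Suc n) = strip a1 a2 w n"
    using strip_unfold(1)[OF a w, of n] z[of "int n + 1"] by simp
  have "strip a1 a2 w (Suc n) = (\<lambda>_. 0)"
    by (rule strip_zero[OF a w])
      (use strip_unfold(3)[OF a w, of n] z[of "int (Suc n) + 1"] in \<open>simp_all add: add.commute\<close>)
  with eq show ?thesis by simp
qed

text \<open>Undoing the maximal raisings one after the other is the composition of powers of
  \<open>f\<close> that defines \<open>starP\<close>; it starts at zero because the chain of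
  raisings has ended there.\<close>

lemma starP_str:
  assumes a: "1 \<le> a1" "1 \<le> a2" "a1 * a2 > 4" and w: "w \<in> cone a1 a2"
  shows "starP a1 a2 (str a1 a2 w) = w"
proof -
  let ?x = "str a1 a2 w"
  have fin: "finite (supp ?x)" using coneD(1)[OF str_cone[OF a w]] .
  obtain n where n: "bound ?x = int n" using bound_nonneg[OF fin] by (metis zero_le_imp_eq_int)
  define U where "U j = strip a1 a2 w (nat (j - 1))" for j :: int
  have "U j = (fP a1 a2 (idx j) ^^ nat (?x j)) (U (j + 1))" if "1 \<le> j" for j
  proof -
    have "nat (j + 1 - 1) = Suc (nat (j - 1))" using that by simp
    then show ?thesis using strip_unfold(1)[OF a w, of "nat (j - 1)"] that by (simp add: U_def)
  qed
  then have "foldr (\<lambda>k. fP a1 a2 (idx k) ^^ nat (?x k)) [1..int n] (U (int n + 1)) = U 1"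
    using foldr_pow_chain[where g = "\<lambda>k. fP a1 a2 (idx k)" and x = "\<lambda>k. nat (?x k)" and U = U] by blast
  moreover have "?x j = 0" if "int n < j" for j
    using bound_ge[OF fin, of j] that n by force
  then have "U (int n + 1) = (\<lambda>_. 0)" using strip_tail_zero[OF a w, of n] by (simp add: U_def)
  ultimately show ?thesis by (simp add: starP_def n U_def)
qed

text \<open>By the chain of inequalities a nonzero entry at \<open>k \<ge> 2\<close> forces nonzero
  entries at \<open>2, ..., k\<close>. They are at least 1, so the total bounds the position; the 1
  in \<open>ztotal z + 1\<close> allows for a vacant first position.\<close>

lemma cone_supp_bound:
  assumes a: "1 \<le> a1" "1 \<le> a2" "a1 * a2 > 4" and z: "z \<in> cone a1 a2" and k: "z k \<noteq> 0"
  shows "1 \<le> k \<and> k \<le> ztotal z + 1 \<and> 0 \<le> z k \<and> z k \<le> ztotal z"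
proof -
  note zc = coneD[OF z]
  have pos: "z (2 + int m) \<noteq> 0" if "z (2 + int n) \<noteq> 0" "m \<le> n" for m n
    using that(2,1)
  proof (induction rule: inc_induct)
    case (step m)
    then have "0 < real_of_int (z (3 + int m))"
      using zc(3)[of "3 + int m"] by (simp add: algebra_simps less_le)
    also have "\<dots> \<le> rho a1 a2 1 m * real_of_int (z (2 + int m))" using zc(4) .
    finally show ?case by auto
  qed
  have k1: "1 \<le> k" using zc(2)[of k] k by force
  have le: "z k \<le> ztotal z"
    unfolding ztotal_def by (rule member_le_sum) (use k zc(1,3) in \<open>auto simp: supp_def\<close>)
  have "k \<le> ztotal z + 1"
  proof (cases "k = 1")
    case True
    then show ?thesis using ztotal_nonneg[OF z] by simp
  next
    case False
    then have "k = 2 + int (nat (k - 2))" using k1 by simp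
    then obtain n where n: "k = 2 + int n" by blast
    have sub: "{2..k} \<subseteq> supp z"
    proof
      fix j assume j: "j \<in> {2..k}"
      then have "nat (j - 2) \<le> n" "j = 2 + int (nat (j - 2))" using n by auto
      then show "j \<in> supp z" using pos[of n "nat (j - 2)"] k n by (simp add: supp_def)
    qed
    have "k - 1 = (\<Sum>j\<in>{2..k}. 1)" using k1 False by simp
    also have "\<dots> \<le> (\<Sum>j\<in>{2..k}. z j)"
    proof (rule sum_mono)
      fix j assume "j \<in> {2..k}"
      then have "z j \<noteq> 0" using sub by (auto simp: supp_def)
      then show "1 \<le> z j" using zc(3)[of j] by simp
    qed
    also have "\<dots> \<le> ztotal z" unfolding ztotal_def by (rule sum_mono2) (use sub zc in auto)
    finally show ?thesis by simp
  qed
  with k1 le zc(3) show ?thesis by blast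
qed

lemma finite_cone_total:
  assumes "1 \<le> a1" "1 \<le> a2" "a1 * a2 > 4"
  shows "finite {z \<in> cone a1 a2. ztotal z = n}"
proof (rule finite_subset)
  show "{z \<in> cone a1 a2. ztotal z = n} \<subseteq>
      {f. \<forall>x. (x \<in> {1..n + 1} \<longrightarrow> f x \<in> {0..max 0 n}) \<and> (x \<notin> {1..n + 1} \<longrightarrow> f x = 0)}"
  proof clarify
    fix z x assume z: "z \<in> cone a1 a2" and n: "n = ztotal z"
    show "(x \<in> {1..ztotal z + 1} \<longrightarrow> z x \<in> {0..max 0 (ztotal z)}) \<and> (x \<notin> {1..ztotal z + 1} \<longrightarrow> z x = 0)"
      using cone_supp_bound[OF assms z, of x] by (cases "z x = 0") auto
  qed
  show "finite {f :: int \<Rightarrow> int. \<forall>x. (x \<in> {1..n + 1} \<longrightarrow> f x \<in> {0..max 0 n}) \<and> (x \<notin> {1..n + 1} \<longrightarrow> f x = 0)}"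
    using finite_set_of_finite_funs[of "{1..n + 1}" "{0..max 0 n}" 0] by simp
qed

text \<open>Counting replaces Kashiwara's theorem that \<open>\<Psi>\<^sup>+\<close> turns the involution \<open>*\<close> into the string map: \<open>str\<close> is an injective
  endomap of the finite set of cone elements of given total.\<close>

lemma str_surj:
  assumes a: "1 \<le> a1" "1 \<le> a2" "a1 * a2 > 4" and u: "u \<in> cone a1 a2"
  obtains w where "w \<in> cone a1 a2" "str a1 a2 w = u"
proof -
  let ?S = "{z \<in> cone a1 a2. ztotal z = ztotal u}"
  have "str a1 a2 ` ?S \<subseteq> ?S" using str_cone[OF a] ztotal_str[OF a] by auto
  moreover have "inj_on (str a1 a2) ?S"
    by (rule inj_on_inverseI[of _ "starP a1 a2"]) (use starP_str[OF a] in auto)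
  ultimately have "str a1 a2 ` ?S = ?S" using finite_cone_total[OF a] by (intro endo_inj_surj)
  then have "u \<in> str a1 a2 ` ?S" using u by simp
  then show ?thesis using that by blast
qed

text \<open>A point \<open>u\<close> of the cone is the string of some \<open>w\<close>, and
  \<open>starP\<close> returns this \<open>w\<close>; the sequence \<open>U\<close> consists of its
  successive maximal raisings.\<close>

lemma starP_chain:
  assumes a: "1 \<le> a1" "1 \<le> a2" "a1 * a2 > 4" and u: "u \<in> ImP a1 a2"
  obtains U where "U 1 = starP a1 a2 u" "\<And>j. finite (supp (U j))"
    "\<And>j. 1 \<le> j \<Longrightarrow> sigP a1 a2 (idx j) (U j) = u j"
    "\<And>j. 1 \<le> j \<Longrightarrow> U (j + 1) = Emax a1 a2 (idx j) (U j)"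
proof -
  obtain w where w: "w \<in> cone a1 a2" "str a1 a2 w = u" using str_surj[OF a ImP_cone[OF a u]] .
  define U where "U j = strip a1 a2 w (nat (j - 1))" for j :: int
  have "U 1 = starP a1 a2 u" using starP_str[OF a w(1)] w(2) by (simp add: U_def)
  moreover have "finite (supp (U j))" for j unfolding U_def using coneD(1)[OF strip_cone[OF a w(1)]] .
  moreover have "sigP a1 a2 (idx j) (U j) = u j" if "1 \<le> j" for j
    using that unfolding w(2)[symmetric] by (simp add: str_def U_def)
  moreover have "U (j + 1) = Emax a1 a2 (idx j) (U j)" if "1 \<le> j" for j
  proof -
    have "nat (j + 1 - 1) = Suc (nat (j - 1))" using that by simp
    then show ?thesis using that by (simp add: U_def)
  qed
  ultimately show ?thesis using that by blast
qed

subsection \<open>Extremality\<close>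

lemma eM_pow_flip:
  assumes "finite (supp z)" "i \<in> {1, 2}"
  shows "(eM a1 a2 i ^^ n) z = flip ((fP a2 a1 (3 - i) ^^ n) (flip z))"
proof (induction n)
  case (Suc n)
  have "finite (supp (flip ((fP a2 a1 (3 - i) ^^ n) (flip z))))" using assms(1) by simp
  from eM_flip[OF this assms(2), of a1 a2] Suc show ?case by simp
qed simp

lemma ImM_flip:
  assumes "v \<in> ImM a1 a2"
  shows "finite (supp v) \<and> flip v \<in> ImP a2 a1"
  using assms
proof induction
  case zero
  have "flip (\<lambda>_. 0) = (\<lambda>_. 0)" by (simp add: flip_def)
  then show ?case by (simp add: ImP.zero supp_def)
next
  case (step z i)
  then have "eM a1 a2 i z = flip (fP a2 a1 (3 - i) (flip z))" using eM_flip by blast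
  then show ?case using step ImP.step[of "flip z" a2 a1 "3 - i"] swap_in by simp
qed

text \<open>Any bound on the support may serve as length of the fold. This matters because the
  reflection of \<open>k\<close> to \<open>1 - k\<close> shifts the range by one.\<close>

lemma starP_foldr:
  assumes fin: "finite (supp x)" and z: "\<And>j. int n < j \<Longrightarrow> x j = 0"
  shows "starP a1 a2 x = foldr (\<lambda>k. fP a1 a2 (idx k) ^^ nat (x k)) [1..int n] (\<lambda>_. 0)"
proof -
  let ?F = "\<lambda>n. foldr (\<lambda>k. fP a1 a2 (idx k) ^^ nat (x k)) [1..int n] (\<lambda>_. 0)"
  have ext: "?F (n + d) = ?F n" if "\<And>j. int n < j \<Longrightarrow> x j = 0" for n d
  proof (induction d)
    case (Suc d)
    have "[1..int (n + Suc d)] = [1..int (n + d)] @ [int (n + d) + 1]"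
      by (subst upto_rec2) (auto simp: algebra_simps)
    then show ?case using Suc that[of "int (n + d) + 1"] by simp
  qed simp
  obtain b where b: "bound x = int b" using bound_nonneg[OF fin] by (metis zero_le_imp_eq_int)
  have zb: "x j = 0" if "int b < j" for j using bound_ge[OF fin, of j] that b by force
  have "starP a1 a2 x = ?F b" by (simp add: starP_def b)
  also have "\<dots> = ?F (b + n)" using ext[OF zb] by simp
  also have "\<dots> = ?F n" using ext[of n b] z by (simp add: add.commute)
  finally show ?thesis .
qed

lemma starM_flip:
  assumes fin: "finite (supp z)"
  shows "starM a1 a2 z = flip (starP a2 a1 (flip z))"
proof -
  obtain b where b: "bound z = int b" using bound_nonneg[OF fin] by (metis zero_le_imp_eq_int)
  have rev: "rev [- int n..0] = map (\<lambda>k. 1 - k) [1..int n + 1]" for n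
  proof (induction n)
    case (Suc n)
    have "[- int (Suc n)..0] = (- int n - 1) # [- int n..0]" by (subst upto_rec1) auto
    moreover have "[1..int (Suc n) + 1] = [1..int n + 1] @ [int n + 2]"
      by (subst upto_rec2) (auto simp: algebra_simps)
    ultimately show ?case using Suc by simp
  qed simp
  have fold: "finite (supp (foldr (\<lambda>j. fP a2 a1 (idx j) ^^ nat (flip z j)) js (\<lambda>_. 0))) \<and>
      foldr (\<lambda>j. eM a1 a2 (idx (1 - j)) ^^ nat (- z (1 - j))) js (\<lambda>_. 0) =
      flip (foldr (\<lambda>j. fP a2 a1 (idx j) ^^ nat (flip z j)) js (\<lambda>_. 0))" for js
  proof (induction js)
    case Nil
    show ?case by (simp add: flip_def supp_def)
  next
    case (Cons j js)
    let ?c = "foldr (\<lambda>j. fP a2 a1 (idx j) ^^ nat (flip z j)) js (\<lambda>_. 0)"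
    have f: "finite (supp ?c)" "finite (supp (flip ?c))" using Cons by simp_all
    have "(eM a1 a2 (idx (1 - j)) ^^ nat (- z (1 - j))) (flip ?c) =
        flip ((fP a2 a1 (idx j) ^^ nat (flip z j)) ?c)"
      using eM_pow_flip[where i = "idx (1 - j)" and ?a1.0 = a1 and ?a2.0 = a2, OF f(2) idx_in] by (simp add: idx_flip flip_apply)
    then show ?case using Cons f by simp
  qed
  have "starM a1 a2 z = foldr (\<lambda>k. eM a1 a2 (idx k) ^^ nat (- z k)) (map (\<lambda>k. 1 - k) [1..int b + 1]) (\<lambda>_. 0)"
    by (simp add: starM_def b rev)
  also have "\<dots> = foldr (\<lambda>j. eM a1 a2 (idx (1 - j)) ^^ nat (- z (1 - j))) [1..int b + 1] (\<lambda>_. 0)"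
    by (simp add: foldr_map comp_def)
  also have "\<dots> = flip (foldr (\<lambda>j. fP a2 a1 (idx j) ^^ nat (flip z j)) [1..int (Suc b)] (\<lambda>_. 0))"
    using fold[of "[1..int b + 1]"] by (simp add: add.commute)
  also have "foldr (\<lambda>j. fP a2 a1 (idx j) ^^ nat (flip z j)) [1..int (Suc b)] (\<lambda>_. 0) = starP a2 a1 (flip z)"
  proof (rule starP_foldr[symmetric])
    show "finite (supp (flip z))" using fin by simp
    show "flip z j = 0" if "int (Suc b) < j" for j
      using bound_ge[OF fin, of "1 - j"] that b by (force simp: flip_apply)
  qed
  finally show ?thesis .
qed

section \<open>Weights along strings and the reflections \<open>S_i\<close>\<close>

lemma wtP_fP:
  assumes "finite (supp z)" "i \<in> {1, 2}"
  shows "wtP a1 a2 j (fP a1 a2 i z) = wtP a1 a2 j z - cartan a1 a2 j i"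
proof -
  obtain m where m: "1 \<le> m" "idx m = i" "fP a1 a2 i z = z(m := z m + 1)"
    using fP_at[OF assms] by metis
  show ?thesis
    using sum_supp_upd[OF assms(1), where R = "\<lambda>k. 1 \<le> k" and m = m and c = 1 and g = "\<lambda>k. cartan a1 a2 j (idx k)"] m
    by (simp add: wtP_def mult.commute)
qed

lemma wtP_fP_pow:
  assumes "finite (supp z)" "i \<in> {1, 2}"
  shows "wtP a1 a2 j ((fP a1 a2 i ^^ n) z) = wtP a1 a2 j z - int n * cartan a1 a2 j i"
  by (induction n) (use assms in \<open>simp_all add: wtP_fP algebra_simps\<close>)

lemma wtT_move:
  assumes "finite (supp U)" "finite (supp V)" "i \<in> {1, 2}" "j \<in> {1, 2}"
  shows "wtT a1 a2 j (el ((fP a1 a2 i ^^ r) U) V mu) =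
    wtT a1 a2 j (el U ((fP a2 a1 (3 - i) ^^ x) V) mu) - (int r + int x) * cartan a1 a2 j i"
  using wtP_fP_pow[OF assms(1,3), of a1 a2 j r] wtP_fP_pow[OF assms(2) swap_in[OF assms(3)], of a2 a1 "3 - j" x]
    cartan_swap[OF assms(4,3), of a2 a1]
  by (simp add: wtT_el[OF assms(4)] algebra_simps)

lemma iter_opt_add: "iter_opt (m + n) g x = iter_opt m g (iter_opt n g x)"
  by (simp add: iter_opt_def funpow_add)

text \<open>Each application raises \<open>\<epsilon>_i\<close> by 1 and lowers the pairing of the
  weight by 2, so \<open>\<phi>_i\<close> of the left factor drops by 1 and the strict test still
  holds for all \<open>r\<close> steps.\<close>

lemma iter_ftil_left:
  assumes fin: "finite (supp U)" "finite (supp V)" and i: "i \<in> {1, 2}"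
    and r: "int r \<le> sigP a1 a2 i U + wtP a1 a2 i U + pairw i mu - (sigP a2 a1 (3 - i) V + wtP a2 a1 (3 - i) V)"
  shows "iter_opt r (ftil a1 a2 i) (Some (el U V mu)) = Some (el ((fP a1 a2 i ^^ r) U) V mu)"
  using r
proof (induction r)
  case (Suc r)
  have f: "finite (supp ((fP a1 a2 i ^^ r) U))" using fin by simp
  show ?case
    using Suc ftil_el[OF f fin(2) i, of a1 a2 mu] sigP_fP_pow[OF fin(1) i, of a1 a2 r]
      wtP_fP_pow[OF fin(1) i, of a1 a2 i r] by simp
qed simp

lemma iter_ftil_right:
  assumes fin: "finite (supp U)" "finite (supp V)" and i: "i \<in> {1, 2}"
    and z: "sigP a2 a1 (3 - i) V = 0"
    and le: "sigP a1 a2 i U + wtP a1 a2 i U + pairw i mu \<le> wtP a2 a1 (3 - i) V - int x"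
  shows "iter_opt x (ftil a1 a2 i) (Some (el U ((fP a2 a1 (3 - i) ^^ x) V) mu)) = Some (el U V mu)"
proof -
  have "iter_opt r (ftil a1 a2 i) (Some (el U ((fP a2 a1 (3 - i) ^^ x) V) mu)) =
      Some (el U ((fP a2 a1 (3 - i) ^^ (x - r)) V) mu)" if "r \<le> x" for r
    using that
  proof (induction r)
    case (Suc r)
    then obtain k where k: "x - r = Suc k" "x - Suc r = k" by (metis Suc_diff_Suc Suc_le_lessD)
    have f: "finite (supp ((fP a2 a1 (3 - i) ^^ k) V))" using fin by simp
    have f': "finite (supp ((fP a2 a1 (3 - i) ^^ Suc k) V))" using fin by simp
    have "eP a2 a1 (3 - i) ((fP a2 a1 (3 - i) ^^ Suc k) V) = Some ((fP a2 a1 (3 - i) ^^ k) V)"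
      using eP_fP[OF f swap_in[OF i]] by simp
    moreover have "int (Suc k) \<le> int x" using k by simp
    ultimately have "ftil a1 a2 i (el U ((fP a2 a1 (3 - i) ^^ Suc k) V) mu) = Some (el U ((fP a2 a1 (3 - i) ^^ k) V) mu)"
      using ftil_el[OF fin(1) f' i, of a1 a2 mu] le z
        sigP_fP_pow[OF fin(2) swap_in[OF i], of a2 a1 "Suc k"] wtP_fP_pow[OF fin(2) swap_in[OF i], of a2 a1 "3 - i" "Suc k"]
      by (simp del: funpow.simps)
    then show ?case using Suc k by (simp del: funpow.simps)
  qed simp
  from this[of x] show ?thesis by simp
qed

text \<open>Raising the right factor never fails, so a vanishing \<open>e_i\<close> must have been
  directed at the left factor: \<open>e_i\<close> kills \<open>U\<close>, and the tensor rule bounds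
  \<open>x\<close> by \<open>n\<close>. The reflection then spends \<open>n - x\<close> steps on the
  left factor and \<open>x\<close> steps on removing the string entry \<open>x\<close> from the
  right one.\<close>

lemma Sop_left:
  assumes fin: "finite (supp U)" "finite (supp V)" and i: "i \<in> {1, 2}"
    and z: "sigP a2 a1 (3 - i) V = 0"
    and n: "wtT a1 a2 i (el U ((fP a2 a1 (3 - i) ^^ x) V) mu) = n" "0 \<le> n"
    and e: "etil a1 a2 i (el U ((fP a2 a1 (3 - i) ^^ x) V) mu) = None"
  shows "sigP a1 a2 i U = 0" "int x \<le> n"
    "Sop a1 a2 i (el U ((fP a2 a1 (3 - i) ^^ x) V) mu) = Some (el ((fP a1 a2 i ^^ nat (n - int x)) U) V mu)"
proof -
  let ?V = "(fP a2 a1 (3 - i) ^^ x) V"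
  have f: "finite (supp ?V)" using fin by simp
  have sV: "sigP a2 a1 (3 - i) ?V = int x" using sigP_fP_pow[OF fin(2) swap_in[OF i], of a2 a1 x] z by simp
  have wV: "wtP a2 a1 (3 - i) ?V = wtP a2 a1 (3 - i) V - 2 * int x"
    using wtP_fP_pow[OF fin(2) swap_in[OF i], of a2 a1 "3 - i" x] by simp
  have c: "sigP a2 a1 (3 - i) ?V + wtP a2 a1 (3 - i) ?V \<le> sigP a1 a2 i U + wtP a1 a2 i U + pairw i mu"
    and "eP a1 a2 i U = None"
    using e unfolding etil_el[OF fin(1) f i] by (auto split: if_splits)
  then show sU: "sigP a1 a2 i U = 0" using sigP_nonneg[OF fin(1) i, of a1 a2] by (simp add: eP_None_iff)
  have nn: "wtP a1 a2 i U + pairw i mu - wtP a2 a1 (3 - i) ?V = n" using n(1) by (simp add: wtT_el[OF i])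
  show xn: "int x \<le> n" using c sV sU nn by simp
  define r where "r = nat (n - int x)"
  have r: "int r = n - int x" using xn by (simp add: r_def)
  have "iter_opt r (ftil a1 a2 i) (Some (el U ?V mu)) = Some (el ((fP a1 a2 i ^^ r) U) ?V mu)"
    by (rule iter_ftil_left[OF fin(1) f i]) (use r sV sU nn in simp)
  moreover have "iter_opt x (ftil a1 a2 i) (Some (el ((fP a1 a2 i ^^ r) U) ?V mu)) = Some (el ((fP a1 a2 i ^^ r) U) V mu)"
    by (rule iter_ftil_right[OF _ fin(2) i z])
      (use fin sigP_fP_pow[OF fin(1) i, of a1 a2 r] wtP_fP_pow[OF fin(1) i, of a1 a2 i r] sU nn wV r in simp_all)
  moreover have "nat n = x + r" using r by simp
  ultimately show "Sop a1 a2 i (el U ?V mu) = Some (el ((fP a1 a2 i ^^ nat (n - int x)) U) V mu)"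
    using n by (simp add: Sop_def iter_opt_add r_def)
qed

text \<open>The word \<open>... S_{i_{-1}} S_{i_0}\<close> is applied letter by letter. Each
  reflection removes one string entry from the right factor and adds the complementary power of
  \<open>f\<close> to the left one, so the numbers \<open>p_k - x_{1-k}\<close> extend the string of
  the left factor to the indices \<open>k \<le> 0\<close>.\<close>

lemma extremal_left_chain:
  fixes p x :: "int \<Rightarrow> int"
  assumes ext: "extremal a1 a2 (el U0 (V 1) mu)" and fU: "finite (supp U0)" and fV: "\<And>j. finite (supp (V j))"
    and x: "\<And>j. 1 \<le> j \<Longrightarrow> sigP a2 a1 (idx j) (V j) = x j"
    and V: "\<And>j. 1 \<le> j \<Longrightarrow> V (j + 1) = Emax a2 a1 (idx j) (V j)"
    and p0: "\<And>k. 0 \<le> p k" and prec: "\<And>k. p (k + 1) + p (k - 1) = acoef a1 a2 k * p k"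
    and wt: "wtT a1 a2 2 (el U0 (V 1) mu) = p 0" "wtT a1 a2 1 (el U0 (V 1) mu) = - p 1"
  obtains U where "U 1 = U0" "\<And>k. finite (supp (U k))"
    "\<And>k. k \<le> 0 \<Longrightarrow> sigP a1 a2 (idx k) (U (k + 1)) = 0"
    "\<And>k. k \<le> 0 \<Longrightarrow> x (1 - k) \<le> p k"
    "\<And>k. k \<le> 0 \<Longrightarrow> U k = (fP a1 a2 (idx k) ^^ nat (p k - x (1 - k))) (U (k + 1))"
proof -
  define W where "W = rec_nat U0 (\<lambda>n. fP a1 a2 (idx (- int n)) ^^ nat (p (- int n) - x (1 + int n)))"
  have W0: "W 0 = U0" and WS: "W (Suc n) = (fP a1 a2 (idx (- int n)) ^^ nat (p (- int n) - x (1 + int n))) (W n)" for n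
    by (simp_all add: W_def)
  have fW: "finite (supp (W n))" for n by (induction n) (simp_all add: W0 WS fU)
  \<comment> \<open>The invariant records the word \<open>js\<close> applied so far and both weight
    pairings: \<open>p_{-n}\<close> for the colour of the next reflection and
    \<open>-p_{1-n}\<close> for the other.\<close>
  have main: "\<exists>js. set js \<subseteq> {1, 2} \<and> Sw a1 a2 js (el U0 (V 1) mu) = Some (el (W n) (V (1 + int n)) mu) \<and>
      wtT a1 a2 (idx (- int n)) (el (W n) (V (1 + int n)) mu) = p (- int n) \<and>
      wtT a1 a2 (idx (1 - int n)) (el (W n) (V (1 + int n)) mu) = - p (1 - int n)" (is "\<exists>js. ?Q n js")
    and step: "sigP a1 a2 (idx (- int n)) (W n) = 0 \<and> x (1 + int n) \<le> p (- int n) \<and>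
      Sop a1 a2 (idx (- int n)) (el (W n) (V (1 + int n)) mu) = Some (el (W (Suc n)) (V (2 + int n)) mu)" for n
  proof -
    have VV: "V (1 + int n) = (fP a2 a1 (3 - idx (- int n)) ^^ nat (x (1 + int n))) (V (2 + int n))"
      "sigP a2 a1 (3 - idx (- int n)) (V (2 + int n)) = 0" "0 \<le> x (1 + int n)" for n
    proof -
      have i: "3 - idx (- int n) = idx (1 + int n)" by (simp add: idx_def)
      have "V (2 + int n) = Emax a2 a1 (idx (1 + int n)) (V (1 + int n))"
        using V[of "1 + int n"] by (simp add: algebra_simps)
      with Emax_props[OF fV idx_in, of a2 a1 "1 + int n" "1 + int n"] x[of "1 + int n"]
        sigP_nonneg[OF fV idx_in, of a2 a1 "1 + int n" "1 + int n"]
      show "V (1 + int n) = (fP a2 a1 (3 - idx (- int n)) ^^ nat (x (1 + int n))) (V (2 + int n))"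
        "sigP a2 a1 (3 - idx (- int n)) (V (2 + int n)) = 0" "0 \<le> x (1 + int n)"
        unfolding i by simp_all
    qed
    have st: "sigP a1 a2 (idx (- int n)) (W n) = 0 \<and> x (1 + int n) \<le> p (- int n) \<and>
      Sop a1 a2 (idx (- int n)) (el (W n) (V (1 + int n)) mu) = Some (el (W (Suc n)) (V (2 + int n)) mu)"
      if Q: "?Q n js" for n js
    proof -
      let ?i = "idx (- int n)" and ?x = "nat (x (1 + int n))"
      have eN: "etil a1 a2 ?i (el (W n) (V (1 + int n)) mu) = None"
        using ext Q p0[of "- int n"] idx_in[of "- int n"] unfolding extremal_def by metis
      note S = Sop_left[OF fW[of n] fV[of "2 + int n"] idx_in[of "- int n"] VV(2)[of n], where x = ?x and mu = mu and n = "p (- int n)"]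
      show ?thesis
        using S Q eN p0[of "- int n"] VV(3)[of n] unfolding VV(1)[of n, symmetric] by (simp add: WS)
    qed
    have "\<exists>js. ?Q n js" for n
    proof (induction n)
      case 0
      have "?Q 0 []" using wt by (simp add: Sw_def W0 idx_def)
      then show ?case by blast
    next
      case (Suc n)
      then obtain js where Q: "?Q n js" by blast
      let ?k = "- int n"
      have S: "x (1 + int n) \<le> p ?k" "Sop a1 a2 (idx ?k) (el (W n) (V (1 + int n)) mu) = Some (el (W (Suc n)) (V (2 + int n)) mu)"
        using st[OF Q] by auto
      have s: "int (nat (p ?k - x (1 + int n))) + int (nat (x (1 + int n))) = p ?k"
        using S(1) VV(3)[of n] by simp
      have w: "wtT a1 a2 j (el (W (Suc n)) (V (2 + int n)) mu) =
          wtT a1 a2 j (el (W n) (V (1 + int n)) mu) - p ?k * cartan a1 a2 j (idx ?k)" if "j \<in> {1, 2}" for j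
        using wtT_move[OF fW[of n] fV[of "2 + int n"] idx_in[of ?k] that, of a1 a2 "nat (p ?k - x (1 + int n))" mu "nat (x (1 + int n))"]
        unfolding VV(1)[of n, symmetric] WS[symmetric] s .
      have i1: "idx (- int (Suc n)) = idx (?k + 1)" "idx (1 - int n) = idx (?k + 1)" "idx (1 - int (Suc n)) = idx ?k"
        by (simp_all add: idx_def)
      have "wtT a1 a2 (idx (?k + 1)) (el (W (Suc n)) (V (2 + int n)) mu) = - p (1 - int n) + acoef a1 a2 ?k * p ?k"
        using w[OF idx_in, of "?k + 1"] Q cartan_idx_adj(2)[of a1 a2 ?k] unfolding i1 by simp
      also have "\<dots> = p (- int (Suc n))"
      proof -
        have "?k + 1 = 1 - int n" "?k - 1 = - int (Suc n)" by simp_all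
        with prec[of ?k] show ?thesis by simp
      qed
      finally have w1: "wtT a1 a2 (idx (?k + 1)) (el (W (Suc n)) (V (2 + int n)) mu) = p (- int (Suc n))" .
      have w2: "wtT a1 a2 (idx ?k) (el (W (Suc n)) (V (2 + int n)) mu) = - p ?k"
        using w[OF idx_in, of ?k] Q by simp
      have e: "1 + int (Suc n) = 2 + int n" "1 - int (Suc n) = ?k" by simp_all
      have "?Q (Suc n) (idx ?k # js)"
        unfolding i1 e(1) using w1 w2 Q S(2) idx_in[of ?k] by (simp add: Sw_Cons)
      then show ?case by blast
    qed
    then show "\<exists>js. ?Q n js"
      "sigP a1 a2 (idx (- int n)) (W n) = 0 \<and> x (1 + int n) \<le> p (- int n) \<and>
      Sop a1 a2 (idx (- int n)) (el (W n) (V (1 + int n)) mu) = Some (el (W (Suc n)) (V (2 + int n)) mu)"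
      using st by blast+
  qed
  define U where "U k = W (nat (1 - k))" for k
  show ?thesis
  proof (rule that[of U])
    show "U 1 = U0" by (simp add: U_def W0)
    show "finite (supp (U k))" for k by (simp add: U_def fW)
    fix k :: int assume k: "k \<le> 0"
    define n where "n = nat (- k)"
    have n: "k = - int n" using k by (simp add: n_def)
    have e: "nat (1 - (k + 1)) = n" "nat (1 - k) = Suc n" "1 - k = 1 + int n" unfolding n by auto
    have e4: "nat (1 + int n) = Suc n" by simp
    show "sigP a1 a2 (idx k) (U (k + 1)) = 0" "x (1 - k) \<le> p k"
      "U k = (fP a1 a2 (idx k) ^^ nat (p k - x (1 - k))) (U (k + 1))"
      using step[of n] WS[of n] unfolding U_def e n[symmetric] by (simp_all add: e4)
  qed
qed

text \<open>The maximal raisings of the left factor for \<open>k \<ge> 1\<close> and the reflected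
  elements for \<open>k \<le> 0\<close> form one two-sided chain
  \<open>W (k + 1) = Emax (W k)\<close> with \<open>\<epsilon>\<close> values \<open>X_k\<close>.
  The string estimate can therefore be started arbitrarily far to the left.\<close>

lemma extremal_gam:
  fixes p x u :: "int \<Rightarrow> int"
  assumes a: "1 \<le> a1" "1 \<le> a2" "a1 * a2 > 4"
    and u: "u \<in> ImP a1 a2" and x: "x \<in> ImP a2 a1"
    and ext: "extremal a1 a2 (el (starP a1 a2 u) (starP a2 a1 x) mu)"
    and p0: "\<And>k. 0 \<le> p k" and prec: "\<And>k. p (k + 1) + p (k - 1) = acoef a1 a2 k * p k"
    and wt: "wtT a1 a2 2 (el (starP a1 a2 u) (starP a2 a1 x) mu) = p 0"
      "wtT a1 a2 1 (el (starP a1 a2 u) (starP a2 a1 x) mu) = - p 1"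
    and X: "X = (\<lambda>k. if 1 \<le> k then u k else p k - x (1 - k))"
  shows "0 \<le> X k" "real_of_int (X (k + 1)) \<le> gam a1 a2 k * real_of_int (X k)"
proof -
  obtain U1 where U1: "U1 1 = starP a1 a2 u" "\<And>j. finite (supp (U1 j))"
    "\<And>j. 1 \<le> j \<Longrightarrow> sigP a1 a2 (idx j) (U1 j) = u j"
    "\<And>j. 1 \<le> j \<Longrightarrow> U1 (j + 1) = Emax a1 a2 (idx j) (U1 j)"
    using starP_chain[OF a u] by metis
  have a': "a2 * a1 > 4" using a(3) by (simp add: mult.commute)
  obtain V where V: "V 1 = starP a2 a1 x" "\<And>j. finite (supp (V j))"
    "\<And>j. 1 \<le> j \<Longrightarrow> sigP a2 a1 (idx j) (V j) = x j"
    "\<And>j. 1 \<le> j \<Longrightarrow> V (j + 1) = Emax a2 a1 (idx j) (V j)"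
    using starP_chain[OF a(2,1) a' x] by metis
  have ext': "extremal a1 a2 (el (U1 1) (V 1) mu)" using ext U1(1) V(1) by simp
  obtain U where U: "U 1 = U1 1" "\<And>k. finite (supp (U k))"
    "\<And>k. k \<le> 0 \<Longrightarrow> sigP a1 a2 (idx k) (U (k + 1)) = 0"
    "\<And>k. k \<le> 0 \<Longrightarrow> x (1 - k) \<le> p k"
    "\<And>k. k \<le> 0 \<Longrightarrow> U k = (fP a1 a2 (idx k) ^^ nat (p k - x (1 - k))) (U (k + 1))"
    using extremal_left_chain[where V = V and x = x and p = p, OF ext' U1(2) V(2) V(3) V(4) p0 prec] wt U1(1) V(1)
    by metis
  define W where "W k = (if 1 \<le> k then U1 k else U k)" for k
  have Wk: "W k = U k" if "k \<le> 1" for k using that U(1) by (cases "k = 1") (auto simp: W_def)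
  have fW: "finite (supp (W k))" for k using U(2) U1(2) by (simp add: W_def)
  have XW: "X k = sigP a1 a2 (idx k) (W k)" and WE: "W (k + 1) = Emax a1 a2 (idx k) (W k)" for k
  proof -
    have "X k = sigP a1 a2 (idx k) (W k) \<and> W (k + 1) = Emax a1 a2 (idx k) (W k)"
    proof (cases "1 \<le> k")
      case True
      then show ?thesis using U1(3,4)[of k] by (simp add: X W_def)
    next
      case False
      then have k: "k \<le> 0" by simp
      have s: "sigP a1 a2 (idx k) (U k) = p k - x (1 - k)"
        by (subst U(5)[OF k], subst sigP_fP_pow[OF U(2) idx_in]) (use U(3,4)[OF k] in simp)
      have "Emax a1 a2 (idx k) (U k) = U (k + 1)"
        by (subst U(5)[OF k], subst Emax_fP_pow[OF U(2) idx_in]) (rule Emax_zero[OF U(2) idx_in U(3)[OF k]])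
      then show ?thesis using s k Wk[of k] Wk[of "k + 1"] by (simp add: X)
    qed
    then show "X k = sigP a1 a2 (idx k) (W k)" "W (k + 1) = Emax a1 a2 (idx k) (W k)" by auto
  qed
  show X0: "0 \<le> X k" for k using sigP_nonneg[OF fW idx_in] XW by simp
  let ?q = "alphaC a1 a2 * betaC a1 a2"
  have le: "real_of_int (X (k + 1)) \<le> gam a1 a2 k * (1 + (1 / ?q) ^ n) * real_of_int (X k)" for n
  proof -
    \<comment> \<open>The index \<open>k\<close> stays fixed while the start of the string recedes
      with \<open>n\<close>; the truncations then converge to \<open>\<gamma>_k\<close>.\<close>
    define s where "s = k - 1 - int n"
    have "real_of_int (X (k + 1)) \<le> rho a1 a2 s n * real_of_int (X k)"
      using tmax_chain_le[where U = W and s = s and t = 1 and n = n, OF a fW WE] unfolding XW sigP_tmax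
      by (simp add: s_def add.commute)
    also have "\<dots> \<le> gam a1 a2 k * (1 + (1 / ?q) ^ n) * real_of_int (X k)"
      using rho_bounds[OF a, of s n] X0[of k] by (intro mult_right_mono) (simp_all add: s_def)
    finally show ?thesis .
  qed
  have q: "0 \<le> 1 / ?q" "1 / ?q < 1" using alpha_beta_gt1[OF a] by auto
  have "(\<lambda>n. gam a1 a2 k * (1 + (1 / ?q) ^ n) * real_of_int (X k)) \<longlonglongrightarrow>
      gam a1 a2 k * (1 + 0) * real_of_int (X k)"
    by (intro tendsto_intros LIMSEQ_realpow_zero q)
  then show "real_of_int (X (k + 1)) \<le> gam a1 a2 k * real_of_int (X k)"
    using LIMSEQ_le_const le by force
qed

section \<open>Positivity and recursion of the sequence \<open>p\<close>\<close>

lemma rec_pos: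
  fixes r c :: "nat \<Rightarrow> int" and h :: "nat \<Rightarrow> real"
  assumes "\<And>n. r (Suc (Suc n)) = c n * r (Suc n) - r n" "\<And>n. 0 < h n" "\<And>n. h (Suc n) + 1 / h n \<le> c n"
    and "0 < r 0" "h 0 * r 0 \<le> r (Suc 0)"
  shows "0 < r n"
proof -
  \<comment> \<open>The lower bound \<open>h n\<close> for the ratio of consecutive terms
    propagates: the next ratio is \<open>c n\<close> minus the inverse of this one, hence at least
    \<open>c n - 1 / h n \<ge> h (Suc n)\<close>.\<close>
  have "0 < r n \<and> h n * r n \<le> r (Suc n)"
  proof (induction n)
    case (Suc n)
    have "0 < h n * r n" using Suc assms(2) by simp
    then have pos: "0 < real_of_int (r (Suc n))" using Suc by linarith
    have "real_of_int (r n) \<le> r (Suc n) / h n" using Suc assms(2)[of n] by (simp add: field_simps)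
    moreover have "(h (Suc n) + 1 / h n) * r (Suc n) \<le> c n * real_of_int (r (Suc n))"
      using assms(3)[of n] pos by (intro mult_right_mono) auto
    ultimately show ?case using pos by (simp add: assms(1) algebra_simps)
  qed (use assms in simp)
  then show ?thesis by simp
qed

lemma pplus_pminus_pos:
  assumes "1 \<le> a1" "1 \<le> a2" "a1 * a2 > 4" "lam_cond a1 a2 k1 k2"
  shows "0 < pplus a1 a2 k1 k2 n" "0 < pminus a1 a2 k1 k2 n"
proof -
  have k: "0 < k1" "0 < k2" using assms(4) by (auto simp: lam_cond_def)
  let ?P = "pplus a1 a2 k1 k2" and ?M = "pminus a1 a2 k1 k2"
  \<comment> \<open>If one coefficient is 1, the other is at least 5. The alternating ratio bounds 2
    and 1/2 then work because \<open>1/2 + 1/2 = 1\<close> and \<open>2 + 2 \<le> 5\<close>; if both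
    coefficients are at least 2, the constant bound 1 works.\<close>
  let ?h = "\<lambda>n. if even n then 2 else 1 / 2 :: real"
  have shift: "(\<forall>n. 0 < f n)" if "0 < f 0" "\<And>n. 0 < f (Suc n)" for f :: "nat \<Rightarrow> int"
    using that by (metis not0_implies_Suc)
  consider "2 \<le> a1" "2 \<le> a2" | "a1 = 1" | "a2 = 1" using assms by linarith
  then have "(\<forall>n. 0 < ?P n) \<and> (\<forall>n. 0 < ?M n)"
  proof cases
    case 1
    then consider "k2 \<le> k1" "k1 < (a1 - 1) * k2" | "k1 < k2" "k2 \<le> (a2 - 1) * k1"
      using assms(4) by (auto simp: lam_cond_def)
    then show ?thesis
    proof cases
      case a: 1
      have "0 < ?P n" for n
        by (rule rec_pos[of _ "\<lambda>n. if even n then a2 else a1" "\<lambda>_. 1"]) (use 1 a k in auto)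
      \<comment> \<open>Here the ratio bound is available from the second term on:
        \<open>k1 < (a1 - 1) k2\<close> says that \<open>p_{-1} > p_0\<close>.\<close>
      moreover have "0 < ?M (Suc n)" for n
        by (rule rec_pos[of "\<lambda>n. ?M (Suc n)" "\<lambda>n. if even n then a2 else a1" "\<lambda>_. 1"])
          (use 1 a k in \<open>auto simp: algebra_simps simp flip: of_int_mult of_int_diff\<close>)
      ultimately show ?thesis using shift[of ?M] k by auto
    next
      case a: 2
      have "0 < ?M n" for n
        by (rule rec_pos[of _ "\<lambda>n. if odd n then a2 else a1" "\<lambda>_. 1"]) (use 1 a k in auto)
      moreover have "0 < ?P (Suc n)" for n
        by (rule rec_pos[of "\<lambda>n. ?P (Suc n)" "\<lambda>n. if odd n then a2 else a1" "\<lambda>_. 1"])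
          (use 1 a k in \<open>auto simp: algebra_simps simp flip: of_int_mult of_int_diff\<close>)
      ultimately show ?thesis using shift[of ?P] k by auto
    qed
  next
    case 2
    then have c: "2 * k1 \<le> k2" "k2 \<le> (a2 - 2) * k1" "5 \<le> a2" using assms by (auto simp: lam_cond_def)
    have "0 < ?M n" for n
      by (rule rec_pos[of _ "\<lambda>n. if odd n then a2 else a1" ?h]) (use 2 c k in auto)
    moreover have "0 < ?P (Suc n)" for n
      by (rule rec_pos[of "\<lambda>n. ?P (Suc n)" "\<lambda>n. if odd n then a2 else a1" ?h])
        (use 2 c k in \<open>auto simp: algebra_simps simp flip: of_int_mult of_int_diff\<close>)
    ultimately show ?thesis using shift[of ?P] k by auto
  next
    case 3
    then have c: "2 * k2 \<le> k1" "k1 \<le> (a1 - 2) * k2" "5 \<le> a1" using assms by (auto simp: lam_cond_def)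
    have "0 < ?P n" for n
      by (rule rec_pos[of _ "\<lambda>n. if even n then a2 else a1" ?h]) (use 3 c k in auto)
    moreover have "0 < ?M (Suc n)" for n
      by (rule rec_pos[of "\<lambda>n. ?M (Suc n)" "\<lambda>n. if even n then a2 else a1" ?h])
        (use 3 c k in \<open>auto simp: algebra_simps simp flip: of_int_mult of_int_diff\<close>)
    ultimately show ?thesis using shift[of ?M] k by auto
  qed
  then show "0 < ?P n" "0 < ?M n" by auto
qed

lemma pseq_pos:
  assumes "1 \<le> a1" "1 \<le> a2" "a1 * a2 > 4" "lam_cond a1 a2 k1 k2"
  shows "0 < pseq a1 a2 k1 k2 m"
  using pplus_pminus_pos[OF assms] by (simp add: pseq_def)

lemma pseq_pminus: "m \<le> 1 \<Longrightarrow> pseq a1 a2 k1 k2 m = pminus a1 a2 k1 k2 (nat (1 - m))"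
  by (cases "m = 1"; cases "m = 0") (auto simp: pseq_def)

lemma pseq_rec: "pseq a1 a2 k1 k2 (k + 1) + pseq a1 a2 k1 k2 (k - 1) = acoef a1 a2 k * pseq a1 a2 k1 k2 k"
proof (cases "1 \<le> k")
  case True
  define n where "n = nat (k - 1)"
  have n: "k = int n + 1" using True by (simp add: n_def)
  have "nat (k + 1) = Suc (Suc n)" "nat k = Suc n" "nat (k - 1) = n" using n by auto
  then show ?thesis using True by (simp add: pseq_def acoef_def n)
next
  case False
  define n where "n = nat (- k)"
  have n: "k = - int n" using False by (simp add: n_def)
  have "nat (1 - (k + 1)) = n" "nat (1 - k) = Suc n" "nat (1 - (k - 1)) = Suc (Suc n)" using n by auto
  then show ?thesis using False pseq_pminus[of "k + 1"] pseq_pminus[of k] pseq_pminus[of "k - 1"]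
    by (simp add: acoef_def n)
qed

subsection \<open>The polyhedral region\<close>

lemma wtP_starP:
  assumes fin: "finite (supp x)" and nn: "\<And>k. 0 \<le> x k"
  shows "wtP a1 a2 j (starP a1 a2 x) = wtP a1 a2 j x"
proof -
  obtain b where b: "bound x = int b" using bound_nonneg[OF fin] by (metis zero_le_imp_eq_int)
  have zb: "x k = 0" if "int b < k" for k using bound_ge[OF fin, of k] that b by force
  have fold: "finite (supp (foldr (\<lambda>k. fP a1 a2 (idx k) ^^ nat (x k)) js (\<lambda>_. 0))) \<and>
      wtP a1 a2 j (foldr (\<lambda>k. fP a1 a2 (idx k) ^^ nat (x k)) js (\<lambda>_. 0)) =
      - (\<Sum>k\<leftarrow>js. x k * cartan a1 a2 j (idx k))" for js
  proof (induction js)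
    case Nil
    show ?case by (simp add: supp_def wtP_def)
  next
    case (Cons k js)
    let ?c = "foldr (\<lambda>k. fP a1 a2 (idx k) ^^ nat (x k)) js (\<lambda>_. 0)"
    have "finite (supp ?c)" using Cons by simp
    then show ?case using Cons wtP_fP_pow[where z = ?c and i = "idx k" and j = j and ?a1.0 = a1 and ?a2.0 = a2, OF _ idx_in] nn[of k] by simp
  qed
  have "wtP a1 a2 j (starP a1 a2 x) = - (\<Sum>k\<leftarrow>[1..int b]. x k * cartan a1 a2 j (idx k))"
    using fold[of "[1..int b]"] by (simp add: starP_def b)
  also have "(\<Sum>k\<leftarrow>[1..int b]. x k * cartan a1 a2 j (idx k)) = (\<Sum>k\<in>{1..int b}. x k * cartan a1 a2 j (idx k))"
    by (simp add: interv_sum_list_conv_sum_set_int)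
  also have "\<dots> = (\<Sum>k\<in>{k. 1 \<le> k \<and> x k \<noteq> 0}. x k * cartan a1 a2 j (idx k))"
  proof (rule sum.mono_neutral_right)
    show "{k. 1 \<le> k \<and> x k \<noteq> 0} \<subseteq> {1..int b}"
    proof
      fix k assume "k \<in> {k. 1 \<le> k \<and> x k \<noteq> 0}"
      then show "k \<in> {1..int b}" using zb[of k] by (cases "int b < k") auto
    qed
  qed auto
  finally show ?thesis by (simp add: wtP_def)
qed

text \<open>The \<open>X\<^sub>k\<close> of the introduction, and the region cut out by the inequalities for \<open>X\<close> and \<open>Q\<close>.\<close>

definition Xval :: "int \<Rightarrow> int \<Rightarrow> int \<Rightarrow> int \<Rightarrow> (int \<Rightarrow> int) \<Rightarrow> int \<Rightarrow> int" where
  "Xval a1 a2 k1 k2 z k = z k + (if k \<le> 0 then pseq a1 a2 k1 k2 k else 0)"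

definition region :: "int \<Rightarrow> int \<Rightarrow> int \<Rightarrow> int \<Rightarrow> (int \<Rightarrow> int) set" where
  "region a1 a2 k1 k2 = {z. finite (supp z) \<and>
     (\<forall>k. let X = Xval a1 a2 k1 k2 z; Q = (\<lambda>k. pseq a1 a2 k1 k2 k - X k) in
        0 \<le> X k \<and> 0 \<le> Q k \<and>
        real_of_int (X (k + 1)) \<le> gam a1 a2 k * real_of_int (X k) \<and>
        real_of_int (Q k) \<le> gam a1 a2 (k + 1) * real_of_int (Q (k + 1)))}"

lemma region_Sigma_set:
  assumes "z \<in> region a1 a2 k1 k2"
  shows "(z, (k1, - k2)) \<in> Sigma_set a1 a2 k1 k2"
proof -
  let ?p = "pseq a1 a2 k1 k2" and ?g = "gam a1 a2"
  have fin: "finite (supp z)" using assms by (simp add: region_def)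
  have X: "0 \<le> Xval a1 a2 k1 k2 z k" "Xval a1 a2 k1 k2 z k \<le> ?p k"
    "real_of_int (Xval a1 a2 k1 k2 z (k + 1)) \<le> ?g k * real_of_int (Xval a1 a2 k1 k2 z k)"
    "real_of_int (?p k - Xval a1 a2 k1 k2 z k) \<le> ?g (k + 1) * real_of_int (?p (k + 1) - Xval a1 a2 k1 k2 z (k + 1))" for k
    using assms by (auto simp: region_def Let_def)
  have pos: "0 \<le> z k" "z k \<le> ?p k" "real_of_int (z (k + 1)) \<le> ?g k * z k"
    "real_of_int (?p k - z k) \<le> ?g (k + 1) * real_of_int (?p (k + 1) - z (k + 1))" if "1 \<le> k" for k
    using X[of k] that by (auto simp: Xval_def)
  have neg: "z k \<le> 0" "0 \<le> real_of_int (?p k) + real_of_int (z k)" "- real_of_int (z (k - 1)) \<le> - ?g k * z k"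
    "real_of_int (z k + ?p k) \<le> ?g (k - 1) * real_of_int (z (k - 1) + ?p (k - 1))" if "k \<le> 0" for k
    using X[of k] X(3,4)[of "k - 1"] that by (auto simp: Xval_def simp flip: of_int_add)
  \<comment> \<open>The two inequalities that link the tensor factors are the case
    \<open>k = 0\<close>.\<close>
  have mid: "real_of_int (z 1) \<le> ?g 0 * (z 0 + ?p 0)" "- real_of_int (z 0) \<le> ?g 1 * (?p 1 - z 1)"
    using X(3,4)[of 0] by (auto simp: Xval_def)
  have "inZ z" using fin pos(1) neg(1) by (simp add: inZ_def)
  then show ?thesis
    unfolding Sigma_set_def using mid pos neg by (auto simp: Let_def algebra_simps)
qed

text \<open>Since \<open>p\<close> satisfies the recursion with equality, the condition also reads
  \<open>Q_m - 1 \<ge> a Q_{m-1} - Q_{m-2}\<close>. With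
  \<open>a = \<gamma>_{m-1} + 1/\<gamma>_{m-2}\<close> the old bound on \<open>X_{m-2}\<close>
  yields the new one for \<open>X_m + 1\<close>, and the old bound on \<open>Q_{m-2}\<close> yields
  \<open>Q_m - 1 \<ge> Q_{m-1}/\<gamma>_m\<close>, hence also
  \<open>X_m + 1 \<le> p_m\<close>.\<close>

lemma region_step:
  assumes a: "1 \<le> a1" "1 \<le> a2" "a1 * a2 > 4" and z: "z \<in> region a1 a2 k1 k2"
    and key: "Xval a1 a2 k1 k2 z m + 1 \<le>
      acoef a1 a2 (m - 1) * Xval a1 a2 k1 k2 z (m - 1) - Xval a1 a2 k1 k2 z (m - 2)"
  shows "z(m := z m + 1) \<in> region a1 a2 k1 k2"
proof -
  define X where "X = Xval a1 a2 k1 k2 z"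
  define p where "p = pseq a1 a2 k1 k2"
  let ?g = "gam a1 a2" and ?c = "real_of_int (acoef a1 a2 (m - 1))"
  have fin: "finite (supp z)" using z by (simp add: region_def)
  have X: "0 \<le> X k" "X k \<le> p k" "real_of_int (X (k + 1)) \<le> ?g k * real_of_int (X k)"
    "real_of_int (p k - X k) \<le> ?g (k + 1) * real_of_int (p (k + 1) - X (k + 1))" for k
    using z by (auto simp: region_def Let_def X_def p_def)
  have X': "Xval a1 a2 k1 k2 (z(m := z m + 1)) = X(m := X m + 1)"
    by (auto simp: X_def Xval_def)
  have g: "0 < ?g k" for k using gam_pos[OF a] .
  have rec: "?g (m - 1) + 1 / ?g (m - 2) = ?c" using gam_rec[OF a, of "m - 2"] by simp
  have gm: "?g (m - 2) = ?g m" by (simp add: gam_def)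
  have k1: "real_of_int (X m + 1) \<le> ?c * X (m - 1) - X (m - 2)"
    using key unfolding X_def[symmetric] by (simp flip: of_int_mult of_int_diff)
  have "real_of_int (X (m - 1)) / ?g (m - 2) \<le> X (m - 2)"
    using X(3)[of "m - 2"] g[of "m - 2"] by (simp add: field_simps)
  moreover have "?c * X (m - 1) = ?g (m - 1) * X (m - 1) + X (m - 1) / ?g (m - 2)"
    unfolding rec[symmetric] by (simp add: algebra_simps)
  ultimately have c1: "real_of_int (X m + 1) \<le> ?g (m - 1) * X (m - 1)" using k1 by linarith
  have prec: "p m = acoef a1 a2 (m - 1) * p (m - 1) - p (m - 2)"
    using pseq_rec[of a1 a2 k1 k2 "m - 1"] by (simp add: p_def)
  then have "acoef a1 a2 (m - 1) * (p (m - 1) - X (m - 1)) - (p (m - 2) - X (m - 2)) \<le> p m - X m - 1"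
    using key unfolding X_def[symmetric] by (simp add: algebra_simps)
  then have k2: "?c * real_of_int (p (m - 1) - X (m - 1)) - real_of_int (p (m - 2) - X (m - 2)) \<le> real_of_int (p m - X m - 1)"
    by (simp flip: of_int_mult of_int_diff)
  have "real_of_int (p (m - 2) - X (m - 2)) \<le> ?g (m - 1) * real_of_int (p (m - 1) - X (m - 1))"
    using X(4)[of "m - 2"] by simp
  moreover have "?c * real_of_int (p (m - 1) - X (m - 1)) = ?g (m - 1) * real_of_int (p (m - 1) - X (m - 1)) +
      real_of_int (p (m - 1) - X (m - 1)) / ?g m"
    unfolding rec[symmetric] gm by (simp only: distrib_right) simp
  ultimately have q: "real_of_int (p (m - 1) - X (m - 1)) / ?g m \<le> real_of_int (p m - X m - 1)"
    using k2 by linarith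
  then have c2: "real_of_int (p (m - 1) - X (m - 1)) \<le> ?g m * real_of_int (p m - X m - 1)"
    using g[of m] by (simp add: field_simps)
  have "0 \<le> real_of_int (p (m - 1) - X (m - 1)) / ?g m" using X(2)[of "m - 1"] g[of m] by simp
  then have "0 \<le> real_of_int (p m - X m - 1)" using q by linarith
  then have c3: "X m + 1 \<le> p m" by linarith
  have d: "?g m * X m \<le> ?g m * (X m + 1)" using g[of m] by simp
  have "0 \<le> (X(m := X m + 1)) k \<and> 0 \<le> p k - (X(m := X m + 1)) k \<and>
      real_of_int ((X(m := X m + 1)) (k + 1)) \<le> ?g k * real_of_int ((X(m := X m + 1)) k) \<and>
      real_of_int (p k - (X(m := X m + 1)) k) \<le> ?g (k + 1) * real_of_int (p (k + 1) - (X(m := X m + 1)) (k + 1))" for k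
  proof -
    consider "k = m" | "k = m - 1" | "k \<noteq> m" "k + 1 \<noteq> m" by linarith
    then show ?thesis
    proof cases
      case 1
      then show ?thesis using X[of m] c3 d by (simp add: algebra_simps)
    next
      case 2
      then have mk: "m - 1 = k" "k + 1 = m" and "k \<noteq> m" by simp_all
      then show ?thesis using X(1,2)[of k] c1 c2 unfolding mk by (simp add: algebra_simps)
    next
      case 3
      then show ?thesis using X[of k] by simp
    qed
  qed
  then show ?thesis using fin unfolding region_def mem_Collect_eq Let_def X' p_def[symmetric] by simp
qed

section \<open>Stability of the region under the operators \<open>f_i\<close>\<close>

lemma sigmaP_wtP_low:
  assumes "finite (supp z)"
  shows "sigmaP a1 a2 1 z + wtP a1 a2 1 z = - z 1"
    and "sigmaP a1 a2 2 z + wtP a1 a2 2 z = - z 2 + a2 * z 1"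
proof -
  let ?T = "\<lambda>i t. \<Sum>j\<in>{j. t < j \<and> z j \<noteq> 0}. cartan a1 a2 i (idx j) * z j"
  have w: "wtP a1 a2 i z = - ?T i 0" for i
    unfolding wtP_def by (intro arg_cong[of _ _ uminus] sum.cong) (auto simp: mult.commute)
  \<comment> \<open>Signature and weight contain the same sum over later entries with opposite
    signs, so only entries up to the position survive.\<close>
  have T0: "?T i 0 = cartan a1 a2 i (idx 1) * z 1 + ?T i 1" for i
    by (rule sum_supp_split[OF assms]) auto
  have T1: "?T i 1 = cartan a1 a2 i (idx 2) * z 2 + ?T i 2" for i
    by (rule sum_supp_split[OF assms]) auto
  have s: "sigmaP a1 a2 1 z = z 1 + ?T 1 1" "sigmaP a1 a2 2 z = z 2 + ?T 2 2"
    by (simp_all add: sigmaP_def idx_def)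
  show "sigmaP a1 a2 1 z + wtP a1 a2 1 z = - z 1"
    unfolding s w T0 by (simp add: cartan_def idx_def)
  show "sigmaP a1 a2 2 z + wtP a1 a2 2 z = - z 2 + a2 * z 1"
    unfolding s w T0 T1 by (simp add: cartan_def idx_def)
qed

text \<open>For \<open>m \<ge> 3\<close> the position \<open>m - 2\<close> loses against
  \<open>m\<close> within the left factor. For \<open>m = 1\<close> and \<open>m = 2\<close> the
  competitor \<open>m - 2\<close> lies in the right factor, and the strict test of the tensor rule
  supplies the same inequality.\<close>

lemma region_fP:
  assumes a: "1 \<le> a1" "1 \<le> a2" "a1 * a2 > 4" and z: "glue U (flip V) \<in> region a1 a2 k1 k2"
    and fin: "finite (supp U)" "finite (supp V)" and i: "i \<in> {1, 2}"
    and left: "sigP a1 a2 i U + wtP a1 a2 i U + pairw i (k1, - k2) > sigP a2 a1 (3 - i) V + wtP a2 a1 (3 - i) V"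
  shows "glue (fP a1 a2 i U) (flip V) \<in> region a1 a2 k1 k2"
proof -
  obtain m where m: "1 \<le> m" "idx m = i" and f: "fP a1 a2 i U = U(m := U m + 1)"
    and sm: "sigmaP a1 a2 m U = sigP a1 a2 i U"
    and l: "\<And>k. 1 \<le> k \<Longrightarrow> k < m \<Longrightarrow> idx k = i \<Longrightarrow> sigmaP a1 a2 k U < sigP a1 a2 i U"
    using fP_at[OF fin(1) i] by metis
  let ?z = "glue U (flip V)"
  have p: "pseq a1 a2 k1 k2 0 = k2" "pseq a1 a2 k1 k2 1 = k1"
    "pseq a1 a2 k1 k2 (- 1) = a1 * k2 - k1"
    by (simp_all add: pseq_def numeral_2_eq_2)
  have key: "Xval a1 a2 k1 k2 ?z m + 1 \<le>
      acoef a1 a2 (m - 1) * Xval a1 a2 k1 k2 ?z (m - 1) - Xval a1 a2 k1 k2 ?z (m - 2)"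
  proof -
    consider "m = 1" | "m = 2" | "3 \<le> m" using m by linarith
    then show ?thesis
    proof cases
      case 1
      then have i1: "i = 1" using m by (simp add: idx_def)
      have "sigmaP a2 a1 2 V \<le> sigP a2 a1 2 V"
        using tmax_ge[OF fin(2), of 1 2 2 a2 a1] by (simp add: sigP_tmax idx_def)
      then have "- V 2 + a1 * V 1 < - U 1 + k1"
        using left sigmaP_wtP_low(2)[OF fin(2), of a2 a1] sigmaP_wtP_low(1)[OF fin(1), of a1 a2] sm 1
        unfolding i1 by (simp add: pairw_def)
      then show ?thesis using 1 p by (simp add: Xval_def glue_def flip_def acoef_def algebra_simps)
    next
      case 2
      then have i1: "i = 2" using m by (simp add: idx_def)
      have "sigmaP a2 a1 1 V \<le> sigP a2 a1 1 V"
        using tmax_ge[OF fin(2), of 1 1 1 a2 a1] by (simp add: sigP_tmax idx_def)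
      then have "- V 1 < - U 2 + a2 * U 1 - k2"
        using left sigmaP_wtP_low(1)[OF fin(2), of a2 a1] sigmaP_wtP_low(2)[OF fin(1), of a1 a2] sm 2
        unfolding i1 by (simp add: pairw_def)
      then show ?thesis using 2 p by (simp add: Xval_def glue_def flip_def acoef_def algebra_simps)
    next
      case 3
      then have "sigmaP a1 a2 (m - 2) U < sigmaP a1 a2 m U" using l[of "m - 2"] m sm by simp
      then show ?thesis using sigmaP_diff[OF fin(1), of a1 a2 "m - 2"] 3
        by (simp add: Xval_def glue_def algebra_simps)
    qed
  qed
  show ?thesis
    using region_step[OF a z key] m by (simp add: f glue_upd glue_val)
qed

text \<open>Position \<open>m\<close> of \<open>V\<close> is index \<open>1 - m\<close> of the
  element. The strict drop of the signature is a linear inequality in three entries, and adding the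
  recursion of \<open>p\<close> replaces these entries by the values \<open>X\<close>.\<close>

lemma region_eP:
  assumes a: "1 \<le> a1" "1 \<le> a2" "a1 * a2 > 4" and z: "glue U (flip V) \<in> region a1 a2 k1 k2"
    and fin: "finite (supp U)" "finite (supp V)" and i: "i \<in> {1, 2}"
    and e: "eP a2 a1 i V = Some V'"
  shows "glue U (flip V') \<in> region a1 a2 k1 k2"
proof -
  have "0 < sigP a2 a1 i V" using e by (auto simp: eP_def split: if_splits)
  then obtain m where m: "1 \<le> m" and f: "V' = V(m := V m - 1)"
    and sm: "sigmaP a2 a1 (m + 2) V < sigmaP a2 a1 m V"
    using eP_cases[OF fin(2) i] e by (metis option.inject)
  let ?z = "glue U (flip V)"
  define n where "n = 1 - m"
  have "0 < V m - acoef a2 a1 (m + 1) * V (m + 1) + V (m + 2)"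
    using sm sigmaP_diff[OF fin(2), of a2 a1 m] by simp
  moreover have "acoef a2 a1 (m + 1) = acoef a1 a2 (n - 1)" by (simp add: acoef_def n_def)
  moreover have "?z n = - V m" "?z (n - 1) = - V (m + 1)" "?z (n - 2) = - V (m + 2)"
    using m by (simp_all add: glue_def flip_def n_def add.commute)
  moreover have "pseq a1 a2 k1 k2 n + pseq a1 a2 k1 k2 (n - 2) = acoef a1 a2 (n - 1) * pseq a1 a2 k1 k2 (n - 1)"
    using pseq_rec[of a1 a2 k1 k2 "n - 1"] by simp
  moreover have "n \<le> 0" using m by (simp add: n_def)
  ultimately have key: "Xval a1 a2 k1 k2 ?z n + 1 \<le>
      acoef a1 a2 (n - 1) * Xval a1 a2 k1 k2 ?z (n - 1) - Xval a1 a2 k1 k2 ?z (n - 2)"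
    by (simp add: Xval_def right_diff_distrib)
  have "?z(n := ?z n + 1) = glue U (flip V')"
    using m by (auto simp: f fun_eq_iff glue_def flip_def n_def)
  with region_step[OF a z key] show ?thesis by simp
qed

section \<open>Clearing the right tensor factor\<close>

lemma fpath_Cons: "ftil a1 a2 j b = Some c \<Longrightarrow> fpath a1 a2 (j # js) b = fpath a1 a2 js c"
  by (simp add: fpath_def)

lemma fpath_append: "fpath a1 a2 js b = Some c \<Longrightarrow> fpath a1 a2 (js @ ks) b = fpath a1 a2 ks c"
  by (simp add: fpath_def)

text \<open>While \<open>f_i\<close> acts on the left factor, its \<open>\<phi>_i\<close> drops by 1
  each time and the right factor stays fixed. After finitely many steps \<open>f_i\<close> acts on
  the right factor, where positive \<open>\<epsilon>_{3-i}\<close> of the flipped copy keeps the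
  result nonzero.\<close>

lemma fpath_shrink_right:
  assumes a: "1 \<le> a1" "1 \<le> a2" "a1 * a2 > 4" and i: "i \<in> {1, 2}"
    and V: "finite (supp V)" "\<And>k. k \<le> 0 \<Longrightarrow> V k = 0" "0 < sigP a2 a1 (3 - i) V"
    and "U \<in> ImP a1 a2" "glue U (flip V) \<in> region a1 a2 k1 k2"
  shows "\<exists>js U' V'. set js \<subseteq> {1, 2} \<and> fpath a1 a2 js (el U V (k1, - k2)) = Some (el U' V' (k1, - k2)) \<and>
    U' \<in> ImP a1 a2 \<and> glue U' (flip V') \<in> region a1 a2 k1 k2 \<and> finite (supp V') \<and>
    (\<forall>k\<le>0. V' k = 0) \<and> ztotal V' = ztotal V - 1"
  using assms(8,9)
proof (induction "nat (sigP a1 a2 i U + wtP a1 a2 i U + pairw i (k1, - k2) - (sigP a2 a1 (3 - i) V + wtP a2 a1 (3 - i) V))"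
    arbitrary: U)
  case 0
  have fU: "finite (supp U)" using coneD(1)[OF ImP_cone[OF a 0(2)]] .
  obtain m where m: "1 \<le> m" "eP a2 a1 (3 - i) V = Some (V(m := V m - 1))"
    "fP a2 a1 (3 - i) (V(m := V m - 1)) = V"
    using eP_cases[OF V(1) swap_in[OF i] V(3)] by metis
  let ?V = "V(m := V m - 1)"
  have f: "finite (supp ?V)" using V(1) by simp
  have "ftil a1 a2 i (el U V (k1, - k2)) = Some (el U ?V (k1, - k2))"
    using 0(1) ftil_el[OF fU V(1) i, of a1 a2 "(k1, - k2)"] m(2) by simp
  then have "fpath a1 a2 [i] (el U V (k1, - k2)) = Some (el U ?V (k1, - k2))"
    by (simp add: fpath_def)
  moreover have "glue U (flip ?V) \<in> region a1 a2 k1 k2"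
    using region_eP[OF a 0(3) fU V(1) swap_in[OF i] m(2)] .
  moreover have "ztotal ?V = ztotal V - 1" using ztotal_fP[OF f, of a2 a1 "3 - i"] m(3) by simp
  moreover have "\<forall>k\<le>0. ?V k = 0" using V(2) m(1) by simp
  moreover have "set [i] \<subseteq> {1, 2}" using i by simp
  ultimately show ?case using 0(2) f by blast
next
  case (Suc n)
  have fU: "finite (supp U)" using coneD(1)[OF ImP_cone[OF a Suc(3)]] .
  let ?U = "fP a1 a2 i U"
  have left: "sigP a1 a2 i U + wtP a1 a2 i U + pairw i (k1, - k2) > sigP a2 a1 (3 - i) V + wtP a2 a1 (3 - i) V"
    using Suc(2) by linarith
  have U: "?U \<in> ImP a1 a2" using Suc(3) i by (rule ImP.step)
  have R: "glue ?U (flip V) \<in> region a1 a2 k1 k2" using region_fP[OF a Suc(4) fU V(1) i left] .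
  have n: "n = nat (sigP a1 a2 i ?U + wtP a1 a2 i ?U + pairw i (k1, - k2) - (sigP a2 a1 (3 - i) V + wtP a2 a1 (3 - i) V))"
    using Suc(2) sigP_fP[OF fU i, of a1 a2] wtP_fP[OF fU i, of a1 a2 i] by simp
  obtain js U' V' where IH: "set js \<subseteq> {1, 2}" "fpath a1 a2 js (el ?U V (k1, - k2)) = Some (el U' V' (k1, - k2))"
    and rest: "U' \<in> ImP a1 a2 \<and> glue U' (flip V') \<in> region a1 a2 k1 k2 \<and> finite (supp V') \<and>
      (\<forall>k\<le>0. V' k = 0) \<and> ztotal V' = ztotal V - 1"
    using Suc(1)[OF n U R] by blast
  have "ftil a1 a2 i (el U V (k1, - k2)) = Some (el ?U V (k1, - k2))"
    using left ftil_el[OF fU V(1) i, of a1 a2 "(k1, - k2)"] by simp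
  then have "fpath a1 a2 (i # js) (el U V (k1, - k2)) = Some (el U' V' (k1, - k2))"
    using IH(2) fpath_Cons by simp
  moreover have "set (i # js) \<subseteq> {1, 2}" using IH(1) i by simp
  ultimately show ?case using rest by blast
qed

lemma fpath_clear_right:
  assumes a: "1 \<le> a1" "1 \<le> a2" "a1 * a2 > 4"
    and "finite (supp V)" "\<forall>k\<le>0. V k = 0" "U \<in> ImP a1 a2" "glue U (flip V) \<in> region a1 a2 k1 k2"
  shows "\<exists>js U'. set js \<subseteq> {1, 2} \<and> fpath a1 a2 js (el U V (k1, - k2)) = Some (el U' (\<lambda>_. 0) (k1, - k2)) \<and>
    U' \<in> ImP a1 a2 \<and> glue U' (flip (\<lambda>_. 0)) \<in> region a1 a2 k1 k2"
  using assms(4-7)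
proof (induction "nat (ztotal V)" arbitrary: U V rule: less_induct)
  case less
  \<comment> \<open>Non-negativity of \<open>V\<close> at \<open>k \<ge> 1\<close> is
    \<open>Q \<ge> 0\<close> at the index \<open>1 - k\<close>.\<close>
  have nn: "0 \<le> V k" for k
  proof (cases "k \<le> 0")
    case False
    have "0 \<le> pseq a1 a2 k1 k2 (1 - k) - Xval a1 a2 k1 k2 (glue U (flip V)) (1 - k)"
      using less.prems(4) by (simp add: region_def Let_def)
    then show ?thesis using False by (simp add: Xval_def glue_def flip_def)
  qed (use less.prems(2) in simp)
  show ?case
  proof (cases "V = (\<lambda>_. 0)")
    case True
    then have "fpath a1 a2 [] (el U V (k1, - k2)) = Some (el U (\<lambda>_. 0) (k1, - k2))" by (simp add: fpath_def)
    moreover have "set [] \<subseteq> {1, 2 :: int}" by simp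
    ultimately show ?thesis using less.prems(3,4) True by blast
  next
    case False
    then obtain i where i: "i \<in> {1, 2}" "sigP a2 a1 i V \<noteq> 0"
      using sigP_zero_imp_zero[OF less.prems(1) _ nn, of a2 a1] less.prems(2) by blast
    then have s: "0 < sigP a2 a1 (3 - (3 - i)) V" using sigP_nonneg[OF less.prems(1) i(1), of a2 a1] by simp
    obtain js U' V' where js: "set js \<subseteq> {1, 2}" "fpath a1 a2 js (el U V (k1, - k2)) = Some (el U' V' (k1, - k2))"
      and V': "U' \<in> ImP a1 a2" "glue U' (flip V') \<in> region a1 a2 k1 k2" "finite (supp V')"
        "\<forall>k\<le>0. V' k = 0" "ztotal V' = ztotal V - 1"
      using fpath_shrink_right[OF a swap_in[OF i(1)] less.prems(1) _ s less.prems(3,4)] less.prems(2) by blast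
    have "V k \<noteq> 0 \<Longrightarrow> V k \<le> ztotal V" for k
      unfolding ztotal_def by (rule member_le_sum) (use nn less.prems(1) in \<open>auto simp: supp_def\<close>)
    moreover obtain k where "V k \<noteq> 0" using False by blast
    ultimately have "0 < ztotal V" using nn[of k] by fastforce
    then have "nat (ztotal V') < nat (ztotal V)" using V'(5) by simp
    then obtain ks U'' where ks: "set ks \<subseteq> {1, 2}" "fpath a1 a2 ks (el U' V' (k1, - k2)) = Some (el U'' (\<lambda>_. 0) (k1, - k2))"
      and U'': "U'' \<in> ImP a1 a2 \<and> glue U'' (flip (\<lambda>_. 0)) \<in> region a1 a2 k1 k2"
      using less.hyps[OF _ V'(3,4,1,2)] by blast
    have "fpath a1 a2 (js @ ks) (el U V (k1, - k2)) = Some (el U'' (\<lambda>_. 0) (k1, - k2))"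
      using fpath_append[OF js(2)] ks(2) by simp
    moreover have "set (js @ ks) \<subseteq> {1, 2}" using js(1) ks(1) by simp
    ultimately show ?thesis using U'' by blast
  qed
qed

text \<open>The growth estimate is used for the starred element and for the one with exchanged
  factors. In the latter \<open>X\<close> and \<open>Q\<close> trade places under
  \<open>k \<mapsto> 1 - k\<close>.\<close>

lemma extremal_star_region:
  assumes a: "1 \<le> a1" "1 \<le> a2" "a1 * a2 > 4" and lam: "lam_cond a1 a2 k1 k2"
    and u: "u \<in> ImP a1 a2" and x: "x \<in> ImP a2 a1"
    and ext: "extremal a1 a2 (star a1 a2 (el u x (k1, - k2)))"
  shows "glue u (flip x) \<in> region a1 a2 k1 k2"
proof -
  have a': "a2 * a1 > 4" using a(3) by (simp add: mult.commute)
  note uc = coneD[OF ImP_cone[OF a u]] and xc = coneD[OF ImP_cone[OF a(2,1) a' x]]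
  let ?z = "glue u (flip x)"
  define p where "p = pseq a1 a2 k1 k2"
  have plus: "plusPart ?z = u" using uc(2) by (auto simp: plusPart_def glue_def)
  have minus: "minusPart ?z = flip x" using xc(2) by (auto simp: minusPart_def glue_def flip_def)
  define mu where "mu = (- k1 - wtP a1 a2 1 ?z - wtM a1 a2 1 ?z, k2 - wtP a1 a2 2 ?z - wtM a1 a2 2 ?z)"
  have fx: "finite (supp (flip x))" using xc(1) by simp
  have st: "star a1 a2 (el u x (k1, - k2)) = el (starP a1 a2 u) (starP a2 a1 x) mu"
    using plus minus starM_flip[OF fx, of a1 a2] by (simp add: star_def Let_def el_def mu_def)
  let ?b = "el (starP a1 a2 u) (starP a2 a1 x) mu"
  have ext': "extremal a1 a2 ?b" using ext st by simp
  \<comment> \<open>The starred element has weight \<open>-\<lambda>\<close>, because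
    \<open>starP\<close> preserves weights in both factors; hence the pairings
    \<open>k2 = p_0\<close> and \<open>-k1 = -p_1\<close>.\<close>
  have wt: "wtT a1 a2 2 ?b = p 0" "wtT a1 a2 1 ?b = - p 1"
    using wtP_starP[OF uc(1,3), of a1 a2] wtP_starP[OF xc(1,3), of a2 a1]
    by (simp_all add: wtT_el mu_def pairw_def wtM_flip flip_glue wtP_glue p_def pseq_def)
  have p0: "0 \<le> p k" for k using pseq_pos[OF a lam, of k] by (simp add: p_def)
  have prec: "p (k + 1) + p (k - 1) = acoef a1 a2 k * p k" for k using pseq_rec by (simp add: p_def)
  define X where "X = (\<lambda>k. if 1 \<le> k then u k else p k - x (1 - k))"
  note X = extremal_gam[OF a u x ext' p0 prec wt X_def]
  define q where "q k = p (1 - k)" for k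
  define Y where "Y = (\<lambda>k. if 1 \<le> k then x k else q k - u (1 - k))"
  let ?mu = "(- snd mu, - fst mu)"
  have fb: "finite (supp (fst ?b))"
    using starP_chain[OF a u] starP_chain[OF a(2,1) a' x] unfolding el_def fst_conv
    by (metis finite_supp_flip finite_supp_glue)
  have fl: "flip_elt ?b = el (starP a2 a1 x) (starP a1 a2 u) ?mu" by (rule flip_elt_el)
  have ext2: "extremal a2 a1 (el (starP a2 a1 x) (starP a1 a2 u) ?mu)"
    using extremal_flip[OF fb ext'] fl by simp
  have wt2: "wtT a2 a1 2 (el (starP a2 a1 x) (starP a1 a2 u) ?mu) = q 0"
    "wtT a2 a1 1 (el (starP a2 a1 x) (starP a1 a2 u) ?mu) = - q 1"
    using wtT_flip[of 1 a2 a1 ?b] wtT_flip[of 2 a2 a1 ?b] wt unfolding fl by (simp_all add: q_def)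
  have q0: "0 \<le> q k" for k using p0 by (simp add: q_def)
  have qrec: "q (k + 1) + q (k - 1) = acoef a2 a1 k * q k" for k
    using prec[of "1 - k"] by (simp add: q_def acoef_swap[of a2 a1] algebra_simps)
  note Y = extremal_gam[OF a(2,1) a' x u ext2 q0 qrec wt2 Y_def]
  have XX: "Xval a1 a2 k1 k2 ?z = X"
    by (auto simp: Xval_def X_def glue_def flip_def p_def)
  have YY: "p k - X k = Y (1 - k)" for k by (simp add: X_def Y_def q_def)
  have "finite (supp ?z)" using uc(1) fx by (rule finite_supp_glue)
  moreover have "real_of_int (p k - X k) \<le> gam a1 a2 (k + 1) * real_of_int (p (k + 1) - X (k + 1))" for k
    using Y(2)[of "- k"] unfolding YY by (simp add: gam_swap[of a2 a1] add.commute)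
  ultimately show ?thesis
    using X Y(1) unfolding region_def Let_def XX p_def[symmetric] mem_Collect_eq YY by blast
qed

theorem theorem3p4:
  fixes a1 a2 k1 k2 :: int and y :: elt
  assumes "1 \<le> a1" and "1 \<le> a2" and "a1 * a2 > 4"
    and "lam_cond a1 a2 k1 k2"
    and "y \<in> ImPsi a1 a2 (k1, - k2)"
    and "extremal a1 a2 (star a1 a2 y)"
  shows "\<exists>js x. set js \<subseteq> {1,2} \<and> x \<in> Sigma' a1 a2 k1 k2 \<and> fpath a1 a2 js y = Some x"
proof -
  note a = assms(1-3)
  have a': "a2 * a1 > 4" using a(3) by (simp add: mult.commute)
  obtain u v where y: "y = (glue u v, (k1, - k2))" and u: "u \<in> ImP a1 a2" and v: "v \<in> ImM a1 a2"
    using assms(5) by (auto simp: ImPsi_def)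
  have x: "flip v \<in> ImP a2 a1" using ImM_flip[OF v] by blast
  note xc = coneD[OF ImP_cone[OF a(2,1) a' x]]
  have yel: "y = el u (flip v) (k1, - k2)" by (simp add: y el_def)
  have R: "glue u (flip (flip v)) \<in> region a1 a2 k1 k2"
    using extremal_star_region[OF a assms(4) u x] assms(6) yel by blast
  obtain js U where js: "set js \<subseteq> {1, 2}" "fpath a1 a2 js y = Some (el U (\<lambda>_. 0) (k1, - k2))"
    and U: "U \<in> ImP a1 a2" "glue U (flip (\<lambda>_. 0)) \<in> region a1 a2 k1 k2"
    using fpath_clear_right[OF a xc(1) _ u R] xc(2) unfolding yel by blast
  \<comment> \<open>\<open>U\<close> lies in the cone and so vanishes at the indices
    \<open>k \<le> 0\<close>; cutting off there gives back \<open>U\<close> itself.\<close>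
  have "plusPart (glue U (flip (\<lambda>_. 0))) = U"
    using coneD(2)[OF ImP_cone[OF a U(1)]] by (auto simp: plusPart_def glue_def)
  moreover have "minusPart (glue U (flip (\<lambda>_. 0))) = (\<lambda>_. 0)"
    by (auto simp: minusPart_def glue_def flip_def)
  ultimately have "el U (\<lambda>_. 0) (k1, - k2) \<in> Sigma' a1 a2 k1 k2"
    using region_Sigma_set[OF U(2)] U(1) by (simp add: Sigma'_def el_def)
  with js show ?thesis by blast
qed

end
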